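(* Let $d\mu$ be a non-trivial $l\times l$ matrix-valued measure on $\mathbb R$ with $E=\operatorname{supp}(d\mu)$ compact, where $E$ has positive logarithmic capacity. Write $d\mu=M(x)\,d\mu_{\mathrm{tr}}(x)$. If $d\nu_n\to d\rho_E$ weakly, then either $\mu$ is regular, or else there is a set $S$ of capacity zero such that $\det(M(x))=0$ for $d\mu_{\mathrm{tr}}$-a.e. $x\notin S$.
   Context: Fix $l\ge1$; $^\dagger$ is the Hermitian adjoint, $\mathbf 1$ the $l\times l$ identity. Measures are positive semi-definite $l\times l$ matrix-valued on $\mathbb R$, normalized by $\mu(\mathbb R)=\mathbf 1$. With $\langle\!\langle f,g\rangle\!\rangle_R=\int f(x)^\dagger\,d\mu(x)\,g(x)$, $\mu$ is non-trivial if $\operatorname{Tr}\langle\!\langle f,f\rangle\!\rangle_R>0$ for every non-zero polynomial $f$ with $l\times l$ matrix coefficients. $\mu_{\mathrm{tr}}(X)=\operatorname{Tr}(\mu(X))$ is the trace measure and $M(x)$ is the positive semi-definite matrix-valued Radon–Nikodym density of $\mu$ with respect to $\mu_{\mathrm{tr}}$. $(p_n^R)_{n\ge0}$ are right orthonormal matrix polynomials: $\deg p_n^R=n$, $p_0^R=\mathbf 1$, $\langle\!\langle p_n^R,p_m^R\rangle\!\rangle_R=\delta_{nm}\mathbf 1$; $p_n^L(z)=p_n^R(\bar z)^\dagger$. The Jacobi parameters are $A_n=\langle\!\langle p_{n-1}^R,xp_n^R\rangle\!\rangle_R$, $B_n=\langle\!\langle p_{n-1}^R,xp_{n-1}^R\rangle\!\rangle_R$,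 $n\ge1$. $d\nu_n=\frac1{nl}\sum_{j=1}^{nl}\delta_{x_j^{(n)}}$, where $\{x_j^{(n)}\}_{j=1}^{nl}$ are the (real) zeros of $\det(p_n^L(x))$ counted with multiplicity. $C(E)$ is the logarithmic capacity of $E$, $d\rho_E$ its equilibrium measure. $\mu$ is called regular if $\lim_{n\to\infty}|\det(A_1\cdots A_n)|^{1/n}=C(E)^l$. *)

theory Defs
  imports "HOL-Probability.Probability" "HOL-Computational_Algebra.Polynomial"
begin

section \<open>Complex matrices\<close>

definition hadj :: "complex^'n^'m \<Rightarrow> complex^'m^'n" where
  "hadj A = (\<chi> i j. cnj (A $ j $ i))"

definition qform :: "complex^'l^'l \<Rightarrow> complex^'l \<Rightarrow> complex" where
  "qform A v = (\<Sum>i\<in>UNIV. \<Sum>j\<in>UNIV. cnj (v $ i) * A $ i $ j * v $ j)"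

definition psd :: "complex^'l^'l \<Rightarrow> bool" where
  "psd A \<longleftrightarrow> hadj A = A \<and> (\<forall>v. 0 \<le> Re (qform A v))"


section \<open>Matrix-valued measures\<close>

text \<open>A matrix-valued measure is a set function; only its values on Borel sets matter.\<close>

definition matrix_measure :: "(real set \<Rightarrow> complex^'l^'l) \<Rightarrow> bool" where
  "matrix_measure \<mu> \<longleftrightarrow>
     (\<forall>X\<in>sets borel. psd (\<mu> X)) \<and>
     (\<forall>X::nat \<Rightarrow> real set. range X \<subseteq> sets borel \<longrightarrow> disjoint_family X \<longrightarrow>
        (\<lambda>n. \<mu> (X n)) sums \<mu> (\<Union>n. X n)) \<and>
     \<mu> UNIV = mat 1"

definition msupport :: "(real set \<Rightarrow> complex^'l^'l) \<Rightarrow> real set" where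
  "msupport \<mu> = {x. \<forall>U. open U \<longrightarrow> x \<in> U \<longrightarrow> \<mu> U \<noteq> 0}"

definition trace_measure :: "(real set \<Rightarrow> complex^'l^'l) \<Rightarrow> real measure" where
  "trace_measure \<mu> = measure_of UNIV (sets borel) (\<lambda>X. ennreal (Re (trace (\<mu> X))))"

text \<open>\<open>d\<mu> = M d\<mu>\<^sub>t\<^sub>r\<close> with \<open>M\<close> positive semi-definite.\<close>

definition trace_density ::
    "(real set \<Rightarrow> complex^'l^'l) \<Rightarrow> (real \<Rightarrow> complex^'l^'l) \<Rightarrow> bool" where
  "trace_density \<mu> M \<longleftrightarrow>
     integrable (trace_measure \<mu>) M \<and>
     (AE x in trace_measure \<mu>. psd (M x)) \<and>
     (\<forall>X\<in>sets borel. \<mu> X = (LINT x:X|trace_measure \<mu>. M x))"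

definition quad_measure ::
    "(real set \<Rightarrow> complex^'l^'l) \<Rightarrow> complex^'l \<Rightarrow> real measure" where
  "quad_measure \<mu> v = measure_of UNIV (sets borel) (\<lambda>X. ennreal (Re (qform (\<mu> X) v)))"

text \<open>
  Integration against the complex measure \<open>\<mu>\<^sub>j\<^sub>k\<close>. The library integrates only against
  non-negative measures, so \<open>\<mu>\<^sub>j\<^sub>k\<close> is written, by polarization, as the combination
  \<open>1/4 \<Sum>\<^sub>m (-i)\<^sup>m v\<^sub>m\<^sup>\<dagger> \<mu> v\<^sub>m\<close>, \<open>v\<^sub>m = e\<^sub>j + i\<^sup>m e\<^sub>k\<close>, \<open>m < 4\<close>, of finite non-negative
  measures; see \<open>entry_integral_indicator\<close> below.
\<close>

definition entry_integral ::
    "(real set \<Rightarrow> complex^'l^'l) \<Rightarrow> 'l \<Rightarrow> 'l \<Rightarrow> (real \<Rightarrow> complex) \<Rightarrow> complex" where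
  "entry_integral \<mu> j k f =
     (1/4) * (\<Sum>m<4. (-\<i>) ^ m *
        (LINT x|quad_measure \<mu> (axis j 1 + (\<i> ^ m) *s axis k 1). f x))"

lemma qform_polarization:
  fixes A :: "complex^'l^'l"
  shows "(1/4) * (\<Sum>m<4. (-\<i>) ^ m * qform A (axis j 1 + (\<i> ^ m) *s axis k 1)) = A $ j $ k"
proof -
  have *: "qform A (axis j 1 + c *s axis k 1) =
      A $ j $ j + c * A $ j $ k + cnj c * A $ k $ j + cnj c * c * A $ k $ k" for c
  proof -
    have "qform A (axis j 1 + c *s axis k 1) = (\<Sum>a\<in>UNIV. \<Sum>b\<in>UNIV.
        (if a = j then if b = j then A $ a $ b else 0 else 0)
        + (if a = j then if b = k then A $ a $ b * c else 0 else 0)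
        + (if a = k then if b = j then cnj c * A $ a $ b else 0 else 0)
        + (if a = k then if b = k then cnj c * A $ a $ b * c else 0 else 0))"
      unfolding qform_def
      by (intro sum.cong refl) (simp add: axis_def algebra_simps)
    also have "\<dots> = A $ j $ j + A $ j $ k * c + cnj c * A $ k $ j + cnj c * A $ k $ k * c"
    proof -
      have r: "(\<Sum>a\<in>UNIV. \<Sum>b\<in>UNIV. (if a = p then if b = q then g a b else 0 else 0)) = g p q"
        for p q :: 'l and g :: "'l \<Rightarrow> 'l \<Rightarrow> complex"
      proof -
        have "(\<Sum>b\<in>UNIV. (if a = p then if b = q then g a b else 0 else 0)) =
            (if a = p then g a q else 0)" for a
          by (cases "a = p") simp_all
        then show ?thesis by simp
      qed
      show ?thesis by (simp only: sum.distrib r)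
    qed
    finally show ?thesis by (simp add: algebra_simps)
  qed
  show ?thesis
    unfolding * by (simp add: lessThan_Suc eval_nat_numeral) (simp add: algebra_simps)
qed

lemma sets_quad_measure [simp]: "sets (quad_measure \<mu> v) = sets borel"
proof -
  have "sets (quad_measure \<mu> v) = sigma_sets UNIV (sets (borel :: real measure))"
    unfolding quad_measure_def by (rule sets_measure_of) auto
  also have "\<dots> = sets borel"
    using sets.sigma_sets_eq[of "borel :: real measure"] by simp
  finally show ?thesis .
qed

lemma psd_qform_real: "psd A \<Longrightarrow> qform A v = complex_of_real (Re (qform A v))"
proof -
  assume "psd A"
  then have h: "cnj (A $ j $ i) = A $ i $ j" for i j
    by (metis (no_types, lifting) hadj_def psd_def vec_lambda_beta)
  have "cnj (qform A v) = (\<Sum>i\<in>UNIV. \<Sum>j\<in>UNIV. cnj (v $ j) * A $ j $ i * v $ i)"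
    unfolding qform_def by (simp add: h mult.commute mult.left_commute)
  also have "\<dots> = qform A v"
    unfolding qform_def by (rule sum.swap)
  finally show ?thesis
    by (simp add: complex_eq_iff)
qed

lemma emeasure_quad_measure:
  fixes \<mu> :: "real set \<Rightarrow> complex^'l^'l"
  assumes "matrix_measure \<mu>" and "X \<in> sets borel"
  shows "emeasure (quad_measure \<mu> v) X = ennreal (Re (qform (\<mu> X) v))"
proof (rule emeasure_measure_of[OF quad_measure_def])
  have lin: "bounded_linear (\<lambda>A :: complex^'l^'l. Re (qform A v))"
    unfolding qform_def
    by (intro linear_conv_bounded_linear[THEN iffD1] linearI)
      (simp_all only: vector_add_component vector_scaleR_component distrib_left distrib_right
        sum.distrib plus_complex.sel mult_scaleR_left mult_scaleR_right scaleR_complex.sel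
        scaleR_sum_right[symmetric] real_scaleR_def)
  have add: "range Y \<subseteq> sets borel \<Longrightarrow> disjoint_family Y \<Longrightarrow>
      (\<lambda>n. Re (qform (\<mu> (Y n)) v)) sums Re (qform (\<mu> (\<Union>n. Y n)) v)" for Y
    by (rule bounded_linear.sums[OF lin]) (use assms(1) in \<open>simp add: matrix_measure_def\<close>)
  have pos: "Y \<in> sets borel \<Longrightarrow> 0 \<le> Re (qform (\<mu> Y) v)" for Y
    using assms(1) by (simp add: matrix_measure_def psd_def)
  have z: "Re (qform (\<mu> {}) v) = 0"
    using sums_summable[OF add[of "\<lambda>_. {}"]] by (simp add: disjoint_family_on_def summable_const_iff)
  show "positive (sets (quad_measure \<mu> v)) (\<lambda>X. ennreal (Re (qform (\<mu> X) v)))"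
    using z by (simp add: positive_def)
  show "countably_additive (sets (quad_measure \<mu> v)) (\<lambda>X. ennreal (Re (qform (\<mu> X) v)))"
  proof (rule countably_additiveI)
    fix Y :: "nat \<Rightarrow> real set"
    assume Y: "range Y \<subseteq> sets (quad_measure \<mu> v)" "disjoint_family Y"
    show "(\<Sum>n. ennreal (Re (qform (\<mu> (Y n)) v))) = ennreal (Re (qform (\<mu> (\<Union>n. Y n)) v))"
      using Y add[of Y] pos by (subst suminf_ennreal2) (auto simp: sums_iff)
  qed
qed (use assms in auto)

lemma entry_integral_indicator:
  assumes "matrix_measure \<mu>" and X: "X \<in> sets borel"
  shows "entry_integral \<mu> j k (indicator X) = \<mu> X $ j $ k"
proof -
  have p: "psd (\<mu> X)"
    using assms by (simp add: matrix_measure_def)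
  have "(LINT x|quad_measure \<mu> v. indicator X x) = qform (\<mu> X) v" for v
  proof -
    have "(LINT x|quad_measure \<mu> v. indicator X x :: complex) =
        (LINT x|quad_measure \<mu> v. complex_of_real (indicator X x))"
      by (rule Bochner_Integration.integral_cong) (auto simp: indicator_def)
    also have "\<dots> = complex_of_real (measure (quad_measure \<mu> v) X)"
      using X by (subst integral_complex_of_real) (simp add: sets_eq_imp_space_eq[OF sets_quad_measure])
    also have "measure (quad_measure \<mu> v) X = Re (qform (\<mu> X) v)"
      using p emeasure_quad_measure[OF assms, of v] by (simp add: measure_def psd_def)
    finally show ?thesis
      using psd_qform_real[OF p, of v] by simp
  qed
  then show ?thesis
    unfolding entry_integral_def by (simp only: qform_polarization)
qed

definition mip_right :: "(real set \<Rightarrow> complex^'l^'l) \<Rightarrow>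
    (real \<Rightarrow> complex^'l^'l) \<Rightarrow> (real \<Rightarrow> complex^'l^'l) \<Rightarrow> complex^'l^'l" where
  "mip_right \<mu> f g =
     (\<chi> a b. \<Sum>j\<in>UNIV. \<Sum>k\<in>UNIV. entry_integral \<mu> j k (\<lambda>x. hadj (f x) $ a $ j * g x $ k $ b))"


section \<open>Matrix orthogonal polynomials\<close>

text \<open>
  A matrix polynomial is a polynomial with matrix coefficients, evaluated at scalars. The ring
  structure of the type \<open>poly\<close> is not used (the product of the type \<open>vec\<close> is
  componentwise, not the matrix product).
\<close>

definition mpeval :: "(complex^'l^'l) poly \<Rightarrow> complex \<Rightarrow> complex^'l^'l" where
  "mpeval p z = (\<chi> i j. \<Sum>k\<le>degree p. coeff p k $ i $ j * z ^ k)"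

abbreviation rpeval :: "(complex^'l^'l) poly \<Rightarrow> real \<Rightarrow> complex^'l^'l" where
  "rpeval p x \<equiv> mpeval p (complex_of_real x)"

definition nontrivial :: "(real set \<Rightarrow> complex^'l^'l) \<Rightarrow> bool" where
  "nontrivial \<mu> \<longleftrightarrow>
     (\<forall>f :: (complex^'l^'l) poly. f \<noteq> 0 \<longrightarrow> 0 < Re (trace (mip_right \<mu> (rpeval f) (rpeval f))))"

definition right_orthonormal ::
    "(real set \<Rightarrow> complex^'l^'l) \<Rightarrow> (nat \<Rightarrow> (complex^'l^'l) poly) \<Rightarrow> bool" where
  "right_orthonormal \<mu> p \<longleftrightarrow>
     (\<forall>n. degree (p n) = n) \<and> p 0 = [:mat 1:] \<and>
     (\<forall>n m. mip_right \<mu> (rpeval (p n)) (rpeval (p m)) = (if n = m then mat 1 else 0))"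

definition jacobi_A ::
    "(real set \<Rightarrow> complex^'l^'l) \<Rightarrow> (nat \<Rightarrow> (complex^'l^'l) poly) \<Rightarrow> nat \<Rightarrow> complex^'l^'l" where
  "jacobi_A \<mu> p n = mip_right \<mu> (rpeval (p (n - 1))) (\<lambda>x. x *\<^sub>R rpeval (p n) x)"

primrec jacobi_A_prod ::
    "(real set \<Rightarrow> complex^'l^'l) \<Rightarrow> (nat \<Rightarrow> (complex^'l^'l) poly) \<Rightarrow> nat \<Rightarrow> complex^'l^'l" where
  "jacobi_A_prod \<mu> p 0 = mat 1"
| "jacobi_A_prod \<mu> p (Suc n) = jacobi_A_prod \<mu> p n ** jacobi_A \<mu> p (Suc n)"

text \<open>\<open>mpeval_left p\<^sub>n\<^sup>R z\<close> is \<open>p\<^sub>n\<^sup>L(z)\<close>.\<close>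

definition mpeval_left :: "(complex^'l^'l) poly \<Rightarrow> complex \<Rightarrow> complex^'l^'l" where
  "mpeval_left p z = hadj (mpeval p (cnj z))"

text \<open>\<open>det p\<^sup>L\<close> as a polynomial, so that its zeros have multiplicities.\<close>

definition det_left :: "(complex^'l^'l) poly \<Rightarrow> complex poly" where
  "det_left p = det (\<chi> i j. \<Sum>k\<le>degree p. monom (cnj (coeff p k $ j $ i)) k)"

lemma poly_det_left: "poly (det_left p) z = det (mpeval_left p z)"
proof -
  have e: "poly (\<Sum>k\<le>degree p. monom (cnj (coeff p k $ j $ i)) k) z = mpeval_left p z $ i $ j" for i j
    by (simp add: mpeval_left_def mpeval_def hadj_def poly_sum poly_monom)
  show ?thesis
    unfolding det_left_def det_def by (simp add: poly_sum poly_prod e[unfolded poly_sum])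
qed

text \<open>
  The normalized zero counting measure \<open>1/(n l) \<Sum>\<^sub>x (multiplicity of x) \<delta>\<^sub>x\<close> of \<open>det p\<^sub>n\<^sup>L\<close>,
  for \<open>n \<ge> 1\<close>.
\<close>

definition zero_measure :: "(nat \<Rightarrow> (complex^'l^'l) poly) \<Rightarrow> nat \<Rightarrow> real measure" where
  "zero_measure p n =
     distr
       (density (count_space UNIV)
         (\<lambda>x. ennreal (real (order (complex_of_real x) (det_left (p n))) / real (n * CARD('l)))))
       borel (\<lambda>x. x)"


section \<open>Logarithmic capacity\<close>

definition prob_measures_on :: "real set \<Rightarrow> real measure set" where
  "prob_measures_on E = {\<rho>. real_distribution \<rho> \<and> measure \<rho> E = 1}"

text \<open>\<open>log |x - y|\<^sup>-\<^sup>1\<close>; the library's convention \<open>ln 0 = 0\<close> has to be avoided on the diagonal.\<close>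

definition log_kernel :: "real \<Rightarrow> real \<Rightarrow> ereal" where
  "log_kernel x y = (if x = y then \<infinity> else ereal (- ln \<bar>x - y\<bar>))"

text \<open>
  For \<open>\<rho>\<close> of bounded support the negative part of the kernel is bounded, so the second term is
  finite.
\<close>

definition log_energy :: "real measure \<Rightarrow> ereal" where
  "log_energy \<rho> =
     enn2ereal (\<integral>\<^sup>+x. \<integral>\<^sup>+y. e2ennreal (log_kernel x y) \<partial>\<rho> \<partial>\<rho>) -
     enn2ereal (\<integral>\<^sup>+x. \<integral>\<^sup>+y. e2ennreal (- log_kernel x y) \<partial>\<rho> \<partial>\<rho>)"

definition robin :: "real set \<Rightarrow> ereal" where
  "robin E = (INF \<rho>\<in>prob_measures_on E. log_energy \<rho>)"

text \<open>The capacity \<open>exp (- robin E)\<close> of a compact set \<open>E\<close>.\<close>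

definition log_capacity :: "real set \<Rightarrow> real" where
  "log_capacity E = (if robin E = \<infinity> then 0 else exp (- real_of_ereal (robin E)))"

text \<open>The capacity of a Borel set is the supremum of the capacities of its compact subsets.\<close>

definition capacity_zero :: "real set \<Rightarrow> bool" where
  "capacity_zero S \<longleftrightarrow>
     S \<in> sets borel \<and> (\<forall>K. compact K \<longrightarrow> K \<subseteq> S \<longrightarrow> log_capacity K = 0)"

text \<open>For \<open>E\<close> compact of positive capacity the minimizer exists and is unique.\<close>

definition equilibrium_measure :: "real set \<Rightarrow> real measure \<Rightarrow> bool" where
  "equilibrium_measure E \<rho> \<longleftrightarrow> \<rho> \<in> prob_measures_on E \<and> log_energy \<rho> = robin E"

text \<open>
  The orthonormal polynomials are unique only up to unitary right factors; the absolute value of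
  the determinant does not depend on their choice.
\<close>

definition regular_measure ::
    "(real set \<Rightarrow> complex^'l^'l) \<Rightarrow> (nat \<Rightarrow> (complex^'l^'l) poly) \<Rightarrow> bool" where
  "regular_measure \<mu> p \<longleftrightarrow>
     (\<lambda>n. root n (cmod (det (jacobi_A_prod \<mu> p n)))) \<longlonglongrightarrow> log_capacity (msupport \<mu>) ^ CARD('l)"

end

theory Submission
  imports Defs "HOL-Real_Asymp.Real_Asymp" "HOL-Computational_Algebra.Fundamental_Theorem_Algebra"
begin

text \<open>
  Write \<open>E\<close> for the support, \<open>l\<close> for the matrix size, \<open>\<kappa>\<^sub>n\<close> for the leading coefficient of \<open>p\<^sub>n\<close> and
  \<open>R = log (1 / C(E))\<close>. Since \<open>\<bar>det (A\<^sub>1 \<cdots> A\<^sub>n)\<bar> \<bar>det \<kappa>\<^sub>n\<bar> = 1\<close> and all zeros of \<open>det p\<^sub>n\<close> are real, one has at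
  every real \<open>x\<close>
    \<open>(1/n) log \<bar>det p\<^sub>n(x)\<bar> = - (1/n) log \<bar>det (A\<^sub>1 \<cdots> A\<^sub>n)\<bar> - l \<Phi>\<^sub>n(x)\<close>,
  where \<open>\<Phi>\<^sub>n\<close> is the logarithmic potential of the zero counting measure \<open>\<nu>\<^sub>n\<close>. Three facts are combined.

  Upper bound for the Jacobi parameters. The expansion of a monic scalar polynomial \<open>T\<close> of degree \<open>n\<close> times
  the identity in the orthonormal polynomials shows that \<open>\<bar>det (A\<^sub>1 \<cdots> A\<^sub>n)\<bar>\<close> is at most \<open>l!\<close> times the \<open>l\<close>-th
  power of the maximum of \<open>\<bar>T\<bar>\<close> on \<open>E\<close> (\<open>det_jacobi_A_prod_le\<close>), and near-Fekete points supply \<open>T\<close> with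
  maximum \<open>exp (n (- R + o(1)))\<close> (\<open>eventually_monic_poly_le_exp\<close>). So if \<open>\<mu>\<close> is not regular, then along a
  subsequence \<open>(1/n) log \<bar>det (A\<^sub>1 \<cdots> A\<^sub>n)\<bar>\<close> stays below \<open>- l R - \<delta>\<close> for some \<open>\<delta> > 0\<close>.

  Growth. The integrals of \<open>p\<^sub>n\<^sup>\<dagger> M p\<^sub>n\<close> are the identity, so at almost every \<open>x\<close> this matrix is bounded by
  \<open>const (n + 1)\<^sup>2\<close>; where \<open>det M(x) \<noteq> 0\<close>, \<open>\<bar>det p\<^sub>n(x)\<bar>\<close> therefore grows at most polynomially
  (\<open>AE_det_p_le\<close>). With the formula above, along the subsequence \<open>lim inf \<Phi>\<^sub>n(x) \<ge> R + \<delta>/l\<close> at almost every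
  \<open>x\<close> with \<open>det M(x) \<noteq> 0\<close>; this is used in the weaker form \<open>liminf_pot_ge\<close>.

  Potential theory. The potential of the equilibrium measure is at most \<open>R\<close> everywhere
  (\<open>equilibrium_pot_le\<close>). Therefore, as \<open>\<nu>\<^sub>n\<close> converges weakly to it, no measure of finite energy is carried
  by a set \<open>S\<close> where \<open>lim inf \<Phi>\<^sub>n\<close> exceeds \<open>R\<close> by a fixed amount (\<open>energy_infinite_of_liminf_pot\<close>). So \<open>S\<close> has
  capacity zero, and off \<open>S\<close> the determinant of \<open>M\<close> vanishes almost everywhere.

  The logarithmic kernel is shifted by a constant \<open>log D\<close> that makes it non-negative on \<open>E\<close>; energies,
  potentials and the number \<open>R\<close> in the lemmas are shifted accordingly.
\<close>

section \<open>Logarithmic potentials on the line\<close>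

text \<open>
  The kernel is the positive part of \<open>log (D / \<bar>x - y\<bar>)\<close>. On a set of diameter at most \<open>D\<close> it differs from the
  logarithmic kernel by the constant \<open>log D\<close>, and being non-negative it can be integrated in any order.
\<close>

definition lker :: "real \<Rightarrow> real \<Rightarrow> real \<Rightarrow> ennreal" where
  "lker D x y = (if x = y then \<infinity> else ennreal (ln (D / \<bar>x - y\<bar>)))"

definition tker :: "real \<Rightarrow> real \<Rightarrow> real \<Rightarrow> real \<Rightarrow> real" where
  "tker D t x y = max 0 (ln (D / max \<bar>x - y\<bar> t))"

definition pot :: "real \<Rightarrow> real measure \<Rightarrow> real \<Rightarrow> ennreal" where
  "pot D \<sigma> x = (\<integral>\<^sup>+y. lker D x y \<partial>\<sigma>)"

definition energy :: "real \<Rightarrow> real measure \<Rightarrow> ennreal" where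
  "energy D \<sigma> = (\<integral>\<^sup>+x. pot D \<sigma> x \<partial>\<sigma>)"

lemma lker_commute: "lker D x y = lker D y x"
  by (simp add: lker_def abs_minus_commute)

lemma lker_measurable [measurable (raw)]:
  assumes [measurable]: "f \<in> borel_measurable N" "g \<in> borel_measurable N"
  shows "(\<lambda>z. lker D (f z) (g z)) \<in> borel_measurable N"
  unfolding lker_def by measurable

lemma tker_measurable [measurable (raw)]:
  assumes [measurable]: "f \<in> borel_measurable N" "g \<in> borel_measurable N"
  shows "(\<lambda>z. tker D t (f z) (g z)) \<in> borel_measurable N"
  unfolding tker_def by measurable

lemma tker_nonneg: "0 \<le> tker D t x y"
  by (simp add: tker_def)

lemma tker_le: "0 < D \<Longrightarrow> 0 < t \<Longrightarrow> tker D t x y \<le> max 0 (ln (D / t))"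
  unfolding tker_def by (intro max.mono order.refl ln_mono divide_left_mono) (auto intro: divide_pos_pos mult_pos_pos simp: less_max_iff_disj)

lemma tker_antimono:
  "0 < D \<Longrightarrow> 0 < s \<Longrightarrow> s \<le> t \<Longrightarrow> tker D t x y \<le> tker D s x y"
  unfolding tker_def
  by (intro max.mono order.refl ln_mono divide_left_mono)
    (auto intro!: divide_pos_pos mult_pos_pos simp: less_max_iff_disj)

lemma tendsto_tker:
  assumes "0 < D" "0 < t" "(f \<longlongrightarrow> a) F" "(g \<longlongrightarrow> b) F"
  shows "((\<lambda>n. tker D t (f n) (g n)) \<longlongrightarrow> tker D t a b) F"
  unfolding tker_def using assms
  by (intro tendsto_intros) (auto simp: less_max_iff_disj max_def)

text \<open>
  Cutting the kernel at distance \<open>t\<close> leaves a kernel of the same family, with \<open>t\<close> in the role of \<open>D\<close>; so the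
  error of a truncation is again a potential.
\<close>

lemma lker_split:
  assumes "0 < t" "t \<le> D"
  shows "lker D x y = ennreal (tker D t x y) + lker t x y"
proof (cases "x = y")
  case True
  then show ?thesis by (simp add: lker_def)
next
  case False
  show ?thesis
  proof (cases "\<bar>x - y\<bar> \<ge> t")
    case True
    have "ln (t / \<bar>x - y\<bar>) \<le> 0"
      using True False assms by (subst ln_le_zero_iff) auto
    then show ?thesis using True False
      by (simp add: lker_def tker_def max_absorb1 ennreal_neg)
  next
    case f2: False
    have e: "ln (D / \<bar>x - y\<bar>) = ln (D / t) + ln (t / \<bar>x - y\<bar>)"
      using False assms by (simp add: ln_div)
    have "0 \<le> ln (D / t)" "0 \<le> ln (t / \<bar>x - y\<bar>)"
      using False f2 assms by auto
    then show ?thesis using f2 False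
      by (simp add: lker_def tker_def max_absorb2 e ennreal_plus)
  qed
qed

lemma lker_eq_SUP:
  assumes "0 < D"
  shows "lker D x y = (SUP m. ennreal (tker D (1 / Suc m) x y))"
proof -
  have inc: "incseq (\<lambda>m. ennreal (tker D (1 / Suc m) x y))"
    by (intro incseq_SucI ennreal_leI tker_antimono assms) (auto simp: field_simps)
  have "(\<lambda>m. ennreal (tker D (1 / Suc m) x y)) \<longlonglongrightarrow> lker D x y"
  proof (cases "x = y")
    case True
    have "filterlim (\<lambda>m. ln (D * Suc m)) at_top sequentially"
      using assms by real_asymp
    then have "filterlim (\<lambda>m. tker D (1 / Suc m) x y) at_top sequentially"
      by (rule filterlim_at_top_mono) (auto simp: tker_def True)
    then show ?thesis
      using True by (simp add: lker_def ennreal_tendsto_top_eq_at_top)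
  next
    case False
    have "(\<lambda>m. 1 / real (Suc m)) \<longlonglongrightarrow> 0" by real_asymp
    then have "eventually (\<lambda>m. 1 / real (Suc m) < \<bar>x - y\<bar>) sequentially"
      using False by (intro order_tendstoD) auto
    then have "eventually (\<lambda>m. ennreal (tker D (1 / Suc m) x y) = lker D x y) sequentially"
    proof eventually_elim
      case (elim m)
      have e: "max \<bar>x - y\<bar> (1 / real (Suc m)) = \<bar>x - y\<bar>" using elim by linarith
      show ?case using False by (simp only: lker_def tker_def e) (simp add: max_def ennreal_neg)
    qed
    then show ?thesis by (rule tendsto_eventually)
  qed
  then show ?thesis
    using LIMSEQ_unique LIMSEQ_SUP[OF inc] by blast
qed

lemma pot_eq_SUP:
  assumes "0 < D" and [measurable_cong]: "sets \<sigma> = sets borel"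
  shows "pot D \<sigma> x = (SUP m. \<integral>\<^sup>+y. ennreal (tker D (1 / Suc m) x y) \<partial>\<sigma>)"
  unfolding pot_def lker_eq_SUP[OF assms(1)]
proof (rule nn_integral_monotone_convergence_SUP)
  show "incseq (\<lambda>i y. ennreal (tker D (1 / real (Suc i)) x y))"
    by (intro incseq_SucI le_funI ennreal_leI tker_antimono assms) (auto simp: field_simps)
qed measurable

lemma energy_eq_SUP:
  assumes "0 < D" "finite_measure \<sigma>" and [measurable_cong]: "sets \<sigma> = sets borel"
  shows "energy D \<sigma> = (SUP m. \<integral>\<^sup>+x. \<integral>\<^sup>+y. ennreal (tker D (1 / Suc m) x y) \<partial>\<sigma> \<partial>\<sigma>)"
  unfolding energy_def pot_eq_SUP[OF assms(1,3)]
proof (rule nn_integral_monotone_convergence_SUP)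
  interpret finite_measure \<sigma> by fact
  show "incseq (\<lambda>i x. \<integral>\<^sup>+y. ennreal (tker D (1 / real (Suc i)) x y) \<partial>\<sigma>)"
    by (intro incseq_SucI le_funI nn_integral_mono ennreal_leI tker_antimono assms) (auto simp: field_simps)
  show "(\<lambda>x. \<integral>\<^sup>+ y. ennreal (tker D (1 / real (Suc m)) x y) \<partial>\<sigma>) \<in> borel_measurable \<sigma>" for m
    by measurable
qed

lemma pot_measurable [measurable]:
  assumes "finite_measure \<sigma>" and [measurable_cong]: "sets \<sigma> = sets borel"
  shows "pot D \<sigma> \<in> borel_measurable borel"
proof -
  interpret finite_measure \<sigma> by fact
  show ?thesis unfolding pot_def by measurable
qed

lemma nn_integral_pot_swap:
  assumes "finite_measure \<sigma>" and [measurable_cong]: "sets \<sigma> = sets borel"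
    and "finite_measure \<tau>" and [measurable_cong]: "sets \<tau> = sets borel"
  shows "(\<integral>\<^sup>+x. pot D \<sigma> x \<partial>\<tau>) = (\<integral>\<^sup>+x. pot D \<tau> x \<partial>\<sigma>)"
proof -
  interpret s: finite_measure \<sigma> by fact
  interpret t: finite_measure \<tau> by fact
  interpret pair_sigma_finite \<tau> \<sigma> ..
  show ?thesis unfolding pot_def
    by (subst Fubini'[symmetric]) (auto simp: lker_commute intro!: lker_measurable)
qed

text \<open>
  On an interval without sources the kernel is convex in \<open>x\<close>: \<open>\<bar>x - y\<bar>\<close> is affine there, so this is the
  inequality between weighted arithmetic and geometric means. On the line it takes the place of the
  maximum principle for harmonic functions.
\<close>

lemma lker_convex:
  assumes D: "0 < D" and s: "0 < s" "s < 1" and ab: "a < b" and x: "x = (1 - s) * a + s * b"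
    and y: "y \<le> a \<or> b \<le> y"
  shows "lker D x y \<le> ennreal (1 - s) * lker D a y + ennreal s * lker D b y"
proof (cases "y = a \<or> y = b")
  case True
  then show ?thesis using s by (auto simp: lker_def ennreal_mult_top)
next
  case False
  have xa: "x - a = s * (b - a)" "b - x = (1 - s) * (b - a)" using x by (simp_all add: algebra_simps)
  have axb: "a < x" "x < b"
    using xa s ab by (metis diff_gt_0_iff_gt mult_pos_pos)+
  define u where "u = \<bar>x - y\<bar>"
  define p where "p = \<bar>a - y\<bar>"
  define q where "q = \<bar>b - y\<bar>"
  have pos: "0 < u" "0 < p" "0 < q" using y axb False by (auto simp: u_def p_def q_def)
  have aff: "(1 - s) * p + s * q = u"
  proof -
    have "(1 - s) * (a - y) + s * (b - y) = x - y" using x by (simp add: algebra_simps)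
    then show ?thesis using y
    proof (elim disjE)
      assume "y \<le> a"
      then have "p = a - y" "q = b - y" "u = x - y" using axb by (auto simp: p_def q_def u_def)
      then show ?thesis using \<open>(1 - s) * (a - y) + s * (b - y) = x - y\<close> by simp
    next
      assume "b \<le> y"
      then have "p = -(a - y)" "q = -(b - y)" "u = -(x - y)" using axb by (auto simp: p_def q_def u_def)
      then have "(1 - s) * p + s * q = - ((1 - s) * (a - y) + s * (b - y))"
        by algebra
      then show ?thesis using \<open>(1 - s) * (a - y) + s * (b - y) = x - y\<close> \<open>u = -(x - y)\<close> by simp
    qed
  qed
  \<comment> \<open>The tangent of the logarithm at \<open>1\<close>; the right-hand side vanishes because \<open>u\<close> is the weighted
    mean of \<open>p\<close> and \<open>q\<close>.\<close>
  have "(1 - s) * ln (p / u) + s * ln (q / u) \<le> (1 - s) * (p / u - 1) + s * (q / u - 1)"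
    using s pos by (intro add_mono mult_left_mono ln_le_minus_one) auto
  also have "\<dots> = ((1 - s) * p + s * q) / u - 1"
    using pos by (simp add: field_simps)
  also have "\<dots> = 0" using aff pos by simp
  finally have "ln (D / u) \<le> (1 - s) * ln (D / p) + s * ln (D / q)"
    using pos D by (simp add: ln_div algebra_simps)
  also have "\<dots> \<le> (1 - s) * max 0 (ln (D / p)) + s * max 0 (ln (D / q))"
    using s by (intro add_mono mult_left_mono) auto
  finally have "ennreal (ln (D / u)) \<le> ennreal ((1 - s) * max 0 (ln (D / p)) + s * max 0 (ln (D / q)))"
    by (rule ennreal_leI)
  also have "\<dots> = ennreal (1 - s) * ennreal (max 0 (ln (D / p))) + ennreal s * ennreal (max 0 (ln (D / q)))"
    using s by (simp add: ennreal_plus ennreal_mult)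
  finally show ?thesis
    using False pos by (auto simp: lker_def u_def p_def q_def max_def ennreal_neg split: if_splits)
qed

lemma lker_antimono: "0 < D \<Longrightarrow> \<bar>a - y\<bar> \<le> \<bar>x - y\<bar> \<Longrightarrow> lker D x y \<le> lker D a y"
  unfolding lker_def
  by (auto intro!: ennreal_leI ln_mono divide_left_mono divide_pos_pos mult_pos_pos)

section \<open>Energy, equilibrium and the maximum principle\<close>

text \<open>
  The negative part of the logarithmic kernel is at most \<open>log D\<close> on \<open>K\<close>, so the two integrals in the
  definition of the energy can be recombined without meeting \<open>\<infinity> - \<infinity>\<close>.
\<close>

lemma log_energy_eq_energy:
  assumes \<sigma>: "\<sigma> \<in> prob_measures_on K" and K[measurable]: "K \<in> sets borel"
    and D: "1 \<le> D" and diam: "\<And>x y. x \<in> K \<Longrightarrow> y \<in> K \<Longrightarrow> \<bar>x - y\<bar> \<le> D"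
  shows "log_energy \<sigma> = enn2ereal (energy D \<sigma>) - ereal (ln D)"
proof -
  interpret real_distribution \<sigma> using \<sigma> by (simp add: prob_measures_on_def)
  have AEK: "AE x in \<sigma>. x \<in> K"
    using \<sigma> by (subst prob_eq_1[symmetric]) (auto simp: prob_measures_on_def)
  define p where "p x y = e2ennreal (log_kernel x y)" for x y
  define q where "q x y = e2ennreal (- log_kernel x y)" for x y
  have p_eq: "p x y = (if x = y then \<infinity> else ennreal (- ln \<bar>x - y\<bar>))"
    and q_eq: "q x y = (if x = y then 0 else ennreal (ln \<bar>x - y\<bar>))" for x y
    by (simp_all add: p_def q_def log_kernel_def e2ennreal_infty) 
      (simp_all add: e2ennreal_neg ennreal.abs_eq flip: e2ennreal_ereal)
  have [measurable]: "(\<lambda>z. p (fst z) (snd z)) \<in> borel_measurable (borel \<Otimes>\<^sub>M borel)"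
    "(\<lambda>z. q (fst z) (snd z)) \<in> borel_measurable (borel \<Otimes>\<^sub>M borel)"
    unfolding p_eq q_eq by measurable
  have [measurable]: "(\<lambda>y. p x y) \<in> borel_measurable borel" "(\<lambda>y. q x y) \<in> borel_measurable borel" for x
    unfolding p_eq q_eq by measurable
  have [measurable]: "(\<lambda>x. \<integral>\<^sup>+y. p x y \<partial>\<sigma>) \<in> borel_measurable borel"
     "(\<lambda>x. \<integral>\<^sup>+y. q x y \<partial>\<sigma>) \<in> borel_measurable borel" 
    by (measurable; simp add: split_def)+
  have pw: "p x y + ennreal (ln D) = q x y + lker D x y" if "x \<in> K" "y \<in> K" for x y
  proof (cases "x = y")
    case False
    define u where "u = \<bar>x - y\<bar>"
    have u: "0 < u" "u \<le> D" using False diam[OF that] by (auto simp: u_def)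
    then have "ln u \<le> ln D" "0 \<le> ln D" using D by auto
    then show ?thesis using False u D
      by (cases "0 \<le> ln u")
        (simp_all add: p_eq q_eq lker_def u_def[symmetric] ln_div ennreal_neg ennreal_plus[symmetric] del: ennreal_plus)
  qed (simp add: p_eq q_eq lker_def)
  have qle: "q x y \<le> ennreal (ln D)" if "x \<in> K" "y \<in> K" for x y
    using diam[OF that] D by (auto simp: q_eq intro!: ennreal_leI)
  let ?P = "\<integral>\<^sup>+x. \<integral>\<^sup>+y. p x y \<partial>\<sigma> \<partial>\<sigma>" and ?Q = "\<integral>\<^sup>+x. \<integral>\<^sup>+y. q x y \<partial>\<sigma> \<partial>\<sigma>"
  have "?P + ennreal (ln D) = (\<integral>\<^sup>+x. \<integral>\<^sup>+y. p x y + ennreal (ln D) \<partial>\<sigma> \<partial>\<sigma>)"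
    by (simp add: nn_integral_add emeasure_space_1[simplified])
  also have "\<dots> = (\<integral>\<^sup>+x. \<integral>\<^sup>+y. q x y + lker D x y \<partial>\<sigma> \<partial>\<sigma>)"
  proof (rule nn_integral_cong_AE)
    show "AE x in \<sigma>. (\<integral>\<^sup>+y. p x y + ennreal (ln D) \<partial>\<sigma>) = (\<integral>\<^sup>+y. q x y + lker D x y \<partial>\<sigma>)"
      using AEK
    proof eventually_elim
      case (elim x)
      show ?case by (intro nn_integral_cong_AE) (use AEK in eventually_elim, use elim pw in auto)
    qed
  qed
  also have "\<dots> = ?Q + energy D \<sigma>"
  proof -
    have [measurable]: "pot D \<sigma> \<in> borel_measurable borel" 
      by (rule pot_measurable) (auto simp: finite_measure_axioms)
    show ?thesis by (simp add: nn_integral_add pot_def[symmetric] energy_def)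
  qed
  finally have main: "?P + ennreal (ln D) = ?Q + energy D \<sigma>" .
  have "?Q \<le> (\<integral>\<^sup>+x. \<integral>\<^sup>+y. ennreal (ln D) \<partial>\<sigma> \<partial>\<sigma>)"
  proof (rule nn_integral_mono_AE)
    show "AE x in \<sigma>. (\<integral>\<^sup>+y. q x y \<partial>\<sigma>) \<le> (\<integral>\<^sup>+y. ennreal (ln D) \<partial>\<sigma>)"
      using AEK
    proof eventually_elim
      case (elim x)
      show ?case by (intro nn_integral_mono_AE) (use AEK in eventually_elim, use elim qle in auto)
    qed
  qed
  then have "?Q \<le> ennreal (ln D)" by (simp add: emeasure_space_1[simplified])
  then obtain b where b: "?Q = ennreal b" "0 \<le> b" by (metis ennreal_cases ennreal_neq_top top.extremum_uniqueI)
  have lD: "0 \<le> ln D" using D by simp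
  show ?thesis
  proof (cases "energy D \<sigma>")
    case (real c)
    then have "?P + ennreal (ln D) = ennreal (b + c)" using main b by simp
    moreover have "?P \<noteq> top" using calculation by auto
    then obtain a where a: "?P = ennreal a" "0 \<le> a" by (metis ennreal_cases)
    ultimately have "ennreal (a + ln D) = ennreal (b + c)" using lD by simp
    then have "a + ln D = b + c" using a b real lD by (metis add_nonneg_nonneg ennreal_inj)
    then show ?thesis
      unfolding log_energy_def p_def[symmetric] q_def[symmetric] a(1) b(1) real using a b real
      by simp
  next
    case top
    then have "?P + ennreal (ln D) = top" using main by simp
    then have "?P = top" by simp
    then show ?thesis
      unfolding log_energy_def p_def[symmetric] q_def[symmetric] top b(1) using b by (simp add: top_ereal_def)
  qed
qed

text \<open>
  The first variation of the energy. Were the potential above \<open>R\<close> on a set of positive mass, it would be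
  below \<open>R\<close> on another such set \<open>A\<close>, its mean being \<open>R\<close>; moving a little mass onto \<open>A\<close> would then lower the
  energy.
\<close>

lemma energy_minimizer_pot_le_AE:
  assumes "real_distribution \<rho>" and J: "energy D \<rho> = ennreal R" and R: "0 \<le> R"
    and min: "\<And>h. h \<in> borel_measurable borel \<Longrightarrow> (\<integral>\<^sup>+x. h x \<partial>\<rho>) = 1 \<Longrightarrow> ennreal R \<le> energy D (density \<rho> h)"
  shows "AE x in \<rho>. pot D \<rho> x \<le> ennreal R"
proof -
  interpret real_distribution \<rho> by fact
  have [measurable]: "pot D \<rho> \<in> borel_measurable borel"
    by (rule pot_measurable) (auto simp: finite_measure_axioms)
  have intpot: "(\<integral>\<^sup>+x. pot D \<rho> x \<partial>\<rho>) = ennreal R" using J by (simp add: energy_def)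
  define f where "f x = enn2real (pot D \<rho> x)" for x
  have [measurable]: "f \<in> borel_measurable borel" unfolding f_def by measurable
  have f0: "0 \<le> f x" for x by (simp add: f_def)
  have fin: "AE x in \<rho>. pot D \<rho> x = ennreal (f x)"
  proof -
    have "AE x in \<rho>. pot D \<rho> x \<noteq> \<infinity>" by (rule nn_integral_PInf_AE) (auto simp: intpot)
    then show ?thesis by eventually_elim (auto simp: f_def less_top[symmetric])
  qed
  have nnf: "(\<integral>\<^sup>+x. ennreal (f x) \<partial>\<rho>) = ennreal R"
    using intpot nn_integral_cong_AE[OF fin] by simp
  have intf: "integrable \<rho> f"
    by (rule integrableI_nonneg) (auto simp: nnf f0)
  have Ef: "expectation f = R"
    using nn_integral_eq_integral[OF intf] nnf R f0 by (simp add: integral_nonneg_AE)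
  define A where "A = {x. f x < R}"
  have [measurable]: "A \<in> sets borel" unfolding A_def by measurable
  show ?thesis
  proof (cases "prob A = 0")
    case True
    then have "AE x in \<rho>. x \<notin> A" by (subst AE_iff_measurable[OF _ refl]) (auto simp: emeasure_eq_measure)
    then have ge: "AE x in \<rho>. 0 \<le> f x - R" by eventually_elim (auto simp: A_def)
    have "AE x in \<rho>. f x - R = 0"
      using Ef intf by (subst integral_nonneg_eq_0_iff_AE[symmetric, OF _ ge]) (auto simp: prob_space[simplified])
    then show ?thesis using fin by eventually_elim auto
  next
    case False
    define a where "a = prob A"
    have a: "0 < a" using False by (simp add: a_def less_le)
    define g where "g x = ennreal (indicator A x / a)" for x
    have [measurable]: "g \<in> borel_measurable borel" unfolding g_def by measurable
    define m where "m = expectation (\<lambda>x. indicator A x / a * f x)"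
    have intAf: "integrable \<rho> (\<lambda>x. indicator A x / a * f x)"
      using integrable_mult_right[OF integrable_mult_indicator[of A \<rho> f], of "1/a"] intf by (simp add: mult.commute)
    have gint: "(\<integral>\<^sup>+x. g x \<partial>\<rho>) = 1"
    proof -
      have "(\<integral>\<^sup>+x. g x \<partial>\<rho>) = (\<integral>\<^sup>+x. ennreal (1 / a) * indicator A x \<partial>\<rho>)"
        using a by (intro nn_integral_cong) (auto simp: g_def indicator_def)
      also have "\<dots> = 1" using a by (simp add: nn_integral_cmult emeasure_eq_measure a_def[symmetric] ennreal_mult[symmetric])
      finally show ?thesis .
    qed
    have gpot: "(\<integral>\<^sup>+x. g x * pot D \<rho> x \<partial>\<rho>) = ennreal m"
    proof -
      have "(\<integral>\<^sup>+x. g x * pot D \<rho> x \<partial>\<rho>) = (\<integral>\<^sup>+x. ennreal (indicator A x / a * f x) \<partial>\<rho>)"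
        by (intro nn_integral_cong_AE) (use fin in eventually_elim, use a in \<open>simp add: g_def f0 ennreal_mult[symmetric]\<close>)
      also have "\<dots> = ennreal m"
        unfolding m_def by (rule nn_integral_eq_integral[OF intAf]) (use a in \<open>auto simp: f0\<close>)
      finally show ?thesis .
    qed
    have m0: "0 \<le> m" unfolding m_def using a f0 by (intro integral_nonneg_AE) auto
    have mR: "m < R"
    proof (rule ccontr)
      assume "\<not> m < R"
      have intA: "integrable \<rho> (\<lambda>x. indicator A x / a :: real)"
        by (rule integrable_const_bound[where B = "1 / a"]) (use a in \<open>auto simp: indicator_def\<close>)
      have iA: "integrable \<rho> (\<lambda>x. indicator A x / a * R - indicator A x / a * f x)" 
        by (intro Bochner_Integration.integrable_diff integrable_mult_left intA intAf)
      have ge: "AE x in \<rho>. 0 \<le> indicator A x / a * R - indicator A x / a * f x"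
        using a by (auto simp: indicator_def A_def divide_right_mono)
      have eq: "expectation (\<lambda>x. indicator A x / a * R - indicator A x / a * f x) = R - m"
        using a by (subst Bochner_Integration.integral_diff[OF integrable_mult_left[OF intA] intAf])
          (simp add: m_def a_def[symmetric])
      then have "expectation (\<lambda>x. indicator A x / a * R - indicator A x / a * f x) = 0"
        using integral_nonneg_AE[OF ge] \<open>\<not> m < R\<close> by simp
      then have "AE x in \<rho>. indicator A x / a * R - indicator A x / a * f x = 0"
        using integral_nonneg_eq_0_iff_AE[OF iA ge] by simp
      then have "AE x in \<rho>. x \<notin> A" by eventually_elim (use a in \<open>auto simp: indicator_def A_def divide_simps\<close>)
      then have "prob A = 0" by (subst (asm) AE_iff_measurable[OF _ refl]) (auto simp: emeasure_eq_measure)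
      then show False using False by simp
    qed
    have fg: "finite_measure (density \<rho> g)"
      by (rule finite_measureI) (simp add: emeasure_density gint)
    define G where "G = pot D (density \<rho> g)"
    have [measurable]: "G \<in> borel_measurable borel" unfolding G_def by (rule pot_measurable[OF fg]) simp
    have G_eq: "G x = (\<integral>\<^sup>+y. g y * lker D x y \<partial>\<rho>)" for x
      unfolding G_def pot_def by (subst nn_integral_density) auto
    have intG: "(\<integral>\<^sup>+x. G x \<partial>\<rho>) = ennreal m"
    proof -
      have "(\<integral>\<^sup>+x. G x \<partial>\<rho>) = (\<integral>\<^sup>+x. pot D \<rho> x \<partial>density \<rho> g)"
        unfolding G_def by (rule nn_integral_pot_swap) (auto simp: fg finite_measure_axioms)
      also have "\<dots> = ennreal m" by (subst nn_integral_density) (auto simp: gpot)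
      finally show ?thesis .
    qed
    have ga: "g x \<le> ennreal (1 / a)" for x using a by (auto simp: g_def indicator_def)
    have "(\<integral>\<^sup>+x. g x * G x \<partial>\<rho>) \<le> (\<integral>\<^sup>+x. ennreal (1 / a) * G x \<partial>\<rho>)"
      by (intro nn_integral_mono mult_right_mono ga) auto
    also have "\<dots> = ennreal (m / a)" using a m0 by (simp add: nn_integral_cmult intG ennreal_mult[symmetric])
    finally obtain w where w: "(\<integral>\<^sup>+x. g x * G x \<partial>\<rho>) = ennreal w" "0 \<le> w"
      by (metis ennreal_cases ennreal_neq_top top.extremum_uniqueI)
    \<comment> \<open>The energy of \<open>(1 - t) + t g\<close> is \<open>R - 2 t (R - m) + t\<^sup>2 (R - 2 m + w)\<close>; this \<open>t\<close> makes the linear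
      term dominate.\<close>
    define t where "t = min (1/2) ((R - m) / (\<bar>R - 2 * m + w\<bar> + 1))"
    have t: "0 < t" using mR by (auto simp: t_def)
    have t2: "t \<le> 1/2" unfolding t_def by (rule min.cobounded1)
    note t = t t2
    define h where "h x = ennreal (1 - t) + ennreal t * g x" for x
    have [measurable]: "h \<in> borel_measurable borel" unfolding h_def by measurable
    have hint: "(\<integral>\<^sup>+x. h x \<partial>\<rho>) = 1"
      using t by (simp add: h_def nn_integral_add nn_integral_cmult gint emeasure_space_1[simplified] ennreal_plus[symmetric] del: ennreal_plus)
    have poth: "pot D (density \<rho> h) x = ennreal (1 - t) * pot D \<rho> x + ennreal t * G x" for x
    proof -
      have "pot D (density \<rho> h) x = (\<integral>\<^sup>+y. h y * lker D x y \<partial>\<rho>)"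
        unfolding pot_def by (subst nn_integral_density) auto
      also have "\<dots> = (\<integral>\<^sup>+y. ennreal (1 - t) * lker D x y + ennreal t * (g y * lker D x y) \<partial>\<rho>)"
        by (simp add: h_def distrib_right mult.assoc)
      also have "\<dots> = ennreal (1 - t) * pot D \<rho> x + ennreal t * G x"
        by (simp add: nn_integral_add nn_integral_cmult pot_def G_eq)
      finally show ?thesis .
    qed
    have "ennreal R \<le> energy D (density \<rho> h)" by (rule min) (auto simp: hint)
    also have "\<dots> = (\<integral>\<^sup>+x. h x * (ennreal (1 - t) * pot D \<rho> x + ennreal t * G x) \<partial>\<rho>)"
      unfolding energy_def poth by (subst nn_integral_density) auto
    also have "\<dots> = (\<integral>\<^sup>+x. ennreal (1 - t) * ennreal (1 - t) * pot D \<rho> x + ennreal (1 - t) * ennreal t * G x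
        + (ennreal t * ennreal (1 - t) * (g x * pot D \<rho> x) + ennreal t * ennreal t * (g x * G x)) \<partial>\<rho>)"
      by (intro nn_integral_cong) (simp add: h_def distrib_left distrib_right mult_ac add_ac)
    also have "\<dots> = ennreal (1 - t) * ennreal (1 - t) * ennreal R + ennreal (1 - t) * ennreal t * ennreal m
        + (ennreal t * ennreal (1 - t) * ennreal m + ennreal t * ennreal t * ennreal w)"
      by (simp add: nn_integral_add nn_integral_cmult intpot intG gpot w)
    also have "\<dots> = ennreal ((1 - t) * (1 - t) * R + (1 - t) * t * m + (t * (1 - t) * m + t * t * w))"
      using t m0 R w by (simp add: ennreal_mult[symmetric] ennreal_plus[symmetric] del: ennreal_plus)
    finally have "R \<le> (1 - t) * (1 - t) * R + (1 - t) * t * m + (t * (1 - t) * m + t * t * w)"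
      using t m0 R w by (subst (asm) ennreal_le_iff) auto
    then have "t * (2 * (R - m)) \<le> t * (t * (R - 2 * m + w))" by (simp add: algebra_simps)
    then have "2 * (R - m) \<le> t * (R - 2 * m + w)" using t by simp
    also have "\<dots> \<le> t * (\<bar>R - 2 * m + w\<bar> + 1)" using t by (intro mult_left_mono) auto
    also have "\<dots> \<le> R - m"
    proof -
      have "t \<le> (R - m) / (\<bar>R - 2 * m + w\<bar> + 1)" by (simp add: t_def)
      then show ?thesis by (subst (asm) pos_le_divide_eq) auto
    qed
    finally show ?thesis using mR by simp
  qed
qed

lemma isCont_integral_tker:
  assumes "finite_measure \<sigma>" and [measurable_cong]: "sets \<sigma> = sets borel" and D: "0 < D" "0 < t"
  shows "isCont (\<lambda>x. LINT y|\<sigma>. tker D t x y) x"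
proof -
  interpret finite_measure \<sigma> by fact
  show ?thesis unfolding continuous_at_sequentially
  proof (intro allI impI)
    fix u assume u: "u \<longlonglongrightarrow> x"
    show "((\<lambda>x. LINT y|\<sigma>. tker D t x y) \<circ> u) \<longlonglongrightarrow> (LINT y|\<sigma>. tker D t x y)"
      unfolding o_def
    proof (rule integral_dominated_convergence[where w = "\<lambda>_. max 0 (ln (D / t))"])
      show "AE y in \<sigma>. (\<lambda>i. tker D t (u i) y) \<longlonglongrightarrow> tker D t x y"
        using D u by (intro AE_I2 tendsto_tker) auto
      show "AE y in \<sigma>. norm (tker D t (u i) y) \<le> max 0 (ln (D / t))" for i
        using tker_le[OF D] tker_nonneg by simp
    qed auto
  qed
qed

lemma nn_integral_tker:
  assumes "finite_measure \<sigma>" and [measurable_cong]: "sets \<sigma> = sets borel" and D: "0 < D" "0 < t"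
  shows "(\<integral>\<^sup>+y. ennreal (tker D t x y) \<partial>\<sigma>) = ennreal (LINT y|\<sigma>. tker D t x y)"
proof -
  interpret finite_measure \<sigma> by fact
  have "integrable \<sigma> (tker D t x)"
    by (rule integrable_const_bound[where B = "max 0 (ln (D / t))"]) (auto simp: tker_le[OF D] tker_nonneg)
  then show ?thesis by (intro nn_integral_eq_integral) (auto simp: tker_nonneg)
qed

lemma closed_pot_le:
  assumes "finite_measure \<rho>" and [measurable_cong]: "sets \<rho> = sets borel" and D: "0 < D" and R: "0 \<le> R"
  shows "closed {x. pot D \<rho> x \<le> ennreal R}"
proof -
  have "{x. pot D \<rho> x \<le> ennreal R} = (\<Inter>m. {x. (LINT y|\<rho>. tker D (1 / Suc m) x y) \<le> R})"
    using D R assms by (auto simp: pot_eq_SUP SUP_le_iff nn_integral_tker ennreal_le_iff)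
  also have "closed \<dots>"
    by (intro closed_INT ballI closed_Collect_le continuous_at_imp_continuous_on isCont_integral_tker)
      (auto simp: assms)
  finally show ?thesis .
qed

text \<open>
  The maximum principle. The set \<open>P\<close> where the potential is at most \<open>R\<close> is closed and carries \<open>\<rho>\<close>, so each
  gap of \<open>P\<close> is free of mass. In a bounded gap convexity bounds the potential by its values at the end
  points, which lie in \<open>P\<close>; in an unbounded gap the potential decreases away from the end point.
\<close>

lemma pot_le_of_AE:
  assumes "real_distribution \<rho>" and D: "0 < D" and R: "0 \<le> R" and AE: "AE x in \<rho>. pot D \<rho> x \<le> ennreal R"
  shows "pot D \<rho> x \<le> ennreal R"
proof -
  interpret real_distribution \<rho> by fact
  define P where "P = {x. pot D \<rho> x \<le> ennreal R}"
  have cl: "closed P"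
    unfolding P_def by (rule closed_pot_le[OF _ _ D R]) (auto simp: finite_measure_axioms)
  have AEP: "AE y in \<rho>. y \<in> P" using AE by (simp add: P_def)
  have "P \<noteq> {}" using AEP AE_False by auto
  show ?thesis
  proof (rule ccontr)
    assume "\<not> pot D \<rho> x \<le> ennreal R"
    then have xP: "x \<notin> P" by (simp add: P_def)
    let ?L = "P \<inter> {..x}" and ?U = "P \<inter> {x..}"
    have a: "Sup ?L \<in> P \<and> Sup ?L < x \<and> (\<forall>y\<in>P. y \<le> Sup ?L \<or> x < y)" if "?L \<noteq> {}"
    proof -
      have "Sup ?L \<in> ?L" using that cl by (intro closed_contains_Sup) auto
      moreover have "y \<le> Sup ?L \<or> x < y" if "y \<in> P" for y
        using that by (cases "y \<le> x") (auto intro!: cSup_upper)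
      ultimately show ?thesis using xP by (auto simp: less_le)
    qed
    have b: "Inf ?U \<in> P \<and> x < Inf ?U \<and> (\<forall>y\<in>P. Inf ?U \<le> y \<or> y < x)" if "?U \<noteq> {}"
    proof -
      have "Inf ?U \<in> ?U" using that cl by (intro closed_contains_Inf) auto
      moreover have "Inf ?U \<le> y \<or> y < x" if "y \<in> P" for y
        using that by (cases "x \<le> y") (auto intro!: cInf_lower)
      ultimately show ?thesis using xP by (auto simp: less_le)
    qed
    have one: False if "c \<in> P" and "AE y in \<rho>. \<bar>c - y\<bar> \<le> \<bar>x - y\<bar>" for c
    proof -
      have "pot D \<rho> x \<le> pot D \<rho> c" unfolding pot_def
        by (intro nn_integral_mono_AE) (use that(2) in eventually_elim, rule lker_antimono[OF D])
      then show False using that xP by (auto simp: P_def)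
    qed
    consider "?L = {}" "?U \<noteq> {}" | "?L \<noteq> {}" "?U = {}" | "?L \<noteq> {}" "?U \<noteq> {}"
      using \<open>P \<noteq> {}\<close> by fastforce
    then show False
    proof cases
      case 1
      show False
        by (rule one[of "Inf ?U"]) (use b 1 in blast, use AEP in eventually_elim, use b 1 in force)
    next
      case 2
      show False
        by (rule one[of "Sup ?L"]) (use a 2 in blast, use AEP in eventually_elim, use a 2 in force)
    next
      case 3
      define a' where "a' = Sup ?L"
      define b' where "b' = Inf ?U"
      note a' = a[OF 3(1), folded a'_def] and b' = b[OF 3(2), folded b'_def]
      define s where "s = (x - a') / (b' - a')"
      have s: "0 < s" "s < 1" using a' b' by (auto simp: s_def)
      have xs: "x = (1 - s) * a' + s * b'"
      proof -
        have "s * (b' - a') = x - a'" using a' b' by (auto simp: s_def)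
        then show ?thesis by (simp add: algebra_simps)
      qed
      have "pot D \<rho> x \<le> (\<integral>\<^sup>+y. ennreal (1 - s) * lker D a' y + ennreal s * lker D b' y \<partial>\<rho>)"
        unfolding pot_def
      proof (intro nn_integral_mono_AE)
        show "AE y in \<rho>. lker D x y \<le> ennreal (1 - s) * lker D a' y + ennreal s * lker D b' y"
          using AEP
        proof eventually_elim
          case (elim y)
          have "y \<le> a' \<or> b' \<le> y" using a' b' elim by force
          then show ?case using a' b' xs s D by (intro lker_convex) auto
        qed
      qed
      also have "\<dots> = ennreal (1 - s) * pot D \<rho> a' + ennreal s * pot D \<rho> b'"
        by (simp add: nn_integral_add nn_integral_cmult pot_def)
      also have "\<dots> \<le> ennreal (1 - s) * ennreal R + ennreal s * ennreal R"
        using a' b' by (intro add_mono mult_left_mono) (auto simp: P_def)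
      also have "\<dots> = ennreal R"
        using s R by (simp add: ennreal_mult[symmetric] ennreal_plus[symmetric] del: ennreal_plus)
          (simp add: algebra_simps)
      finally show False using xP by (simp add: P_def)
    qed
  qed
qed

section \<open>The lower envelope of potentials of weakly convergent measures\<close>

lemma pot_split:
  assumes "finite_measure \<sigma>" and [measurable_cong]: "sets \<sigma> = sets borel" and t: "0 < t" "t \<le> D"
  shows "pot D \<sigma> x = ennreal (LINT y|\<sigma>. tker D t x y) + pot t \<sigma> x"
proof -
  have "pot D \<sigma> x = (\<integral>\<^sup>+y. ennreal (tker D t x y) + lker t x y \<partial>\<sigma>)"
    unfolding pot_def lker_split[OF t] ..
  also have "\<dots> = (\<integral>\<^sup>+y. ennreal (tker D t x y) \<partial>\<sigma>) + pot t \<sigma> x"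
    unfolding pot_def by (rule nn_integral_add) auto
  finally show ?thesis using t assms by (simp add: nn_integral_tker)
qed

text \<open>
  Finiteness of the energy is a uniform integrability statement: the part due to pairs of points at
  distance below \<open>t\<close> tends to zero with \<open>t\<close>.
\<close>

lemma energy_small_scale:
  assumes "finite_measure \<sigma>" and [measurable_cong]: "sets \<sigma> = sets borel"
    and D: "0 < D" and fin: "energy D \<sigma> < \<infinity>" and e: "0 < e"
  shows "\<exists>t. 0 < t \<and> t \<le> D \<and> energy t \<sigma> < e"
proof -
  interpret finite_measure \<sigma> by fact
  define J where "J t = (\<integral>\<^sup>+x. \<integral>\<^sup>+y. ennreal (tker D t x y) \<partial>\<sigma> \<partial>\<sigma>)" for t
  have inc: "incseq (\<lambda>m. J (1 / Suc m))" unfolding J_def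
    by (intro incseq_SucI nn_integral_mono ennreal_leI tker_antimono D) (auto simp: field_simps)
  have "(\<lambda>m. J (1 / Suc m)) \<longlonglongrightarrow> energy D \<sigma>"
    using LIMSEQ_SUP[OF inc] by (simp add: energy_eq_SUP[OF D assms(1,2)] J_def)
  then have "(\<lambda>m. J (1 / Suc m) + e) \<longlonglongrightarrow> energy D \<sigma> + e"
    by (intro tendsto_intros)
  moreover have "energy D \<sigma> < energy D \<sigma> + e"
    using fin e by (metis add.right_neutral ennreal_add_left_cancel_less infinity_ennreal_def)
  ultimately have "eventually (\<lambda>m. energy D \<sigma> < J (1 / Suc m) + e) sequentially"
    by (rule order_tendstoD)
  moreover have "eventually (\<lambda>m. 1 / real (Suc m) < D) sequentially"
  proof (rule order_tendstoD)
    show "(\<lambda>m. 1 / real (Suc m)) \<longlonglongrightarrow> 0" by real_asymp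
  qed (rule D)
  ultimately have "eventually (\<lambda>m. energy D \<sigma> < J (1 / Suc m) + e \<and> 1 / real (Suc m) < D) sequentially"
    by (rule eventually_conj)
  then obtain m where m: "energy D \<sigma> < J (1 / Suc m) + e" "1 / real (Suc m) < D"
    by (auto simp: eventually_sequentially)
  let ?t = "1 / real (Suc m)"
  have [measurable]: "pot ?t \<sigma> \<in> borel_measurable borel"
    by (rule pot_measurable) fact+
  have "energy D \<sigma> = (\<integral>\<^sup>+x. (\<integral>\<^sup>+y. ennreal (tker D ?t x y) \<partial>\<sigma>) + pot ?t \<sigma> x \<partial>\<sigma>)"
    unfolding energy_def using m(2)
    by (intro nn_integral_cong) (subst pot_split[OF assms(1,2), of ?t], auto simp: nn_integral_tker[OF assms(1,2) D])
  also have "\<dots> = J ?t + energy ?t \<sigma>"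
    unfolding J_def energy_def by (rule nn_integral_add) measurable
  finally have "energy ?t \<sigma> < e" using m(1) by (metis add_left_mono not_le)
  then show ?thesis using m by (intro exI[of _ ?t]) auto
qed

lemma lker_scale_mono:
  assumes "0 < s" "0 < t" "s * \<bar>x' - y\<bar> \<le> t * \<bar>x - y\<bar>"
  shows "lker s x y \<le> lker t x' y"
proof (cases "x' = y \<or> x = y")
  case True
  then show ?thesis using assms by (auto simp: lker_def mult_le_0_iff)
next
  case False
  then have "s / \<bar>x - y\<bar> \<le> t / \<bar>x' - y\<bar>" using assms(3) by (simp add: field_simps)
  then show ?thesis using False assms by (auto simp: lker_def intro!: ennreal_leI ln_mono)
qed

text \<open>
  A measure of finite energy has a piece with continuous potential. As in Egorov's theorem, one restricts
  \<open>\<sigma>\<close> to the points at which the potentials at the scales \<open>t k\<close> are at most \<open>2\<^sup>-\<^sup>k\<close>, where the scales are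
  chosen so that Markov's inequality leaves at least half of the mass. This bound extends from \<open>K\<close> to the
  whole line at half the scale, by comparison with the nearest point of \<open>K\<close>; so the truncated potentials of
  the restriction, which are continuous, converge uniformly.
\<close>

lemma continuous_potential_of_restriction:
  assumes "real_distribution \<sigma>" and D: "0 < D" and fin: "energy D \<sigma> < \<infinity>"
  obtains K \<phi> where "closed K" "0 < emeasure \<sigma> K" "\<And>x. isCont \<phi> x"
    "\<And>x. pot D (density \<sigma> (indicator K)) x = ennreal (\<phi> x)" "\<And>x. 0 \<le> \<phi> x" "\<exists>B. \<forall>x. \<phi> x \<le> B"
proof -
  interpret real_distribution \<sigma> by fact
  note fm = finite_measure_axioms
  have "\<exists>t. 0 < t \<and> t \<le> D \<and> energy t \<sigma> < ennreal ((1/4) ^ k / 4)" for k :: nat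
    by (rule energy_small_scale[OF fm _ D fin]) auto
  then obtain t where t: "\<And>k. 0 < t k" "\<And>k. t k \<le> D" "\<And>k::nat. energy (t k) \<sigma> < ennreal ((1/4) ^ k / 4)"
    by metis
  define G where "G k = {x. pot (t k) \<sigma> x \<le> ennreal ((1/2) ^ k)}" for k :: nat
  define K where "K = (\<Inter>k. G k)"
  have clG: "closed (G k)" for k unfolding G_def using t by (intro closed_pot_le fm) auto
  then have clK: "closed K" unfolding K_def by auto
  have [measurable]: "K \<in> sets borel" "G k \<in> sets borel" for k using clK clG by auto
  have "emeasure \<sigma> (- G k) \<le> ennreal ((1/2) ^ k / 4)" for k
  proof -
    have [measurable]: "pot (t k) \<sigma> \<in> borel_measurable borel"
      by (rule pot_measurable) (auto simp: fm)
    have "emeasure \<sigma> (- G k) = (\<integral>\<^sup>+x. indicator (- G k) x \<partial>\<sigma>)" by simp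
    also have "\<dots> \<le> (\<integral>\<^sup>+x. ennreal (2 ^ k) * pot (t k) \<sigma> x \<partial>\<sigma>)"
    proof (rule nn_integral_mono)
      fix x
      show "indicator (- G k) x \<le> ennreal (2 ^ k) * pot (t k) \<sigma> x"
      proof (cases "x \<in> G k")
        case False
        then have "ennreal ((1/2) ^ k) \<le> pot (t k) \<sigma> x" by (auto simp: G_def)
        then have "ennreal (2 ^ k) * ennreal ((1/2) ^ k) \<le> ennreal (2 ^ k) * pot (t k) \<sigma> x"
          by (rule mult_left_mono) simp
        moreover have "ennreal (2 ^ k) * ennreal ((1/2) ^ k) = 1"
          by (subst ennreal_mult[symmetric]) (auto simp: power_one_over)
        ultimately show ?thesis using False by simp
      qed simp
    qed
    also have "\<dots> = ennreal (2 ^ k) * energy (t k) \<sigma>"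
      by (simp add: nn_integral_cmult energy_def)
    also have "\<dots> \<le> ennreal (2 ^ k) * ennreal ((1/4) ^ k / 4)"
      using t(3)[of k] by (intro mult_left_mono) auto
    also have "\<dots> = ennreal ((1/2) ^ k / 4)"
    proof -
      have "(2::real) ^ k * (1/4) ^ k = (1/2) ^ k" by (simp flip: power_mult_distrib)
      then show ?thesis by (simp add: ennreal_mult[symmetric])
    qed
    finally show ?thesis .
  qed
  then have "(\<Sum>k. emeasure \<sigma> (- G k)) \<le> (\<Sum>k. ennreal ((1/2) ^ k / 4))"
    by (intro suminf_le) auto
  also have "\<dots> = ennreal (1/2)"
  proof (subst suminf_ennreal2)
    have s: "(\<lambda>k. (1/2::real) ^ k / 4) sums ((1 / (1 - 1/2)) / 4)"
      by (intro sums_divide geometric_sums) simp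
    then show "summable (\<lambda>k. (1/2::real) ^ k / 4)" by (rule sums_summable)
    have "(\<Sum>k. (1/2::real) ^ k / 4) = 1/2" using sums_unique[OF s] by simp
    then show "ennreal (\<Sum>k. (1/2::real) ^ k / 4) = ennreal (1/2)" by (simp only:)
  qed simp
  finally have "emeasure \<sigma> (\<Union>k. - G k) \<le> ennreal (1/2)"
    by (intro order.trans[OF emeasure_subadditive_countably]) auto
  moreover have "(\<Union>k. - G k) = space \<sigma> - K" by (auto simp: K_def)
  ultimately have "ennreal (prob (space \<sigma> - K)) \<le> ennreal (1/2)"
    by (simp only: emeasure_eq_measure)
  then have "prob (space \<sigma> - K) \<le> 1/2" by (subst (asm) ennreal_le_iff) simp_all
  then have "prob K \<ge> 1/2" using prob_compl[of K] by simp
  then have Kpos: "0 < emeasure \<sigma> K" by (simp add: emeasure_eq_measure)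
  then have Kne: "K \<noteq> {}" by auto
  define \<tau> where "\<tau> = density \<sigma> (indicator K)"
  have [measurable_cong, simp]: "sets \<tau> = sets borel" by (simp add: \<tau>_def)
  have \<tau>1: "emeasure \<tau> UNIV \<le> 1" by (simp add: \<tau>_def emeasure_density emeasure_space_1)
      (metis emeasure_le_1)
  have fm': "finite_measure \<tau>"
    by (rule finite_measureI) (use \<tau>1 in \<open>auto simp: \<tau>_def top_unique\<close>)
  have potle: "pot (t k / 2) \<tau> x \<le> ennreal ((1/2) ^ k)" for k x
  proof -
    obtain x' where x': "x' \<in> K" "infdist x K = dist x x'"
      using infdist_attains_inf[OF clK Kne] by blast
    have "pot (t k / 2) \<tau> x = (\<integral>\<^sup>+y. indicator K y * lker (t k / 2) x y \<partial>\<sigma>)"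
      unfolding pot_def \<tau>_def by (subst nn_integral_density) auto
    also have "\<dots> \<le> (\<integral>\<^sup>+y. lker (t k) x' y \<partial>\<sigma>)"
    proof (rule nn_integral_mono)
      fix y
      show "indicator K y * lker (t k / 2) x y \<le> lker (t k) x' y"
      proof (cases "y \<in> K")
        case True
        \<comment> \<open>A point \<open>y\<close> of \<open>K\<close> is at most twice as far from \<open>x'\<close> as from \<open>x\<close>.\<close>
        have "\<bar>x - x'\<bar> \<le> \<bar>x - y\<bar>"
          using infdist_le[OF True, of x] x'(2) by (simp add: dist_real_def)
        then have "\<bar>x' - y\<bar> \<le> 2 * \<bar>x - y\<bar>"
          using abs_triangle_ineq4[of "x - y" "x - x'"] by simp
        then have "t k / 2 * \<bar>x' - y\<bar> \<le> t k / 2 * (2 * \<bar>x - y\<bar>)"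
          using t(1)[of k] by (intro mult_left_mono) auto
        then have "lker (t k / 2) x y \<le> lker (t k) x' y"
          using t(1)[of k] by (intro lker_scale_mono) auto
        then show ?thesis using True by simp
      qed simp
    qed
    also have "\<dots> \<le> ennreal ((1/2) ^ k)"
      using x'(1) by (auto simp: K_def G_def pot_def)
    finally show ?thesis .
  qed
  define \<phi>t where "\<phi>t k x = (LINT y|\<tau>. tker D (t k / 2) x y)" for k x
  define \<phi> where "\<phi> x = enn2real (pot D \<tau> x)" for x
  have split: "pot D \<tau> x = ennreal (\<phi>t k x) + pot (t k / 2) \<tau> x" for k x
    unfolding \<phi>t_def using t(1,2)[of k] by (intro pot_split fm') auto
  have pot\<phi>: "pot D \<tau> x = ennreal (\<phi> x)" for x
  proof -
    have "pot D \<tau> x < top" unfolding split[of _ 0] using potle[of 0 x]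
      by (auto simp: less_top[symmetric] top_unique)
    then show ?thesis by (simp add: \<phi>_def)
  qed
  have \<phi>t0: "0 \<le> \<phi>t k x" for k x unfolding \<phi>t_def by (intro integral_nonneg_AE) (auto simp: tker_nonneg)
  have \<phi>0: "0 \<le> \<phi> x" for x by (simp add: \<phi>_def)
  have close: "\<phi>t k x \<le> \<phi> x \<and> \<phi> x \<le> \<phi>t k x + (1/2) ^ k" for k x
  proof -
    have "ennreal (\<phi>t k x) \<le> ennreal (\<phi> x)" unfolding pot\<phi>[symmetric] split[of x k] by simp
    moreover have "ennreal (\<phi> x) \<le> ennreal (\<phi>t k x + (1/2) ^ k)"
      unfolding pot\<phi>[symmetric] split[of x k] using potle \<phi>t0 by (simp add: add_left_mono)
    ultimately show ?thesis using \<phi>0 \<phi>t0 by (simp add: ennreal_le_iff del: ennreal_plus)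
  qed
  have "uniform_limit UNIV \<phi>t \<phi> sequentially"
  proof (rule uniform_limitI)
    fix e :: real assume e: "0 < e"
    have "(\<lambda>k. (1/2::real) ^ k) \<longlonglongrightarrow> 0" by real_asymp
    then have "eventually (\<lambda>k. (1/2::real) ^ k < e) sequentially" by (rule order_tendstoD) (rule e)
    then show "eventually (\<lambda>k. \<forall>x\<in>UNIV. dist (\<phi>t k x) (\<phi> x) < e) sequentially"
    proof eventually_elim
      case (elim k)
      have "dist (\<phi>t k x) (\<phi> x) < e" for x
        using close[of k x] elim by (simp add: dist_real_def)
      then show ?case by blast
    qed
  qed
  moreover have "continuous_on UNIV (\<phi>t k)" for k unfolding \<phi>t_def using t(1)[of k] D
    by (intro continuous_at_imp_continuous_on ballI isCont_integral_tker fm') auto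
  ultimately have "continuous_on UNIV \<phi>"
    by (intro uniform_limit_theorem[of _ \<phi>t sequentially]) auto
  then have cont: "isCont \<phi> x" for x by (auto simp: continuous_on_eq_continuous_at)
  have bdd: "\<exists>B. \<forall>x. \<phi> x \<le> B"
  proof (intro exI allI)
    fix x
    interpret t: finite_measure \<tau> by (rule fm')
    have "\<phi>t 0 x \<le> (LINT y|\<tau>. max 0 (ln (D / (t 0 / 2))))"
      unfolding \<phi>t_def using tker_le[OF D, of "t 0 / 2"] t(1)[of 0] tker_nonneg
      by (intro integral_mono t.integrable_const_bound[where B = "max 0 (ln (D / (t 0 / 2)))"]) auto
    then show "\<phi> x \<le> (LINT y|\<tau>. max 0 (ln (D / (t 0 / 2)))) + 1" using close[of 0 x] by simp
  qed
  show ?thesis by (rule that[OF clK Kpos cont pot\<phi>[unfolded \<tau>_def] \<phi>0 bdd])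
qed

text \<open>
  The lower envelope theorem in the form needed for compact sets. If \<open>\<sigma>\<close> had finite energy, integrate the
  potentials of \<open>\<nu>\<^sub>n\<close> against a piece of \<open>\<sigma>\<close> with continuous potential \<open>\<phi>\<close>: Fatou's lemma bounds the result
  from below, while by symmetry of the kernel it equals the integral of \<open>\<phi>\<close> against \<open>\<nu>\<^sub>n\<close> and converges to
  that against \<open>\<rho>\<close>.
\<close>

lemma energy_infinite_of_liminf_pot:
  assumes \<nu>: "\<And>n. real_distribution (\<nu> n)" and \<rho>: "real_distribution \<rho>" and conv: "weak_conv_m \<nu> \<rho>"
    and D: "0 < D" and R: "0 \<le> R" "R < R'" and pot\<rho>: "\<And>x. pot D \<rho> x \<le> ennreal R"
    and \<sigma>: "real_distribution \<sigma>" and lim: "AE x in \<sigma>. ennreal R' \<le> liminf (\<lambda>n. pot D (\<nu> n) x)"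
  shows "energy D \<sigma> = \<infinity>"
proof (rule ccontr)
  assume "energy D \<sigma> \<noteq> \<infinity>"
  then have "energy D \<sigma> < \<infinity>" by (simp add: less_top)
  then obtain K \<phi> where clK: "closed K" and Kpos: "0 < emeasure \<sigma> K" and cont: "\<And>x. isCont \<phi> x"
    and pot\<phi>: "\<And>x. pot D (density \<sigma> (indicator K)) x = ennreal (\<phi> x)" and \<phi>0: "\<And>x. 0 \<le> \<phi> x"
    and bdd: "\<exists>B. \<forall>x. \<phi> x \<le> B"
    by (rule continuous_potential_of_restriction[OF \<sigma> D]) blast
  interpret real_distribution \<sigma> by fact
  interpret rho: real_distribution \<rho> by fact
  interpret nu: real_distribution "\<nu> n" for n by (rule \<nu>)
  have [measurable]: "K \<in> sets borel" using clK by auto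
  define \<tau> where "\<tau> = density \<sigma> (indicator K)"
  have [measurable_cong, simp]: "sets \<tau> = sets borel" "space \<tau> = UNIV" by (simp_all add: \<tau>_def)
  have mass: "emeasure \<tau> UNIV = emeasure \<sigma> K" by (simp add: \<tau>_def emeasure_density)
  have fm': "finite_measure \<tau>" by (rule finite_measureI) (simp add: mass)
  have [measurable]: "pot D (\<nu> n) \<in> borel_measurable borel" for n
    by (rule pot_measurable) (auto simp: nu.finite_measure_axioms)
  obtain B where B: "\<And>x. \<phi> x \<le> B" using bdd by blast
  have [measurable]: "\<phi> \<in> borel_measurable borel"
    using cont by (intro borel_measurable_continuous_onI continuous_at_imp_continuous_on) auto
  have int\<phi>: "(\<integral>\<^sup>+x. pot D \<tau> x \<partial>M) = ennreal (LINT x|M. \<phi> x)" if "real_distribution M" for M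
  proof -
    interpret M: real_distribution M by fact
    have "integrable M \<phi>" by (rule M.integrable_const_bound[where B = B]) (auto simp: \<phi>0 B)
    then show ?thesis unfolding \<tau>_def pot\<phi> by (intro nn_integral_eq_integral) (auto simp: \<phi>0)
  qed
  have AE\<tau>: "AE x in \<tau>. ennreal R' \<le> liminf (\<lambda>n. pot D (\<nu> n) x)"
    unfolding \<tau>_def by (subst AE_density) (use lim in auto)
  have "(\<lambda>n. LINT x|\<nu> n. \<phi> x) \<longlonglongrightarrow> (LINT x|\<rho>. \<phi> x)"
    by (rule weak_conv_imp_integral_bdd_continuous_conv[OF \<nu> \<rho> conv cont, where B = B]) (simp add: \<phi>0 B)
  then have L: "(\<lambda>n. ennreal (LINT x|\<nu> n. \<phi> x)) \<longlonglongrightarrow> ennreal (LINT x|\<rho>. \<phi> x)"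
    by (rule tendsto_ennrealI)
  have "ennreal R' * emeasure \<sigma> K = (\<integral>\<^sup>+x. ennreal R' \<partial>\<tau>)" by (simp add: mass)
  also have "\<dots> \<le> (\<integral>\<^sup>+x. liminf (\<lambda>n. pot D (\<nu> n) x) \<partial>\<tau>)"
    by (rule nn_integral_mono_AE[OF AE\<tau>])
  also have "\<dots> \<le> liminf (\<lambda>n. \<integral>\<^sup>+x. pot D (\<nu> n) x \<partial>\<tau>)"
    by (rule nn_integral_liminf) measurable
  also have "(\<lambda>n. \<integral>\<^sup>+x. pot D (\<nu> n) x \<partial>\<tau>) = (\<lambda>n. ennreal (LINT x|\<nu> n. \<phi> x))"
    by (simp add: nn_integral_pot_swap[OF nu.finite_measure_axioms _ fm'] int\<phi> \<nu>)
  also have "liminf \<dots> = ennreal (LINT x|\<rho>. \<phi> x)"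
    using L by (intro lim_imp_Liminf) auto
  also have "\<dots> = (\<integral>\<^sup>+x. pot D \<rho> x \<partial>\<tau>)"
    by (simp add: nn_integral_pot_swap[OF rho.finite_measure_axioms _ fm'] int\<phi> \<rho>)
  also have "\<dots> \<le> (\<integral>\<^sup>+x. ennreal R \<partial>\<tau>)" by (intro nn_integral_mono pot\<rho>)
  also have "\<dots> = ennreal R * emeasure \<sigma> K" by (simp add: mass)
  finally have "ennreal R' * emeasure \<sigma> K \<le> ennreal R * emeasure \<sigma> K" .
  then have "R' * prob K \<le> R * prob K"
    using R by (simp add: emeasure_eq_measure ennreal_mult[symmetric])
  then show False using Kpos R by (simp add: emeasure_eq_measure)
qed

section \<open>Fekete points and polynomials with small maximum\<close>

text \<open>
  Fekete points maximize the product \<open>V\<close> of all mutual distances. Replacing \<open>x k\<close> by \<open>z\<close> changes only the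
  factors involving \<open>k\<close>, so at a maximum each \<open>x k\<close> maximizes the product of the distances to the other
  points. Points that reach a quarter of the supremum do the same up to a factor \<open>2\<close>, as \<open>V\<close> counts every
  pair twice; the factor is lost in the \<open>n\<close>-th root, and no maximum has to be
  attained.
\<close>

lemma near_fekete_points:
  fixes E :: "real set"
  assumes inf: "infinite E" and diam: "\<And>x y. x \<in> E \<Longrightarrow> y \<in> E \<Longrightarrow> \<bar>x - y\<bar> \<le> D"
  obtains x :: "nat \<Rightarrow> real" where "\<And>i. i \<le> n \<Longrightarrow> x i \<in> E" "inj_on x {..n}"
    "\<And>k z. k \<le> n \<Longrightarrow> z \<in> E \<Longrightarrow>
       (\<Prod>i\<in>{..n} - {k}. \<bar>z - x i\<bar>) \<le> 2 * (\<Prod>i\<in>{..n} - {k}. \<bar>x k - x i\<bar>)"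
proof -
  define V where "V x = (\<Prod>i\<in>{..n}. \<Prod>j\<in>{..n} - {i}. \<bar>x i - x j\<bar>)" for x :: "nat \<Rightarrow> real"
  define F where "F k z x = (\<Prod>i\<in>{..n} - {k}. \<bar>z - x i\<bar>)" for k z and x :: "nat \<Rightarrow> real"
  define W where "W k x = (\<Prod>i\<in>{..n} - {k}. \<Prod>j\<in>{..n} - {i} - {k}. \<bar>x i - x j\<bar>)" for k and x :: "nat \<Rightarrow> real"
  have V_eq: "V x = (F k (x k) x)\<^sup>2 * W k x" if "k \<le> n" for k x
  proof -
    have "V x = F k (x k) x * (\<Prod>i\<in>{..n} - {k}. \<Prod>j\<in>{..n} - {i}. \<bar>x i - x j\<bar>)"
      unfolding V_def F_def using that by (subst prod.remove[of _ k]) auto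
    also have "(\<Prod>i\<in>{..n} - {k}. \<Prod>j\<in>{..n} - {i}. \<bar>x i - x j\<bar>)
        = (\<Prod>i\<in>{..n} - {k}. \<bar>x i - x k\<bar> * (\<Prod>j\<in>{..n} - {i} - {k}. \<bar>x i - x j\<bar>))"
      using that by (intro prod.cong refl, subst prod.remove[of _ k]) auto
    also have "\<dots> = F k (x k) x * W k x"
      by (simp add: prod.distrib W_def F_def abs_minus_commute)
    finally show ?thesis by (simp add: power2_eq_square)
  qed
  define X where "X = {x :: nat \<Rightarrow> real. \<forall>i\<le>n. x i \<in> E}"
  have bdd: "bdd_above (V ` X)"
  proof (rule bdd_aboveI2)
    fix x assume "x \<in> X"
    then show "V x \<le> (\<Prod>i\<in>{..n}. \<Prod>j\<in>{..n} - {i}. D)"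
      unfolding V_def X_def using diam by (intro prod_mono conjI prod_nonneg) auto
  qed
  obtain f :: "nat \<Rightarrow> real" where f: "inj f" "range f \<subseteq> E" using infinite_countable_subset[OF inf] by blast
  have fX: "f \<in> X" using f by (auto simp: X_def)
  have "0 < V f" unfolding V_def using f by (intro prod_pos ballI) (auto simp: inj_eq)
  also have "V f \<le> Sup (V ` X)" using fX bdd by (intro cSup_upper) auto
  finally have "Sup (V ` X) / 4 < Sup (V ` X)" "0 < Sup (V ` X)" by auto
  moreover have "V ` X \<noteq> {}" using fX by auto
  ultimately obtain x where x: "x \<in> X" "Sup (V ` X) / 4 < V x"
    using less_cSup_iff[OF _ bdd, of "Sup (V ` X) / 4"] by auto
  have Vx: "0 < V x" using x \<open>0 < Sup (V ` X)\<close> by linarith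
  have injx: "inj_on x {..n}"
  proof (rule inj_onI, rule ccontr)
    fix i j assume "i \<in> {..n}" "j \<in> {..n}" "x i = x j" "i \<noteq> j"
    then have "V x = 0" unfolding V_def
      by (intro prod_zero[OF _ bexI[of _ i]] prod_zero[OF _ bexI[of _ j]]) auto
    then show False using Vx by simp
  qed
  have "F k z x \<le> 2 * F k (x k) x" if "k \<le> n" "z \<in> E" for k z
  proof -
    let ?y = "x(k := z)"
    have "?y \<in> X" using that x by (auto simp: X_def)
    then have "V ?y \<le> Sup (V ` X)" using bdd by (intro cSup_upper) auto
    then have "V ?y \<le> 4 * V x" using x by simp
    moreover have "F k (?y k) ?y = F k z x" unfolding F_def by (intro prod.cong) auto
    moreover have "W k ?y = W k x" unfolding W_def by (intro prod.cong) auto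
    ultimately have "(F k z x)\<^sup>2 * W k x \<le> (2 * F k (x k) x)\<^sup>2 * W k x"
      using V_eq[OF that(1), of ?y] V_eq[OF that(1), of x] by simp
    moreover have "0 < W k x"
      unfolding W_def using injx by (intro prod_pos ballI) (auto simp: inj_on_def)
    ultimately have "(F k z x)\<^sup>2 \<le> (2 * F k (x k) x)\<^sup>2" by simp
    then show ?thesis
      by (rule power2_le_imp_le) (auto simp: F_def prod_nonneg)
  qed
  then show ?thesis using that[of x] x injx by (auto simp: F_def X_def)
qed

text \<open>
  In the truncated energy of the uniform distribution on \<open>n + 1\<close> points, the diagonal contributes only the
  maximum of the truncated kernel, divided by the number of points.
\<close>

lemma empirical_energy_le:
  fixes x :: "nat \<Rightarrow> real"
  assumes D: "0 < D" "0 < t" and inj: "inj_on x {..n}"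
    and diam: "\<And>i j. i \<le> n \<Longrightarrow> j \<le> n \<Longrightarrow> \<bar>x i - x j\<bar> \<le> D"
    and low: "\<And>k. k \<le> n \<Longrightarrow> exp (real n * c) \<le> 2 * (\<Prod>i\<in>{..n} - {k}. \<bar>x k - x i\<bar>)"
  defines "\<nu> \<equiv> distr (measure_pmf (pmf_of_set {..n})) borel x"
  shows "(\<integral>\<^sup>+u. \<integral>\<^sup>+v. ennreal (tker D t u v) \<partial>\<nu> \<partial>\<nu>)
    \<le> ennreal ((real n * (ln D - c) + ln 2 + max 0 (ln (D / t))) / real (Suc n))"
proof -
  let ?B = "real n * (ln D - c) + ln 2 + max 0 (ln (D / t))"
  have int: "(\<integral>\<^sup>+u. f u \<partial>\<nu>) = (\<Sum>i\<le>n. f (x i)) / of_nat (Suc n)" if [measurable]: "f \<in> borel_measurable borel" for f :: "real \<Rightarrow> ennreal"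
    unfolding \<nu>_def by (subst nn_integral_distr) (auto simp: nn_integral_pmf_of_set)
  have "(\<Sum>i\<le>n. tker D t (x k) (x i)) \<le> ?B" if k: "k \<le> n" for k
  proof -
    have ne: "x k \<noteq> x i" if "i \<in> {..n} - {k}" for i using inj k that by (auto simp: inj_on_def)
    have pos: "0 < (\<Prod>i\<in>{..n} - {k}. \<bar>x k - x i\<bar>)"
      using ne by (intro prod_pos ballI) auto
    have "real n * c = ln (exp (real n * c))" by simp
    also have "\<dots> \<le> ln (2 * (\<Prod>i\<in>{..n} - {k}. \<bar>x k - x i\<bar>))"
      using low[OF k] pos by (intro ln_mono) auto
    also have "\<dots> = ln 2 + ln (\<Prod>i\<in>{..n} - {k}. \<bar>x k - x i\<bar>)"
    proof -
      have "ln (2 * u) = ln 2 + ln u" if "0 < u" for u :: real using that by (simp add: ln_mult)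
      then show ?thesis using pos by blast
    qed
    also have "ln (\<Prod>i\<in>{..n} - {k}. \<bar>x k - x i\<bar>) = (\<Sum>i\<in>{..n} - {k}. ln \<bar>x k - x i\<bar>)"
      by (rule ln_prod) (use ne in auto)
    finally have a: "real n * c \<le> ln 2 + (\<Sum>i\<in>{..n} - {k}. ln \<bar>x k - x i\<bar>)" .
    have "(\<Sum>i\<in>{..n} - {k}. tker D t (x k) (x i)) \<le> (\<Sum>i\<in>{..n} - {k}. ln D - ln \<bar>x k - x i\<bar>)"
    proof (rule sum_mono)
      fix i assume i: "i \<in> {..n} - {k}"
      have p: "0 < \<bar>x k - x i\<bar>" using ne[OF i] by simp
      have "ln \<bar>x k - x i\<bar> \<le> ln D" using p diam[OF k, of i] i by (intro ln_mono) auto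
      moreover have "ln (D / max \<bar>x k - x i\<bar> t) \<le> ln (D / \<bar>x k - x i\<bar>)"
        using p D by (intro ln_mono divide_left_mono) (auto simp: less_max_iff_disj)
      ultimately show "tker D t (x k) (x i) \<le> ln D - ln \<bar>x k - x i\<bar>"
        using p D by (simp add: tker_def ln_div)
    qed
    also have "\<dots> = real n * ln D - (\<Sum>i\<in>{..n} - {k}. ln \<bar>x k - x i\<bar>)"
      using k by (simp add: sum_subtractf)
    finally have "(\<Sum>i\<in>{..n} - {k}. tker D t (x k) (x i)) \<le> real n * (ln D - c) + ln 2"
      using a by (simp add: algebra_simps)
    moreover have "(\<Sum>i\<le>n. tker D t (x k) (x i)) = tker D t (x k) (x k) + (\<Sum>i\<in>{..n} - {k}. tker D t (x k) (x i))"
      using k by (subst sum.remove[of _ k]) auto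
    ultimately show ?thesis using tker_le[OF D, of "x k" "x k"] by simp
  qed note S = this
  have B0: "0 \<le> ?B" using S[of 0] by (intro order.trans[OF _ S[of 0]] sum_nonneg) (auto simp: tker_nonneg)
  have in_le: "(\<integral>\<^sup>+v. ennreal (tker D t (x k) v) \<partial>\<nu>) \<le> ennreal (?B / real (Suc n))" if "k \<le> n" for k
  proof -
    have "(\<integral>\<^sup>+v. ennreal (tker D t (x k) v) \<partial>\<nu>) = ennreal (\<Sum>i\<le>n. tker D t (x k) (x i)) / of_nat (Suc n)"
      by (subst int) (auto simp: sum_ennreal tker_nonneg)
    also have "\<dots> \<le> ennreal ?B / of_nat (Suc n)"
      using S[OF that] by (intro divide_right_mono_ennreal ennreal_leI)
    also have "\<dots> = ennreal (?B / real (Suc n))"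
      using B0 by (subst divide_ennreal[symmetric]) (auto simp: ennreal_of_nat_eq_real_of_nat)
    finally show ?thesis .
  qed
  have "prob_space \<nu>" unfolding \<nu>_def by (intro measure_pmf.prob_space_distr) simp
  then interpret prob_space \<nu> .
  have [measurable_cong]: "sets \<nu> = sets borel" by (simp add: \<nu>_def)
  have "(\<integral>\<^sup>+u. \<integral>\<^sup>+v. ennreal (tker D t u v) \<partial>\<nu> \<partial>\<nu>) \<le> (\<integral>\<^sup>+u. ennreal (?B / real (Suc n)) \<partial>\<nu>)"
  proof (rule nn_integral_mono_AE)
    define Q where "Q u \<longleftrightarrow> (\<integral>\<^sup>+v. ennreal (tker D t u v) \<partial>\<nu>) \<le> ennreal (?B / real (Suc n))" for u
    have m: "{u \<in> space borel. Q u} \<in> sets borel" unfolding Q_def by measurable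
    have "AE i in measure_pmf (pmf_of_set {..n}). Q (x i)"
      using in_le by (simp add: AE_measure_pmf_iff Q_def)
    then have "AE u in \<nu>. Q u" unfolding \<nu>_def by (subst AE_distr_iff[OF _ m]) simp_all
    then show "AE u in \<nu>. (\<integral>\<^sup>+v. ennreal (tker D t u v) \<partial>\<nu>) \<le> ennreal (?B / real (Suc n))"
      by (simp only: Q_def)
  qed
  then show ?thesis by (simp add: emeasure_space_1)
qed

text \<open>
  This is the inequality between the Chebyshev constant and the capacity. If for infinitely many \<open>n\<close> no
  monic polynomial of degree \<open>n\<close> was as small as claimed, this would apply to the polynomials vanishing at
  all but one of \<open>n + 1\<close> near-Fekete points; the uniform distributions on these points would then have
  truncated energies at most \<open>R - e + o(1)\<close>, and so would a weak limit of them, which contradicts the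
  minimality of \<open>R\<close>. The passage to the limit uses Skorohod's representation and Fatou's lemma.
\<close>

lemma eventually_monic_poly_le_exp:
  fixes E :: "real set"
  assumes E: "compact E" "infinite E" and D: "0 < D"
    and diam: "\<And>x y. x \<in> E \<Longrightarrow> y \<in> E \<Longrightarrow> \<bar>x - y\<bar> \<le> D"
    and R: "0 < R" and min: "\<And>\<tau>. \<tau> \<in> prob_measures_on E \<Longrightarrow> ennreal R \<le> energy D \<tau>"
    and e: "0 < e"
  shows "eventually (\<lambda>n. \<exists>A (x :: nat \<Rightarrow> real). finite A \<and> card A = n \<and>
    (\<forall>z\<in>E. (\<Prod>i\<in>A. \<bar>z - x i\<bar>) \<le> exp (real n * (ln D - R + e)))) sequentially"
proof (rule ccontr)
  define c where "c = ln D - R + e"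
  define good where "good n \<longleftrightarrow> (\<exists>A (x :: nat \<Rightarrow> real). finite A \<and> card A = n \<and>
    (\<forall>z\<in>E. (\<Prod>i\<in>A. \<bar>z - x i\<bar>) \<le> exp (real n * c)))" for n
  assume "\<not> ?thesis"
  then have "\<not> eventually good sequentially" unfolding good_def c_def .
  then obtain s :: "nat \<Rightarrow> nat" where s: "strict_mono s" "\<And>j. \<not> good (s j)"
    using not_eventually_sequentiallyD by blast
  have "\<exists>\<nu>. real_distribution \<nu> \<and> (AE u in \<nu>. u \<in> E) \<and> (\<forall>t>0. (\<integral>\<^sup>+u. \<integral>\<^sup>+v. ennreal (tker D t u v) \<partial>\<nu> \<partial>\<nu>)
    \<le> ennreal ((real (s j) * (R - e) + ln 2 + max 0 (ln (D / t))) / real (Suc (s j))))" for j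
  proof -
    let ?n = "s j"
    obtain x where x: "\<And>i. i \<le> ?n \<Longrightarrow> x i \<in> E" "inj_on x {..?n}"
      "\<And>k z. k \<le> ?n \<Longrightarrow> z \<in> E \<Longrightarrow>
       (\<Prod>i\<in>{..?n} - {k}. \<bar>z - x i\<bar>) \<le> 2 * (\<Prod>i\<in>{..?n} - {k}. \<bar>x k - x i\<bar>)"
      using near_fekete_points[OF E(2) diam] by metis
    have low: "exp (real ?n * c) \<le> 2 * (\<Prod>i\<in>{..?n} - {k}. \<bar>x k - x i\<bar>)" if k: "k \<le> ?n" for k
    proof -
      have "\<exists>z\<in>E. exp (real ?n * c) < (\<Prod>i\<in>{..?n} - {k}. \<bar>z - x i\<bar>)"
        using s(2)[of j] k by (auto simp: good_def not_le dest!: spec[of _ "{..?n} - {k}"] spec[of _ x])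
      then show ?thesis using x(3)[OF k] by (meson less_le_trans less_imp_le)
    qed
    let ?\<nu> = "distr (measure_pmf (pmf_of_set {..?n})) borel x"
    have "prob_space ?\<nu>" by (intro measure_pmf.prob_space_distr) simp
    then have "real_distribution ?\<nu>" by (simp add: real_distribution_def real_distribution_axioms_def)
    moreover have "AE u in ?\<nu>. u \<in> E"
      using compact_imp_closed[OF E(1)] x(1) by (subst AE_distr_iff) (auto simp: AE_measure_pmf_iff)
    moreover have "(\<integral>\<^sup>+u. \<integral>\<^sup>+v. ennreal (tker D t u v) \<partial>?\<nu> \<partial>?\<nu>)
      \<le> ennreal ((real ?n * (R - e) + ln 2 + max 0 (ln (D / t))) / real (Suc ?n))" if t: "0 < t" for t
      using empirical_energy_le[OF D t x(2) _ low] diam x(1) by (simp add: c_def)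
    ultimately show ?thesis by blast
  qed
  then obtain \<nu> where \<nu>: "\<And>j. real_distribution (\<nu> j)" "\<And>j. AE u in \<nu> j. u \<in> E"
    "\<And>j t. 0 < t \<Longrightarrow> (\<integral>\<^sup>+u. \<integral>\<^sup>+v. ennreal (tker D t u v) \<partial>\<nu> j \<partial>\<nu> j)
    \<le> ennreal ((real (s j) * (R - e) + ln 2 + max 0 (ln (D / t))) / real (Suc (s j)))"
    by metis
  obtain B where B: "\<And>u. u \<in> E \<Longrightarrow> \<bar>u\<bar> \<le> B"
    using compact_imp_bounded[OF E(1)] by (auto simp: bounded_iff)
  have "tight \<nu>" unfolding tight_def
  proof (intro conjI allI impI \<nu>(1))
    fix \<epsilon> :: real assume "0 < \<epsilon>"
    have "measure (\<nu> j) {- \<bar>B\<bar> - 1<..\<bar>B\<bar>} = 1" for j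
    proof -
      interpret real_distribution "\<nu> j" by (rule \<nu>)
      have "AE u in \<nu> j. u \<in> {- \<bar>B\<bar> - 1<..\<bar>B\<bar>}"
        using \<nu>(2)[of j] by eventually_elim (use B in fastforce)
      then show ?thesis by (subst prob_eq_1) auto
    qed
    then show "\<exists>a b. a < b \<and> (\<forall>n. 1 - \<epsilon> < measure (\<nu> n) {a<..b})"
      using \<open>0 < \<epsilon>\<close> by (intro exI[of _ "- \<bar>B\<bar> - 1"] exI[of _ "\<bar>B\<bar>"]) auto
  qed
  then obtain r M where r: "strict_mono (r :: nat \<Rightarrow> nat)" and M: "real_distribution M"
    and conv: "weak_conv_m (\<nu> \<circ> id \<circ> r) M"
    using tight_imp_convergent_subsubsequence[of \<nu> id] by (auto simp: strict_mono_def)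
  have \<nu>r: "real_distribution ((\<nu> \<circ> id \<circ> r) n)" for n by (simp add: \<nu>)
  \<comment> \<open>With pointwise convergent random variables the truncated energies become expectations over
    \<open>\<Omega> \<times> \<Omega>\<close>, to which Fatou's lemma applies.\<close>
  obtain \<Omega> :: "real measure" and Ys Y where Om: "prob_space \<Omega>"
    and Ysm [measurable]: "\<And>n. Ys n \<in> measurable \<Omega> borel" and Ysd: "\<And>n. distr \<Omega> borel (Ys n) = \<nu> (r n)"
    and Ym: "Y \<in> measurable \<Omega> lborel" and Yd: "distr \<Omega> borel Y = M"
    and lim: "\<And>w. w \<in> space \<Omega> \<Longrightarrow> (\<lambda>n. Ys n w) \<longlonglongrightarrow> Y w"
    using Skorohod[OF \<nu>r M conv] by (simp only: o_def id_apply) blast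
  have [measurable]: "Y \<in> measurable \<Omega> borel" using Ym by simp
  interpret prob_space \<Omega> by (rule Om)
  interpret M: real_distribution M by (rule M)
  have clE: "closed E" by (rule compact_imp_closed[OF E(1)])
  then have [measurable]: "E \<in> sets borel" by auto
  have "AE w in \<Omega>. \<forall>n. Ys n w \<in> E"
  proof (subst AE_all_countable, intro allI)
    fix n
    have "AE u in distr \<Omega> borel (Ys n). u \<in> E" unfolding Ysd by (rule \<nu>)
    then show "AE w in \<Omega>. Ys n w \<in> E" by (subst (asm) AE_distr_iff) auto
  qed
  then have "AE w in \<Omega>. Y w \<in> E"
    using AE_space by eventually_elim (rule closed_sequentially[OF clE _ lim], auto)
  then have "AE u in M. u \<in> E" unfolding Yd[symmetric] by (subst AE_distr_iff) auto
  then have ME: "M \<in> prob_measures_on E"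
    unfolding prob_measures_on_def using M by (simp add: M.prob_eq_1)
  have trunc: "(\<integral>\<^sup>+u. \<integral>\<^sup>+v. ennreal (tker D t u v) \<partial>M \<partial>M) \<le> ennreal (R - e)" if t: "0 < t" for t
  proof -
    have tr: "(\<integral>\<^sup>+u. \<integral>\<^sup>+v. ennreal (tker D t u v) \<partial>distr \<Omega> borel Z \<partial>distr \<Omega> borel Z)
      = (\<integral>\<^sup>+w. \<integral>\<^sup>+w'. ennreal (tker D t (Z w) (Z w')) \<partial>\<Omega> \<partial>\<Omega>)" if [measurable]: "Z \<in> borel_measurable \<Omega>" for Z
    proof -
      interpret Z: prob_space "distr \<Omega> borel Z" by (rule prob_space_distr) simp
      have [measurable_cong]: "sets (distr \<Omega> borel Z) = sets borel" by simp
      have 1: "(\<integral>\<^sup>+v. ennreal (tker D t u v) \<partial>distr \<Omega> borel Z) = (\<integral>\<^sup>+w'. ennreal (tker D t u (Z w')) \<partial>\<Omega>)" for u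
        by (subst nn_integral_distr) auto
      have "(\<lambda>u. \<integral>\<^sup>+v. ennreal (tker D t u v) \<partial>distr \<Omega> borel Z) \<in> borel_measurable borel" by measurable
      then show ?thesis by (subst nn_integral_distr) (auto simp: 1)
    qed
    have "(\<integral>\<^sup>+u. \<integral>\<^sup>+v. ennreal (tker D t u v) \<partial>M \<partial>M) = (\<integral>\<^sup>+w. \<integral>\<^sup>+w'. ennreal (tker D t (Y w) (Y w')) \<partial>\<Omega> \<partial>\<Omega>)"
      unfolding Yd[symmetric] by (rule tr) simp
    also have "\<dots> \<le> (\<integral>\<^sup>+w. liminf (\<lambda>n. \<integral>\<^sup>+w'. ennreal (tker D t (Ys n w) (Ys n w')) \<partial>\<Omega>) \<partial>\<Omega>)"
    proof (rule nn_integral_mono)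
      fix w assume w: "w \<in> space \<Omega>"
      have "(\<integral>\<^sup>+w'. ennreal (tker D t (Y w) (Y w')) \<partial>\<Omega>)
        = (\<integral>\<^sup>+w'. liminf (\<lambda>n. ennreal (tker D t (Ys n w) (Ys n w'))) \<partial>\<Omega>)"
        using w lim by (intro nn_integral_cong lim_imp_Liminf[symmetric] tendsto_ennrealI tendsto_tker D t) auto
      also have "\<dots> \<le> liminf (\<lambda>n. \<integral>\<^sup>+w'. ennreal (tker D t (Ys n w) (Ys n w')) \<partial>\<Omega>)"
        by (rule nn_integral_liminf) measurable
      finally show "(\<integral>\<^sup>+w'. ennreal (tker D t (Y w) (Y w')) \<partial>\<Omega>)
        \<le> liminf (\<lambda>n. \<integral>\<^sup>+w'. ennreal (tker D t (Ys n w) (Ys n w')) \<partial>\<Omega>)" .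
    qed
    also have "\<dots> \<le> liminf (\<lambda>n. \<integral>\<^sup>+w. \<integral>\<^sup>+w'. ennreal (tker D t (Ys n w) (Ys n w')) \<partial>\<Omega> \<partial>\<Omega>)"
      by (rule nn_integral_liminf) measurable
    also have "\<dots> \<le> liminf (\<lambda>n. ennreal ((real (s (r n)) * (R - e) + ln 2 + max 0 (ln (D / t))) / real (Suc (s (r n)))))"
      by (intro Liminf_mono always_eventually allI) (use \<nu>(3)[OF t] in \<open>simp add: tr[symmetric] Ysd\<close>)
    also have "\<dots> = ennreal (R - e)"
    proof (rule lim_imp_Liminf)
      have "(\<lambda>n. (real n * (R - e) + ln 2 + max 0 (ln (D / t))) / real (Suc n)) \<longlonglongrightarrow> R - e"
        by real_asymp
      then show "(\<lambda>n. ennreal ((real (s (r n)) * (R - e) + ln 2 + max 0 (ln (D / t))) / real (Suc (s (r n))))) \<longlonglongrightarrow> ennreal (R - e)"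
        using LIMSEQ_subseq_LIMSEQ[OF _ strict_mono_o[OF s(1) r]] by (intro tendsto_ennrealI) (auto simp: o_def)
    qed simp
    finally show ?thesis .
  qed
  have "energy D M \<le> ennreal (R - e)"
    by (subst energy_eq_SUP[OF D M.finite_measure_axioms]) (auto intro!: SUP_least trunc)
  moreover have "ennreal (R - e) < ennreal R" using R e by (intro ennreal_lessI) auto
  ultimately show False using min[OF ME] by simp
qed

section \<open>The measure as a density and its sesquilinear form on polynomial vectors\<close>

lemma sets_trace_measure [simp, measurable_cong]: "sets (trace_measure \<mu>) = sets borel"
proof -
  have "sets (trace_measure \<mu>) = sigma_sets UNIV (sets (borel :: real measure))"
    unfolding trace_measure_def by (rule sets_measure_of) auto
  also have "\<dots> = sets borel"
    using sets.sigma_sets_eq[of "borel :: real measure"] by simp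
  finally show ?thesis .
qed

lemma space_trace_measure [simp]: "space (trace_measure \<mu>) = UNIV"
  using sets_eq_imp_space_eq[OF sets_trace_measure] by simp

lemma bounded_linear_qform: "bounded_linear (\<lambda>A :: complex^'l^'l. qform A v)"
  unfolding qform_def
  by (intro bounded_linear_sum bounded_linear_mult_right[THEN bounded_linear_compose]
      bounded_linear_mult_left[THEN bounded_linear_compose]
      bounded_linear_vec_nth[THEN bounded_linear_compose] bounded_linear_ident)

lemma bounded_linear_entry: "bounded_linear (\<lambda>A :: complex^'l^'l. A $ a $ b)"
  by (intro bounded_linear_vec_nth[THEN bounded_linear_compose] bounded_linear_vec_nth)

lemma bounded_linear_trace: "bounded_linear (\<lambda>A :: complex^'l^'l. trace A)"
  unfolding trace_def by (intro bounded_linear_sum bounded_linear_entry)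

lemma qform_axis: "qform A (axis i 1) = A $ i $ i"
  by (simp add: qform_def axis_def if_distrib[of cnj] if_distrib[of "\<lambda>x. x * _"] if_distrib[of "\<lambda>x. _ * x"] cong: if_cong)

lemma psd_diag: "psd A \<Longrightarrow> 0 \<le> Re (A $ i $ i)"
  unfolding psd_def by (metis qform_axis)

lemma psd_hermitian: "psd A \<Longrightarrow> A $ j $ i = cnj (A $ i $ j)"
  by (metis (no_types, lifting) hadj_def psd_def vec_lambda_beta)

lemma emeasure_trace_measure:
  fixes \<mu> :: "real set \<Rightarrow> complex^'l^'l"
  assumes "matrix_measure \<mu>" and "X \<in> sets borel"
  shows "emeasure (trace_measure \<mu>) X = ennreal (Re (trace (\<mu> X)))"
proof (rule emeasure_measure_of[OF trace_measure_def])
  have lin: "bounded_linear (\<lambda>A :: complex^'l^'l. Re (trace A))"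
    by (intro bounded_linear_Re[THEN bounded_linear_compose] bounded_linear_trace)
  have add: "range Y \<subseteq> sets borel \<Longrightarrow> disjoint_family Y \<Longrightarrow>
      (\<lambda>n. Re (trace (\<mu> (Y n)))) sums Re (trace (\<mu> (\<Union>n. Y n)))" for Y
    by (rule bounded_linear.sums[OF lin]) (use assms(1) in \<open>simp add: matrix_measure_def\<close>)
  have pos: "Y \<in> sets borel \<Longrightarrow> 0 \<le> Re (trace (\<mu> Y))" for Y
    using assms(1) by (simp add: matrix_measure_def trace_def psd_diag sum_nonneg)
  have z: "Re (trace (\<mu> {})) = 0"
    using sums_summable[OF add[of "\<lambda>_. {}"]] by (simp add: disjoint_family_on_def summable_const_iff)
  show "positive (sets (trace_measure \<mu>)) (\<lambda>X. ennreal (Re (trace (\<mu> X))))"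
    using z by (simp add: positive_def)
  show "countably_additive (sets (trace_measure \<mu>)) (\<lambda>X. ennreal (Re (trace (\<mu> X))))"
  proof (rule countably_additiveI)
    fix Y :: "nat \<Rightarrow> real set"
    assume Y: "range Y \<subseteq> sets (trace_measure \<mu>)" "disjoint_family Y"
    show "(\<Sum>n. ennreal (Re (trace (\<mu> (Y n))))) = ennreal (Re (trace (\<mu> (\<Union>n. Y n))))"
      using Y add[of Y] pos by (subst suminf_ennreal2) (auto simp: sums_iff)
  qed
qed (use assms in auto)

text \<open>
  The complement of the support is a union of null sets from a countable basis.
\<close>

lemma AE_msupport:
  assumes "matrix_measure \<mu>"
  shows "AE x in trace_measure \<mu>. x \<in> msupport \<mu>"
proof -
  obtain B :: "real set set" where B: "countable B" "topological_basis B"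
    using ex_countable_basis by blast
  define N where "N = {b \<in> B. emeasure (trace_measure \<mu>) b = 0}"
  have op: "open b" if "b \<in> B" for b using B(2) that by (rule topological_basis_open)
  have "(\<Union>b\<in>N. b) \<in> null_sets (trace_measure \<mu>)"
    using B(1) op by (intro null_sets_UN') (auto simp: N_def null_sets_def countable_Collect)
  then have "AE x in trace_measure \<mu>. x \<notin> (\<Union>b\<in>N. b)" by (rule AE_not_in)
  then show ?thesis
  proof eventually_elim
    case (elim x)
    show ?case
    proof (rule ccontr)
      assume "x \<notin> msupport \<mu>"
      then obtain U where U: "open U" "x \<in> U" "\<mu> U = 0" by (auto simp: msupport_def)
      then obtain b where b: "b \<in> B" "x \<in> b" "b \<subseteq> U" using B(2) by (metis topological_basisE)
      have "emeasure (trace_measure \<mu>) b \<le> emeasure (trace_measure \<mu>) U"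
        using b U by (intro emeasure_mono) auto
      also have "\<dots> = 0" using U by (subst emeasure_trace_measure[OF assms]) (auto simp: trace_def)
      finally show False using elim b by (auto simp: N_def)
    qed
  qed
qed

locale compact_matrix_measure =
  fixes \<mu> :: "real set \<Rightarrow> complex^'l^'l" and M :: "real \<Rightarrow> complex^'l^'l"
  assumes matrix_measure: "matrix_measure \<mu>"
    and compact_support: "compact (msupport \<mu>)"
    and density: "trace_density \<mu> M"
begin

abbreviation "E \<equiv> msupport \<mu>"
abbreviation "mt \<equiv> trace_measure \<mu>"

lemma AE_E: "AE x in mt. x \<in> E"
  by (rule AE_msupport[OF matrix_measure])

lemma AE_psd: "AE x in mt. psd (M x)"
  and integrable_M: "integrable mt M"
  and \<mu>_eq: "X \<in> sets borel \<Longrightarrow> \<mu> X = (LINT x:X|mt. M x)"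
  using density by (auto simp: trace_density_def)

lemma integrable_entry: "integrable mt (\<lambda>x. M x $ a $ b)"
  by (rule integrable_bounded_linear[OF bounded_linear_entry integrable_M])

lemma entry_measurable [measurable]: "(\<lambda>x. M x $ a $ b) \<in> borel_measurable borel"
  using borel_measurable_integrable[OF integrable_entry] by simp

lemma integrable_qform: "integrable mt (\<lambda>x. qform (M x) v)"
  by (rule integrable_bounded_linear[OF bounded_linear_qform integrable_M])

lemma integrable_bdd_mult:
  assumes f: "f \<in> borel_measurable borel" and bd: "\<And>x. x \<in> E \<Longrightarrow> cmod (f x) \<le> C"
    and g: "integrable mt (g :: real \<Rightarrow> complex)"
  shows "integrable mt (\<lambda>x. f x * g x)"
proof (rule Bochner_Integration.integrable_bound)
  show "integrable mt (\<lambda>x. of_real C * g x)" by (rule integrable_mult_right[OF g])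
  show "(\<lambda>x. f x * g x) \<in> borel_measurable mt" using f borel_measurable_integrable[OF g] by simp
  show "AE x in mt. norm (f x * g x) \<le> norm (of_real C * g x)"
    using AE_E
  proof eventually_elim
    case (elim x)
    have "cmod (f x) \<le> \<bar>C\<bar>" using bd[OF elim] by simp
    then show ?case by (auto simp: norm_mult intro!: mult_right_mono)
  qed
qed

lemma quad_measure_eq_density:
  "quad_measure \<mu> v = density mt (\<lambda>x. ennreal (Re (qform (M x) v)))"
proof (rule measure_eqI)
  have [measurable]: "(\<lambda>x. qform (M x) v) \<in> borel_measurable borel"
    using borel_measurable_integrable[OF integrable_qform] by simp
  fix X assume "X \<in> sets (quad_measure \<mu> v)"
  then have X[measurable]: "X \<in> sets borel" by simp
  have int: "integrable mt (\<lambda>x. indicator X x * Re (qform (M x) v))"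
    using integrable_mult_indicator[of X mt "\<lambda>x. Re (qform (M x) v)"] integrable_qform by simp
  have "qform (\<mu> X) v = (LINT x|mt. qform (indicator X x *\<^sub>R M x) v)"
    unfolding \<mu>_eq[OF X] set_lebesgue_integral_def
    by (rule integral_bounded_linear[OF bounded_linear_qform, symmetric])
      (rule integrable_mult_indicator, use integrable_M in auto)
  also have "\<dots> = (LINT x|mt. indicator X x *\<^sub>R qform (M x) v)"
    by (simp add: linear_scale[OF bounded_linear.linear[OF bounded_linear_qform]])
  finally have "Re (qform (\<mu> X) v) = (LINT x|mt. indicator X x * Re (qform (M x) v))"
    using integral_Re[OF integrable_mult_indicator[of X mt, OF _ integrable_qform]] by simp
  then have "emeasure (quad_measure \<mu> v) X = ennreal (LINT x|mt. indicator X x * Re (qform (M x) v))"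
    by (simp add: emeasure_quad_measure[OF matrix_measure X])
  also have "\<dots> = (\<integral>\<^sup>+x. ennreal (indicator X x * Re (qform (M x) v)) \<partial>mt)"
    by (rule nn_integral_eq_integral[OF int, symmetric])
      (use AE_psd in eventually_elim, auto simp: psd_def indicator_def)
  also have "\<dots> = (\<integral>\<^sup>+x. ennreal (Re (qform (M x) v)) * indicator X x \<partial>mt)"
    by (intro nn_integral_cong) (auto simp: indicator_def)
  finally show "emeasure (quad_measure \<mu> v) X = emeasure (density mt (\<lambda>x. ennreal (Re (qform (M x) v)))) X"
    by (simp add: emeasure_density)
qed simp

text \<open>
  The polarized integrals against the measures \<open>v\<^sup>\<dagger> \<mu> v\<close> combine, under the integral sign, to the entry of
  the density.
\<close>

lemma entry_integral_eq:
  assumes f[measurable]: "f \<in> borel_measurable borel" and bd: "\<And>x. x \<in> E \<Longrightarrow> cmod (f x) \<le> C"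
  shows "entry_integral \<mu> j k f = (LINT x|mt. f x * M x $ j $ k)"
proof -
  let ?v = "\<lambda>m. axis j 1 + (\<i> ^ m) *s axis k 1 :: complex^'l"
  have [measurable]: "(\<lambda>x. qform (M x) v) \<in> borel_measurable borel" for v
    using borel_measurable_integrable[OF integrable_qform] by simp
  have "(LINT x|quad_measure \<mu> v. f x) = (LINT x|mt. f x * qform (M x) v)" for v
  proof -
    have "(LINT x|quad_measure \<mu> v. f x) = (LINT x|mt. Re (qform (M x) v) *\<^sub>R f x)"
      unfolding quad_measure_eq_density
      by (rule integral_density) (use AE_psd in \<open>auto simp: psd_def\<close>)
    also have "\<dots> = (LINT x|mt. f x * qform (M x) v)"
    proof (rule integral_cong_AE)
      show "AE x in mt. Re (qform (M x) v) *\<^sub>R f x = f x * qform (M x) v"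
        using AE_psd by eventually_elim (metis mult.commute psd_qform_real scaleR_conv_of_real)
    qed measurable
    finally show ?thesis .
  qed
  then have "entry_integral \<mu> j k f = (1/4) * (\<Sum>m<4. (-\<i>) ^ m * (LINT x|mt. f x * qform (M x) (?v m)))"
    by (simp add: entry_integral_def)
  also have "\<dots> = (LINT x|mt. (1/4) * (\<Sum>m<4. (-\<i>) ^ m * (f x * qform (M x) (?v m))))"
  proof -
    have i: "integrable mt (\<lambda>x. (-\<i>) ^ m * (f x * qform (M x) (?v m)))" for m
      by (intro integrable_mult_right integrable_bdd_mult[OF f bd] integrable_qform)
    show ?thesis
      unfolding integral_mult_right_zero by (subst Bochner_Integration.integral_sum[OF i]) simp
  qed
  also have "\<dots> = (LINT x|mt. f x * M x $ j $ k)"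
  proof (rule Bochner_Integration.integral_cong[OF refl])
    fix x
    have "(1/4) * (\<Sum>m<4. (-\<i>) ^ m * (f x * qform (M x) (?v m)))
      = f x * ((1/4) * (\<Sum>m<4. (-\<i>) ^ m * qform (M x) (?v m)))"
      by (simp add: sum_distrib_left mult_ac)
    then show "(1/4) * (\<Sum>m<4. (-\<i>) ^ m * (f x * qform (M x) (?v m))) = f x * M x $ j $ k"
      by (simp only: qform_polarization)
  qed
  finally show ?thesis .
qed

text \<open>
  A column of a matrix polynomial is a vector of scalar polynomials; \<open>pform f g\<close> is
  \<open>\<integral> f\<^sup>\<dagger> d\<mu> g\<close> for such columns, so that the matrix valued scalar product becomes a family of numbers
  and polynomial division is available.
\<close>

definition pform :: "('l \<Rightarrow> complex poly) \<Rightarrow> ('l \<Rightarrow> complex poly) \<Rightarrow> complex" where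
  "pform f g = (LINT x|mt. (\<Sum>a\<in>UNIV. \<Sum>b\<in>UNIV. cnj (poly (f a) (of_real x)) * M x $ a $ b * poly (g b) (of_real x)))"

lemma poly_bounded_on_E: "\<exists>C. \<forall>x\<in>E. cmod (poly p (of_real x)) \<le> C"
proof -
  have "compact ((\<lambda>x. poly p (complex_of_real x)) ` E)"
    by (intro compact_continuous_image compact_support continuous_intros)
  then have "bounded ((\<lambda>x. poly p (complex_of_real x)) ` E)" by (rule compact_imp_bounded)
  then show ?thesis by (auto simp: bounded_iff)
qed

lemma integrable_pform_term:
  "integrable mt (\<lambda>x. cnj (poly p (of_real x)) * M x $ a $ b * poly q (of_real x))"
proof -
  obtain C1 where C1: "\<And>x. x \<in> E \<Longrightarrow> cmod (poly p (of_real x)) \<le> C1" using poly_bounded_on_E[of p] by blast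
  obtain C2 where C2: "\<And>x. x \<in> E \<Longrightarrow> cmod (poly q (of_real x)) \<le> C2" using poly_bounded_on_E[of q] by blast
  have m: "(\<lambda>x. cnj (poly p (of_real x)) * poly q (of_real x)) \<in> borel_measurable (borel :: real measure)"
    by (intro borel_measurable_continuous_onI continuous_intros)
  have "cmod (cnj (poly p (of_real x)) * poly q (of_real x)) \<le> \<bar>C1\<bar> * \<bar>C2\<bar>" if "x \<in> E" for x
    using C1[OF that] C2[OF that] by (auto simp: norm_mult intro!: mult_mono)
  then have "integrable mt (\<lambda>x. (cnj (poly p (of_real x)) * poly q (of_real x)) * M x $ a $ b)"
    by (intro integrable_bdd_mult[OF m] integrable_entry)
  then show ?thesis by (simp add: mult_ac)
qed

lemma integrable_pform:
  "integrable mt (\<lambda>x. \<Sum>a\<in>UNIV. \<Sum>b\<in>UNIV. cnj (poly (f a) (of_real x)) * M x $ a $ b * poly (g b) (of_real x))"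
  by (intro Bochner_Integration.integrable_sum integrable_pform_term)

lemma mip_right_eq_pform:
  fixes f g :: "real \<Rightarrow> complex^'l^'l"
  assumes f: "\<And>x a c. f x $ a $ c = poly (F a c) (of_real x)" and g: "\<And>x a c. g x $ a $ c = poly (G a c) (of_real x)"
  shows "mip_right \<mu> f g $ c $ d = pform (\<lambda>a. F a c) (\<lambda>b. G b d)"
proof -
  have e: "entry_integral \<mu> j k (\<lambda>x. hadj (f x) $ c $ j * g x $ k $ d)
     = (LINT x|mt. cnj (poly (F j c) (of_real x)) * M x $ j $ k * poly (G k d) (of_real x))" for j k
  proof -
    obtain C1 where C1: "\<And>x. x \<in> E \<Longrightarrow> cmod (poly (F j c) (of_real x)) \<le> C1" using poly_bounded_on_E[of "F j c"] by blast
    obtain C2 where C2: "\<And>x. x \<in> E \<Longrightarrow> cmod (poly (G k d) (of_real x)) \<le> C2" using poly_bounded_on_E[of "G k d"] by blast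
    have m: "(\<lambda>x. cnj (poly (F j c) (of_real x)) * poly (G k d) (of_real x)) \<in> borel_measurable (borel :: real measure)"
      by (intro borel_measurable_continuous_onI continuous_intros)
    have "cmod (cnj (poly (F j c) (of_real x)) * poly (G k d) (of_real x)) \<le> \<bar>C1\<bar> * \<bar>C2\<bar>" if "x \<in> E" for x
      using C1[OF that] C2[OF that] by (auto simp: norm_mult intro!: mult_mono)
    then show ?thesis
      using entry_integral_eq[OF m, of "\<bar>C1\<bar> * \<bar>C2\<bar>" j k] by (simp add: hadj_def f g mult_ac)
  qed
  show ?thesis
    unfolding mip_right_def pform_def
    by (simp add: e Bochner_Integration.integral_sum integrable_pform_term Bochner_Integration.integrable_sum)
qed

lemma pform_add_right: "pform f (\<lambda>a. g a + h a) = pform f g + pform f h"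
  unfolding pform_def
  by (subst Bochner_Integration.integral_add[OF integrable_pform integrable_pform, symmetric])
    (simp add: algebra_simps sum.distrib)

lemma pform_smult_right: "pform f (\<lambda>a. smult c (g a)) = c * pform f g"
  unfolding pform_def
  by (subst integral_mult_right_zero[symmetric]) (simp add: sum_distrib_left mult_ac)

lemma pform_zero_right: "pform f (\<lambda>a. 0) = 0"
  by (simp add: pform_def)

lemma pform_sum_right: "pform f (\<lambda>a. \<Sum>i\<in>I. g i a) = (\<Sum>i\<in>I. pform f (g i))"
  by (induction I rule: infinite_finite_induct) (simp_all add: pform_zero_right pform_add_right)

lemma pform_commute: "pform g f = cnj (pform f g)"
proof -
  have "cnj (pform f g) = (LINT x|mt. cnj (\<Sum>a\<in>UNIV. \<Sum>b\<in>UNIV. cnj (poly (f a) (of_real x)) * M x $ a $ b * poly (g b) (of_real x)))"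
    unfolding pform_def by (simp only: Bochner_Integration.integral_cnj)
  also have "\<dots> = pform g f"
    unfolding pform_def
  proof (rule integral_cong_AE)
    show "AE x in mt. cnj (\<Sum>a\<in>UNIV. \<Sum>b\<in>UNIV. cnj (poly (f a) (of_real x)) * M x $ a $ b * poly (g b) (of_real x))
      = (\<Sum>a\<in>UNIV. \<Sum>b\<in>UNIV. cnj (poly (g a) (of_real x)) * M x $ a $ b * poly (f b) (of_real x))"
      using AE_psd
    proof eventually_elim
      case (elim x)
      have "cnj (\<Sum>a\<in>UNIV. \<Sum>b\<in>UNIV. cnj (poly (f a) (of_real x)) * M x $ a $ b * poly (g b) (of_real x))
        = (\<Sum>a\<in>UNIV. \<Sum>b\<in>UNIV. cnj (poly (g b) (of_real x)) * M x $ b $ a * poly (f a) (of_real x))"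
        by (simp add: psd_hermitian[OF elim, symmetric] mult_ac)
      also have "\<dots> = (\<Sum>a\<in>UNIV. \<Sum>b\<in>UNIV. cnj (poly (g a) (of_real x)) * M x $ a $ b * poly (f b) (of_real x))"
        by (rule sum.swap)
      finally show ?case .
    qed
  qed (rule borel_measurable_integrable integrable_cnj integrable_pform)+
  finally show ?thesis ..
qed

lemma pform_add_left: "pform (\<lambda>a. g a + h a) f = pform g f + pform h f"
  by (subst (1 2 3) pform_commute) (simp add: pform_add_right)

lemma pform_smult_left: "pform (\<lambda>a. smult c (g a)) f = cnj c * pform g f"
  by (subst (1 2) pform_commute) (simp add: pform_smult_right)

lemma pform_zero_left: "pform (\<lambda>a. 0) f = 0"
  by (simp add: pform_def)

lemma pform_sum_left: "pform (\<lambda>a. \<Sum>i\<in>I. g i a) f = (\<Sum>i\<in>I. pform (g i) f)"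
  by (induction I rule: infinite_finite_induct) (simp_all add: pform_zero_left pform_add_left)

lemma pform_X: "pform (\<lambda>a. [:0, 1:] * f a) g = pform f (\<lambda>a. [:0, 1:] * g a)"
  by (simp add: pform_def mult_ac)

lemma pform_quadratic:
  "(\<Sum>a\<in>UNIV. \<Sum>b\<in>UNIV. cnj (poly (f a) z) * A $ a $ b * poly (f b) z) = qform A (\<chi> a. poly (f a) z)"
  by (simp add: qform_def)

text \<open>
  The numerical range of multiplication by the variable lies in the convex hull of the support, because
  the integrand \<open>f\<^sup>\<dagger> M f\<close> is non-negative.
\<close>

lemma pform_X_bounds:
  assumes ab: "\<And>x. x \<in> E \<Longrightarrow> a \<le> x \<and> x \<le> b"
  shows "a * Re (pform f f) \<le> Re (pform f (\<lambda>i. [:0, 1:] * f i))"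
    and "Re (pform f (\<lambda>i. [:0, 1:] * f i)) \<le> b * Re (pform f f)"
proof -
  let ?q = "\<lambda>x. Re (qform (M x) (\<chi> i. poly (f i) (of_real x)))"
  have i1: "integrable mt (\<lambda>x. qform (M x) (\<chi> i. poly (f i) (of_real x)))"
    using integrable_pform[of f f] by (simp add: pform_quadratic)
  have e2: "(\<Sum>c\<in>UNIV. \<Sum>d\<in>UNIV. cnj (poly (f c) (of_real x)) * M x $ c $ d * poly ([:0, 1:] * f d) (of_real x))
     = of_real x * qform (M x) (\<chi> i. poly (f i) (of_real x))" for x
    by (simp add: qform_def sum_distrib_left mult_ac)
  have i2: "integrable mt (\<lambda>x. of_real x * qform (M x) (\<chi> i. poly (f i) (of_real x)))"
    using integrable_pform[of f "\<lambda>i. [:0, 1:] * f i"] unfolding e2 .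
  have r1: "Re (pform f f) = (LINT x|mt. ?q x)"
    unfolding pform_def pform_quadratic by (rule integral_Re[OF i1, symmetric])
  have r2: "Re (pform f (\<lambda>i. [:0, 1:] * f i)) = (LINT x|mt. x * ?q x)"
    unfolding pform_def e2 by (subst integral_Re[OF i2, symmetric]) simp
  have j1: "integrable mt ?q" by (rule integrable_Re[OF i1])
  have j2: "integrable mt (\<lambda>x. x * ?q x)" using integrable_Re[OF i2] by simp
  have "(LINT x|mt. a * ?q x) \<le> (LINT x|mt. x * ?q x)"
  proof (rule integral_mono_AE)
    show "AE x in mt. a * ?q x \<le> x * ?q x"
      using AE_E AE_psd by eventually_elim (use ab in \<open>auto simp: psd_def intro!: mult_right_mono\<close>)
  qed (use j1 j2 in auto)
  then show "a * Re (pform f f) \<le> Re (pform f (\<lambda>i. [:0, 1:] * f i))" using r1 r2 by simp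
  have "(LINT x|mt. x * ?q x) \<le> (LINT x|mt. b * ?q x)"
  proof (rule integral_mono_AE)
    show "AE x in mt. x * ?q x \<le> b * ?q x"
      using AE_E AE_psd by eventually_elim (use ab in \<open>auto simp: psd_def intro!: mult_right_mono\<close>)
  qed (use j1 j2 in auto)
  then show "Re (pform f (\<lambda>i. [:0, 1:] * f i)) \<le> b * Re (pform f f)" using r1 r2 by simp
qed

text \<open>
  On the vector \<open>T e\<^sub>i\<close> the form integrates \<open>\<bar>T\<bar>\<^sup>2\<close> against the diagonal entry \<open>\<mu>\<^sub>i\<^sub>i\<close>, a probability measure.
\<close>

lemma pform_scalar_poly_le:
  assumes bd: "\<And>x. x \<in> E \<Longrightarrow> cmod (poly T (of_real x)) \<le> s"
  shows "Re (pform (\<lambda>a. if a = i then T else 0) (\<lambda>a. if a = i then T else 0)) \<le> s\<^sup>2"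
proof -
  let ?f = "\<lambda>a. if a = i then T else 0"
  have e: "(\<Sum>a\<in>UNIV. \<Sum>b\<in>UNIV. cnj (poly (?f a) z) * A $ a $ b * poly (?f b) z)
     = cnj (poly T z) * A $ i $ i * poly T z" for z and A :: "complex^'l^'l"
  proof -
    have "(\<Sum>b\<in>UNIV. cnj (poly (?f a) z) * A $ a $ b * poly (?f b) z)
       = (if a = i then cnj (poly T z) * A $ i $ i * poly T z else 0)" for a
      by (cases "a = i") (simp_all add: if_distrib[of "\<lambda>p. poly p z"] if_distrib[of "\<lambda>p. _ * p"] cong: if_cong)
    then show ?thesis by simp
  qed
  have i0: "integrable mt (\<lambda>x. cnj (poly T (of_real x)) * M x $ i $ i * poly T (of_real x))"
    by (rule integrable_pform_term)
  have "Re (pform ?f ?f) = (LINT x|mt. Re (cnj (poly T (of_real x)) * M x $ i $ i * poly T (of_real x)))"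
    unfolding pform_def e by (rule integral_Re[OF i0, symmetric])
  also have "\<dots> \<le> (LINT x|mt. s\<^sup>2 * Re (M x $ i $ i))"
  proof (rule integral_mono_AE)
    show "integrable mt (\<lambda>x. Re (cnj (poly T (of_real x)) * M x $ i $ i * poly T (of_real x)))"
      by (rule integrable_Re[OF i0])
    show "integrable mt (\<lambda>x. s\<^sup>2 * Re (M x $ i $ i))"
      by (intro integrable_mult_right integrable_Re integrable_entry)
    show "AE x in mt. Re (cnj (poly T (of_real x)) * M x $ i $ i * poly T (of_real x)) \<le> s\<^sup>2 * Re (M x $ i $ i)"
      using AE_E AE_psd
    proof eventually_elim
      case (elim x)
      define w where "w = poly T (of_real x)"
      have "cnj w * M x $ i $ i * w = of_real ((cmod w)\<^sup>2) * M x $ i $ i"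
        using complex_norm_square[of w] by (simp add: mult_ac)
      then have "Re (cnj w * M x $ i $ i * w) = (cmod w)\<^sup>2 * Re (M x $ i $ i)"
        by (simp only:) (simp del: of_real_power)
      moreover have "(cmod w)\<^sup>2 \<le> s\<^sup>2" using bd[OF elim(1)] by (simp add: w_def power_mono)
      ultimately show ?case using psd_diag[OF elim(2)] by (simp add: w_def mult_right_mono)
    qed
  qed
  also have "\<dots> = s\<^sup>2 * Re (\<mu> UNIV $ i $ i)"
  proof -
    have "\<mu> UNIV $ i $ i = (LINT x|mt. M x $ i $ i)"
      using \<mu>_eq[of UNIV] integral_bounded_linear[OF bounded_linear_entry integrable_M, of i i]
      by (simp add: set_lebesgue_integral_def)
    then show ?thesis by (simp add: integral_Re integrable_entry)
  qed
  also have "\<mu> UNIV = mat 1" using matrix_measure by (simp add: matrix_measure_def)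
  finally show ?thesis by (simp add: mat_def)
qed

end

section \<open>Matrix orthonormal polynomials\<close>

text \<open>
  A crude form of Hadamard's inequality; factors that do not depend on \<open>n\<close> are lost in the \<open>n\<close>-th root.
\<close>

lemma cmod_det_le:
  fixes A :: "complex^'n^'n"
  assumes "\<And>i j. cmod (A $ i $ j) \<le> s"
  shows "cmod (det A) \<le> fact CARD('n) * s ^ CARD('n)"
proof -
  have s: "0 \<le> s" using assms[of undefined undefined] norm_ge_zero order.trans by blast
  have "cmod (det A) \<le> (\<Sum>q | q permutes (UNIV :: 'n set). cmod (of_int (sign q) * (\<Prod>i\<in>UNIV. A $ i $ q i)))"
    unfolding det_def by (rule norm_sum)
  also have "\<dots> \<le> (\<Sum>q | q permutes (UNIV :: 'n set). s ^ CARD('n))"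
  proof (rule sum_mono)
    fix q
    have "cmod (of_int (sign q) * (\<Prod>i\<in>UNIV. A $ i $ q i)) = (\<Prod>i\<in>UNIV. cmod (A $ i $ q i))"
      by (simp add: norm_mult prod_norm sign_def)
    also have "\<dots> \<le> (\<Prod>i\<in>(UNIV :: 'n set). s)" by (intro prod_mono conjI norm_ge_zero assms)
    finally show "cmod (of_int (sign q) * (\<Prod>i\<in>UNIV. A $ i $ q i)) \<le> s ^ CARD('n)" by simp
  qed
  also have "\<dots> = fact CARD('n) * s ^ CARD('n)"
    by (simp add: card_permutations)
  finally show ?thesis .
qed

lemma det_hadj: "det (hadj A) = cnj (det A)" for A :: "complex^'n^'n"
proof -
  have "det (hadj A) = det (transpose (hadj A))" by (rule det_transpose[symmetric])
  also have "\<dots> = cnj (det A)"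
    by (simp add: det_def hadj_def transpose_def)
  finally show ?thesis .
qed

lemma ex_kernel_of_det_eq_0:
  fixes A :: "complex^'n^'n"
  assumes "det A = 0"
  obtains v where "v \<noteq> 0" "A *v v = 0"
  using assms invertible_det_nz[of A] matrix_left_invertible_ker[of A]
  by (metis invertible_left_inverse)

lemma ex_preimage_of_det_neq_0:
  fixes A :: "complex^'n^'n"
  assumes "det A \<noteq> 0"
  obtains v where "A *v v = w"
  using assms invertible_det_nz[of A] unfolding invertible_def
  by (metis matrix_vector_mul_assoc matrix_vector_mul_lid)

text \<open>
  The form is chosen for determinants of polynomial matrices, where some entries may have smaller degree
  than \<open>n\<close>.
\<close>

lemma coeff_prod_top:
  fixes f :: "'a \<Rightarrow> 'b::comm_ring_1 poly"
  assumes "finite I" "\<And>i. i \<in> I \<Longrightarrow> degree (f i) \<le> n"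
  shows "degree (\<Prod>i\<in>I. f i) \<le> n * card I \<and> coeff (\<Prod>i\<in>I. f i) (n * card I) = (\<Prod>i\<in>I. coeff (f i) n)"
  using assms
proof (induction I rule: finite_induct)
  case (insert x I)
  let ?q = "\<Prod>i\<in>I. f i"
  have IH: "degree ?q \<le> n * card I" "coeff ?q (n * card I) = (\<Prod>i\<in>I. coeff (f i) n)"
    using insert by auto
  have dx: "degree (f x) \<le> n" using insert by auto
  have "coeff (f x * ?q) (n + n * card I) = (\<Sum>i\<le>n + n * card I. coeff (f x) i * coeff ?q (n + n * card I - i))"
    by (rule coeff_mult)
  also have "\<dots> = (\<Sum>i\<in>{n}. coeff (f x) i * coeff ?q (n + n * card I - i))"
  proof (intro sum.mono_neutral_right ballI)
    fix i assume i: "i \<in> {..n + n * card I} - {n}"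
    show "coeff (f x) i * coeff ?q (n + n * card I - i) = 0"
    proof (cases "i < n")
      case True
      then show ?thesis using IH(1) by (simp add: coeff_eq_0)
    next
      case False
      then show ?thesis using dx i by (simp add: coeff_eq_0)
    qed
  qed auto
  finally have "coeff (f x * ?q) (n + n * card I) = coeff (f x) n * (\<Prod>i\<in>I. coeff (f i) n)"
    using IH by simp
  moreover have "degree (f x * ?q) \<le> n + n * card I"
    using degree_mult_le[of "f x" ?q] dx IH by linarith
  ultimately show ?case using insert by (simp add: algebra_simps)
qed simp

text \<open>
  The Cauchy-Schwarz inequality for the vectors \<open>e\<^sub>i\<close> and \<open>v\<close> in the form given by \<open>A\<close>. It is used to control
  \<open>A v\<close> by \<open>v\<^sup>\<dagger> A v\<close> without a lower bound for the eigenvalues of \<open>A\<close>.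
\<close>

lemma psd_Cauchy_Schwarz:
  fixes A :: "complex^'l^'l"
  assumes A: "psd A"
  shows "(cmod ((A *v v) $ i))\<^sup>2 \<le> Re (A $ i $ i) * Re (qform A v)"
proof -
  define w where "w = (A *v v) $ i"
  define q where "q = Re (qform A v)"
  define d where "d = Re (A $ i $ i)"
  have w: "w = (\<Sum>b\<in>UNIV. A $ i $ b * v $ b)" by (simp add: w_def matrix_vector_mult_def)
  have wc: "cnj w = (\<Sum>b\<in>UNIV. cnj (v $ b) * A $ b $ i)"
    by (simp add: w psd_hermitian[OF A, of _ i, symmetric] mult.commute)
  have key: "0 \<le> q - 2 * r * (cmod w)\<^sup>2 + r\<^sup>2 * (cmod w)\<^sup>2 * d" for r :: real
  proof -
    \<comment> \<open>The form is non-negative at \<open>v - r w e\<^sub>i\<close>; the case distinction on \<open>d\<close> below chooses \<open>r\<close>.\<close>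
    let ?s = "- (of_real r * w)"
    let ?u = "\<chi> b. v $ b + (if b = i then ?s else 0)"
    have "qform A ?u = (\<Sum>a\<in>UNIV. \<Sum>b\<in>UNIV. cnj (v $ a) * A $ a $ b * v $ b
        + (if b = i then cnj (v $ a) * A $ a $ b * ?s else 0)
        + (if a = i then cnj ?s * (A $ a $ b * v $ b) else 0)
        + (if a = i then (if b = i then cnj ?s * A $ a $ b * ?s else 0) else 0))"
      unfolding qform_def by (intro sum.cong refl) (simp add: algebra_simps)
    also have "\<dots> = qform A v + (\<Sum>a\<in>UNIV. cnj (v $ a) * A $ a $ i * ?s)
        + cnj ?s * (\<Sum>b\<in>UNIV. A $ i $ b * v $ b) + cnj ?s * A $ i $ i * ?s"
    proof -
      have 1: "(\<Sum>a\<in>UNIV. \<Sum>b\<in>UNIV. (if a = i then g a b else 0)) = (\<Sum>b\<in>UNIV. g i b)" for g :: "'l \<Rightarrow> 'l \<Rightarrow> complex"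
      proof -
        have "(\<Sum>b\<in>UNIV. (if a = i then g a b else 0)) = (if a = i then \<Sum>b\<in>UNIV. g i b else 0)" for a
          by simp
        then show ?thesis by simp
      qed
      show ?thesis
        by (simp only: sum.distrib 1 sum_distrib_left qform_def) simp
    qed
    also have "(\<Sum>a\<in>UNIV. cnj (v $ a) * A $ a $ i * ?s) = cnj w * ?s"
      by (simp only: wc sum_distrib_right)
    finally have "qform A ?u = qform A v + cnj w * ?s + cnj ?s * w + cnj ?s * A $ i $ i * ?s"
      by (simp only: w)
    also have "\<dots> = qform A v - of_real (2 * r) * (w * cnj w) + of_real (r\<^sup>2) * (w * cnj w) * A $ i $ i"
      by (simp add: power2_eq_square algebra_simps)
    also have "w * cnj w = of_real ((cmod w)\<^sup>2)" by (simp only: complex_norm_square)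
    finally have u: "qform A ?u = qform A v - of_real (2 * r) * of_real ((cmod w)\<^sup>2)
        + of_real (r\<^sup>2) * of_real ((cmod w)\<^sup>2) * A $ i $ i" .
    have "Re (X - of_real \<alpha> * of_real \<beta> + of_real \<gamma> * of_real \<beta> * Y) = Re X - \<alpha> * \<beta> + \<gamma> * \<beta> * Re Y"
      for \<alpha> \<beta> \<gamma> X Y by simp
    then have re: "Re (qform A ?u) = q - 2 * r * (cmod w)\<^sup>2 + r\<^sup>2 * (cmod w)\<^sup>2 * d"
      by (simp only: u q_def d_def)
    have "0 \<le> Re (qform A ?u)" using A unfolding psd_def by blast
    then show ?thesis unfolding re .
  qed
  have d0: "0 \<le> d" using psd_diag[OF A] by (simp add: d_def)
  show ?thesis unfolding w_def[symmetric] q_def[symmetric] d_def[symmetric]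
  proof (cases "d = 0")
    case True
    have "w = 0"
    proof (rule ccontr)
      assume "w \<noteq> 0"
      then have "0 < (cmod w)\<^sup>2" by simp
      then show False using key[of "(q + 1) / (2 * (cmod w)\<^sup>2)"] True key[of 0] by (simp add: field_simps)
    qed
    then show "(cmod w)\<^sup>2 \<le> d * q" using True by simp
  next
    case False
    then have d: "0 < d" using d0 by simp
    have "0 \<le> q - 2 * (1 / d) * (cmod w)\<^sup>2 + (1 / d)\<^sup>2 * (cmod w)\<^sup>2 * d" by (rule key)
    also have "\<dots> = q - (cmod w)\<^sup>2 / d" using d by (simp add: field_simps power2_eq_square)
    finally show "(cmod w)\<^sup>2 \<le> d * q" using d by (simp add: field_simps)
  qed
qed

locale matrix_orthonormal_polynomials = compact_matrix_measure \<mu> M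
  for \<mu> :: "real set \<Rightarrow> complex^'l^'l" and M +
  fixes p :: "nat \<Rightarrow> (complex^'l^'l) poly"
  assumes orthonormal: "right_orthonormal \<mu> p"
begin

definition P :: "nat \<Rightarrow> 'l \<Rightarrow> 'l \<Rightarrow> complex poly" where
  "P n a c = (\<Sum>k\<le>n. monom (coeff (p n) k $ a $ c) k)"

definition \<kappa> :: "nat \<Rightarrow> complex^'l^'l" where
  "\<kappa> n = coeff (p n) n"

lemma degree_p: "degree (p n) = n"
  using orthonormal by (simp add: right_orthonormal_def)

lemma mpeval_P: "mpeval (p n) z $ a $ c = poly (P n a c) z"
  by (simp add: mpeval_def P_def degree_p poly_sum poly_monom)

lemma coeff_P: "coeff (P n a c) k = (if k \<le> n then coeff (p n) k $ a $ c else 0)"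
  by (simp add: P_def coeff_sum coeff_monom)

lemma coeff_P_lead: "coeff (P n a c) n = \<kappa> n $ a $ c"
  by (simp add: coeff_P \<kappa>_def)

lemma pform_P: "pform (\<lambda>a. P n a c) (\<lambda>a. P m a d) = (if n = m \<and> c = d then 1 else 0)"
proof -
  have "pform (\<lambda>a. P n a c) (\<lambda>a. P m a d) = mip_right \<mu> (rpeval (p n)) (rpeval (p m)) $ c $ d"
    by (rule mip_right_eq_pform[symmetric]) (simp_all add: mpeval_P)
  then show ?thesis using orthonormal by (simp add: right_orthonormal_def mat_def)
qed

definition deg_less :: "nat \<Rightarrow> ('l \<Rightarrow> complex poly) \<Rightarrow> bool" where
  "deg_less n f \<longleftrightarrow> (\<forall>a. \<forall>k\<ge>n. coeff (f a) k = 0)"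

lemma pform_P_span: "pform (\<lambda>a. P n a i) (\<lambda>a. \<Sum>k<m. \<Sum>j\<in>UNIV. smult (c k j) (P k a j))
   = (if n < m then c n i else 0)"
proof -
  have "pform (\<lambda>a. P n a i) (\<lambda>a. \<Sum>k<m. \<Sum>j\<in>UNIV. smult (c k j) (P k a j))
    = (\<Sum>k<m. \<Sum>j\<in>UNIV. c k j * (if n = k \<and> i = j then 1 else 0))"
    by (simp add: pform_sum_right pform_smult_right pform_P)
  also have "\<dots> = (\<Sum>k<m. if n = k then c k i else 0)"
  proof (rule sum.cong[OF refl])
    fix k
    show "(\<Sum>j\<in>UNIV. c k j * (if n = k \<and> i = j then 1 else 0)) = (if n = k then c k i else 0)"
      by (cases "n = k") (simp_all add: if_distrib[of "\<lambda>x. _ * x"] cong: if_cong)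
  qed
  finally show ?thesis by simp
qed

text \<open>
  Spanning and invertibility of the leading coefficients are proved together. If \<open>\<kappa> n v = 0\<close>, then \<open>p\<^sub>n v\<close>
  has degree below \<open>n\<close>, so it is a combination of earlier columns, to which it is orthogonal; as the columns
  of \<open>p\<^sub>n\<close> are orthonormal, \<open>v = 0\<close>. Invertibility of \<open>\<kappa> n\<close> in turn allows the next degree to be removed.
\<close>

lemma span_and_lead:
  "(\<forall>f. deg_less n f \<longrightarrow> (\<exists>c. \<forall>a. f a = (\<Sum>k<n. \<Sum>j\<in>UNIV. smult (c k j) (P k a j)))) \<and> (\<forall>k<n. det (\<kappa> k) \<noteq> 0)"
proof (induction n)
  case 0
  show ?case by (auto simp: deg_less_def poly_eq_iff)
next
  case (Suc n)
  have det: "det (\<kappa> n) \<noteq> 0"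
  proof
    assume "det (\<kappa> n) = 0"
    then obtain v where v: "v \<noteq> 0" "\<kappa> n *v v = 0" by (rule ex_kernel_of_det_eq_0)
    define f where "f a = (\<Sum>j\<in>UNIV. smult (v $ j) (P n a j))" for a
    have "deg_less n f"
      unfolding deg_less_def
    proof (intro allI impI)
      fix a k assume "n \<le> k"
      show "coeff (f a) k = 0"
      proof (cases "k = n")
        case True
        have "(\<kappa> n *v v) $ a = 0" using v by simp
        then show ?thesis using True by (simp add: f_def coeff_sum coeff_P_lead matrix_vector_mult_def mult.commute)
      next
        case False
        then show ?thesis using \<open>n \<le> k\<close> by (simp add: f_def coeff_sum coeff_P)
      qed
    qed
    then obtain c where c: "\<And>a. f a = (\<Sum>k<n. \<Sum>j\<in>UNIV. smult (c k j) (P k a j))" using Suc by blast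
    have "v $ i = 0" for i
    proof -
      have "pform (\<lambda>a. P n a i) f = 0" unfolding c[abs_def] pform_P_span by simp
      moreover have "pform (\<lambda>a. P n a i) f = (\<Sum>j\<in>UNIV. v $ j * (if i = j then 1 else 0))"
        unfolding f_def by (simp add: pform_sum_right pform_smult_right pform_P)
      ultimately show ?thesis by (simp add: if_distrib[of "\<lambda>x. _ * x"] cong: if_cong)
    qed
    then show False using v by (simp add: vec_eq_iff)
  qed
  have "\<exists>c. \<forall>a. f a = (\<Sum>k<Suc n. \<Sum>j\<in>UNIV. smult (c k j) (P k a j))" if f: "deg_less (Suc n) f" for f
  proof -
    obtain v where v: "\<kappa> n *v v = (\<chi> a. coeff (f a) n)" using det by (rule ex_preimage_of_det_neq_0)
    define g where "g a = f a - (\<Sum>j\<in>UNIV. smult (v $ j) (P n a j))" for a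
    have "deg_less n g"
      unfolding deg_less_def
    proof (intro allI impI)
      fix a k assume "n \<le> k"
      show "coeff (g a) k = 0"
      proof (cases "k = n")
        case True
        have "(\<kappa> n *v v) $ a = coeff (f a) n" using v by simp
        then show ?thesis using True by (simp add: g_def coeff_sum coeff_P_lead matrix_vector_mult_def mult.commute)
      next
        case False
        then show ?thesis using \<open>n \<le> k\<close> f by (simp add: g_def coeff_sum coeff_P deg_less_def)
      qed
    qed
    then obtain c where c: "\<And>a. g a = (\<Sum>k<n. \<Sum>j\<in>UNIV. smult (c k j) (P k a j))" using Suc by blast
    have "f a = (\<Sum>k<Suc n. \<Sum>j\<in>UNIV. smult ((c(n := ($) v)) k j) (P k a j))" for a
    proof -
      have "f a = g a + (\<Sum>j\<in>UNIV. smult (v $ j) (P n a j))" by (simp add: g_def)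
      then show ?thesis by (simp add: c)
    qed
    then show ?thesis by blast
  qed
  then show ?case using det Suc by (auto simp: less_Suc_eq)
qed

lemma det_\<kappa>: "det (\<kappa> n) \<noteq> 0"
  using span_and_lead[of "Suc n"] by blast

lemma expansion:
  assumes "deg_less n f"
  shows "f = (\<lambda>a. \<Sum>k<n. \<Sum>j\<in>UNIV. smult (pform (\<lambda>a. P k a j) f) (P k a j))"
proof -
  obtain c where c: "f = (\<lambda>a. \<Sum>k<n. \<Sum>j\<in>UNIV. smult (c k j) (P k a j))"
    using span_and_lead[of n] assms by blast
  have "pform (\<lambda>a. P k a j) f = c k j" if "k < n" for k j
    unfolding c pform_P_span using that by simp
  then show ?thesis by (subst c) (auto intro!: sum.cong)
qed

lemma orthogonal_deg_less:
  assumes "deg_less n f"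
  shows "pform (\<lambda>a. P n a i) f = 0"
  by (subst expansion[OF assms]) (simp add: pform_P_span)

lemma parseval:
  assumes "deg_less n f"
  shows "pform f f = of_real (\<Sum>k<n. \<Sum>j\<in>UNIV. (cmod (pform (\<lambda>a. P k a j) f))\<^sup>2)"
proof -
  have "pform f f = pform f (\<lambda>a. \<Sum>k<n. \<Sum>j\<in>UNIV. smult (pform (\<lambda>a. P k a j) f) (P k a j))"
    using expansion[OF assms] by simp
  also have "\<dots> = (\<Sum>k<n. \<Sum>j\<in>UNIV. pform (\<lambda>a. P k a j) f * cnj (pform (\<lambda>a. P k a j) f))"
    by (simp add: pform_sum_right pform_smult_right pform_commute[of f "\<lambda>a. P _ a _"])
  finally show ?thesis by (simp add: complex_norm_square[symmetric])
qed

lemma coeff_expansion: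
  assumes f: "deg_less (Suc n) f"
  shows "coeff (f a) n = (\<Sum>j\<in>UNIV. \<kappa> n $ a $ j * pform (\<lambda>a. P n a j) f)"
proof -
  have "coeff (f a) n = coeff (\<Sum>k<Suc n. \<Sum>j\<in>UNIV. smult (pform (\<lambda>a. P k a j) f) (P k a j)) n"
    by (subst expansion[OF f]) simp
  also have "\<dots> = (\<Sum>j\<in>UNIV. pform (\<lambda>a. P n a j) f * \<kappa> n $ a $ j)"
    by (simp add: coeff_sum coeff_P_lead) (simp add: coeff_P)
  finally show ?thesis by (simp add: mult.commute)
qed

text \<open>
  The coefficient of \<open>p\<^sub>n\<^sub>+\<^sub>1\<close> in the expansion of \<open>x p\<^sub>n\<close> is the adjoint of \<open>A\<^sub>n\<^sub>+\<^sub>1\<close>; compare leading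
  coefficients.
\<close>

lemma \<kappa>_Suc: "\<kappa> n = \<kappa> (Suc n) ** hadj (jacobi_A \<mu> p (Suc n))"
proof -
  have "\<kappa> n $ a $ c = (\<kappa> (Suc n) ** hadj (jacobi_A \<mu> p (Suc n))) $ a $ c" for a c
  proof -
    let ?f = "\<lambda>a. [:0, 1:] * P n a c"
    have cf: "coeff (?f b) (Suc k) = coeff (P n b c) k" for b k by simp
    have dl: "deg_less (Suc (Suc n)) ?f"
      unfolding deg_less_def
    proof (intro allI impI)
      fix b k assume "Suc (Suc n) \<le> k"
      then obtain k' where "k = Suc k'" "n < k'" by (cases k) auto
      then show "coeff (?f b) k = 0" by (simp only: cf coeff_P) simp
    qed
    have sx: "(x *\<^sub>R rpeval (p (Suc n)) x) $ a $ c = poly ([:0, 1:] * P (Suc n) a c) (complex_of_real x)" for x a c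
      unfolding vector_scaleR_component mpeval_P by (simp add: scaleR_conv_of_real)
    have A: "pform (\<lambda>a. P (Suc n) a j) ?f = hadj (jacobi_A \<mu> p (Suc n)) $ j $ c" for j
    proof -
      have "jacobi_A \<mu> p (Suc n) $ c $ j = pform (\<lambda>a. P n a c) (\<lambda>a. [:0, 1:] * P (Suc n) a j)"
        unfolding jacobi_A_def diff_Suc_1 by (rule mip_right_eq_pform[OF mpeval_P sx])
      also have "\<dots> = pform ?f (\<lambda>a. P (Suc n) a j)" by (rule pform_X[symmetric])
      finally show ?thesis unfolding hadj_def by (simp add: pform_commute[of "\<lambda>a. P (Suc n) a j"])
    qed
    have "\<kappa> n $ a $ c = coeff (?f a) (Suc n)" by (simp only: cf coeff_P_lead)
    also have "\<dots> = (\<Sum>j\<in>UNIV. \<kappa> (Suc n) $ a $ j * hadj (jacobi_A \<mu> p (Suc n)) $ j $ c)"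
      unfolding coeff_expansion[OF dl] A ..
    finally show ?thesis by (simp add: matrix_matrix_mult_def)
  qed
  then show ?thesis by (simp add: vec_eq_iff)
qed

lemma det_jacobi_A_prod: "cmod (det (jacobi_A_prod \<mu> p n)) * cmod (det (\<kappa> n)) = 1"
proof (induction n)
  case 0
  have "\<kappa> 0 = mat 1" using orthonormal by (simp add: \<kappa>_def right_orthonormal_def)
  then show ?case by simp
next
  case (Suc n)
  have "cmod (det (\<kappa> n)) = cmod (det (\<kappa> (Suc n))) * cmod (det (jacobi_A \<mu> p (Suc n)))"
    by (subst \<kappa>_Suc) (simp add: det_mul det_hadj norm_mult)
  then show ?case using Suc by (simp add: det_mul norm_mult mult_ac)
qed

lemma det_jacobi_A_prod_pos: "0 < cmod (det (jacobi_A_prod \<mu> p n))"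
  using det_jacobi_A_prod[of n] by (metis mult_zero_left norm_ge_zero order_le_less zero_neq_one)

lemma ln_det_\<kappa>: "ln (cmod (det (\<kappa> n))) = - ln (cmod (det (jacobi_A_prod \<mu> p n)))"
proof -
  have "cmod (det (\<kappa> n)) = inverse (cmod (det (jacobi_A_prod \<mu> p n)))"
    using det_jacobi_A_prod[of n] by (metis inverse_unique)
  then show ?thesis by (simp add: ln_inverse)
qed

text \<open>
  The coefficients \<open>K\<close> of \<open>p\<^sub>n\<close> in the expansion of \<open>T\<close> times the identity form the inverse of \<open>\<kappa> n\<close>, and by
  Parseval's identity they are bounded by the maximum of \<open>\<bar>T\<bar>\<close> on the support.
\<close>

lemma det_jacobi_A_prod_le:
  assumes T: "degree T = n" "coeff T n = 1" and bd: "\<And>x. x \<in> E \<Longrightarrow> cmod (poly T (of_real x)) \<le> s"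
    and s: "0 \<le> s"
  shows "cmod (det (jacobi_A_prod \<mu> p n)) \<le> fact CARD('l) * s ^ CARD('l)"
proof -
  define f where "f i a = (if a = i then T else 0)" for i a :: 'l
  define K :: "complex^'l^'l" where "K = (\<chi> j i. pform (\<lambda>a. P n a j) (f i))"
  have dl: "deg_less (Suc n) (f i)" for i
    using T(1) by (auto simp: deg_less_def f_def coeff_eq_0)
  have "(\<kappa> n ** K) $ a $ i = mat 1 $ a $ i" for a i
    using coeff_expansion[OF dl[of i], of a] T(2) by (auto simp: matrix_matrix_mult_def K_def mat_def f_def)
  then have "\<kappa> n ** K = mat 1" by (simp add: vec_eq_iff)
  then have "det (\<kappa> n) * det K = 1" by (metis det_I det_mul)
  then have "cmod (det (\<kappa> n)) * cmod (det K) = 1" by (metis norm_mult norm_one)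
  then have "cmod (det (jacobi_A_prod \<mu> p n)) = cmod (det K)"
    using det_jacobi_A_prod[of n] by (metis inverse_unique mult.commute)
  also have "\<dots> \<le> fact CARD('l) * s ^ CARD('l)"
  proof (rule cmod_det_le)
    fix j i
    have "(cmod (K $ j $ i))\<^sup>2 \<le> (\<Sum>j\<in>UNIV. (cmod (pform (\<lambda>a. P n a j) (f i)))\<^sup>2)"
      unfolding K_def using member_le_sum[of j UNIV "\<lambda>j. (cmod (pform (\<lambda>a. P n a j) (f i)))\<^sup>2"] by simp
    also have "\<dots> \<le> (\<Sum>k<Suc n. \<Sum>j\<in>UNIV. (cmod (pform (\<lambda>a. P k a j) (f i)))\<^sup>2)"
      by (simp add: sum_nonneg)
    also have "\<dots> = Re (pform (f i) (f i))" by (subst parseval[OF dl]) (simp only: Re_complex_of_real)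
    also have "\<dots> \<le> s\<^sup>2" unfolding f_def[abs_def] by (rule pform_scalar_poly_le[OF bd])
    finally show "cmod (K $ j $ i) \<le> s" using s by (rule power2_le_imp_le)
  qed
  finally show ?thesis .
qed

end

section \<open>Zeros and growth of the determinants\<close>

context matrix_orthonormal_polynomials
begin

lemma det_left_lead:
  "degree (det_left (p n)) = n * CARD('l) \<and> lead_coeff (det_left (p n)) = cnj (det (\<kappa> n))"
proof -
  define e where "e i j = (\<Sum>k\<le>n. monom (cnj (coeff (p n) k $ j $ i)) k)" for i j
  have de: "degree (e i j) \<le> n" for i j
    unfolding e_def by (rule degree_le) (auto simp: coeff_sum coeff_monom)
  have ce: "coeff (e i j) n = hadj (\<kappa> n) $ i $ j" for i j
    unfolding e_def by (simp add: coeff_sum coeff_monom hadj_def \<kappa>_def)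
  have dl: "det_left (p n) = (\<Sum>q | q permutes UNIV. of_int (sign q) * (\<Prod>i\<in>UNIV. e i (q i)))"
    by (simp add: det_left_def degree_p e_def det_def)
  have top: "degree (\<Prod>i\<in>UNIV. e i (q i)) \<le> n * CARD('l) \<and>
     coeff (\<Prod>i\<in>UNIV. e i (q i)) (n * CARD('l)) = (\<Prod>i\<in>UNIV. coeff (e i (q i)) n)" for q :: "'l \<Rightarrow> 'l"
    by (rule coeff_prod_top) (auto simp: de)
  have "degree (of_int (sign q) * (\<Prod>i\<in>UNIV. e i (q i))) \<le> n * CARD('l)" for q :: "'l \<Rightarrow> 'l"
    using top[of q] by (simp add: sign_def)
  then have d1: "degree (det_left (p n)) \<le> n * CARD('l)"
    unfolding dl by (intro degree_sum_le finite_permutations) auto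
  have "coeff (det_left (p n)) (n * CARD('l)) = det (hadj (\<kappa> n))"
    unfolding dl det_def coeff_sum
  proof (rule sum.cong[OF refl])
    fix q :: "'l \<Rightarrow> 'l"
    show "coeff (of_int (sign q) * (\<Prod>i\<in>UNIV. e i (q i))) (n * CARD('l))
      = of_int (sign q) * (\<Prod>i\<in>UNIV. hadj (\<kappa> n) $ i $ q i)"
      using top[of q] by (simp add: sign_def ce)
  qed
  then have c: "coeff (det_left (p n)) (n * CARD('l)) = cnj (det (\<kappa> n))" by (simp add: det_hadj)
  then have "coeff (det_left (p n)) (n * CARD('l)) \<noteq> 0" using det_\<kappa>[of n] by simp
  then have "degree (det_left (p n)) = n * CARD('l)" using d1 le_degree le_antisym by blast
  then show ?thesis using c by simp
qed

lemma det_left_nonzero: "det_left (p n) \<noteq> 0"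
  using det_left_lead[of n] det_\<kappa>[of n] by auto

text \<open>
  A zero \<open>z\<close> with conjugate \<open>z0\<close> gives a vector \<open>v \<noteq> 0\<close> with \<open>p\<^sub>n v = (x - z0) q\<close>. Since \<open>q\<close> has degree below
  \<open>n\<close>, it is orthogonal to \<open>p\<^sub>n v\<close>; hence \<open>z\<close> is the mean of \<open>x\<close> for the non-zero measure \<open>q\<^sup>\<dagger> d\<mu> q\<close>, which lies
  in the convex hull of the support.
\<close>

lemma det_left_zeros_real:
  assumes ab: "\<And>x. x \<in> E \<Longrightarrow> a \<le> x \<and> x \<le> b" and z: "poly (det_left (p n)) z = 0"
  shows "\<exists>x. a \<le> x \<and> x \<le> b \<and> z = of_real x"
proof -
  define z0 where "z0 = cnj z"
  have "det (mpeval (p n) z0) = 0"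
    using z by (simp add: poly_det_left mpeval_left_def det_hadj z0_def)
  then obtain v where v: "v \<noteq> 0" "mpeval (p n) z0 *v v = 0" by (rule ex_kernel_of_det_eq_0)
  define f where "f a = (\<Sum>j\<in>UNIV. smult (v $ j) (P n a j))" for a
  have "poly (f a) z0 = 0" for a
  proof -
    have "(mpeval (p n) z0 *v v) $ a = 0" using v by simp
    then show ?thesis by (simp add: f_def poly_sum matrix_vector_mult_def mpeval_P mult.commute)
  qed
  then have "\<exists>q. f a = [:- z0, 1:] * q" for a by (simp add: poly_eq_0_iff_dvd dvd_def)
  then obtain q where q: "\<And>a. f a = [:- z0, 1:] * q a" by metis
  have degf: "degree (f a) \<le> n" for a
    unfolding f_def by (rule degree_le) (auto simp: coeff_sum coeff_P)
  have dlq: "deg_less n q"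
    unfolding deg_less_def
  proof (intro allI impI)
    fix a k assume "n \<le> k"
    show "coeff (q a) k = 0"
    proof (cases "q a = 0")
      case False
      have "degree (f a) = Suc (degree (q a))" unfolding q using False by (subst degree_mult_eq) auto
      then have "degree (q a) < k" using degf[of a] \<open>n \<le> k\<close> by simp
      then show ?thesis by (rule coeff_eq_0)
    qed simp
  qed
  have "\<exists>a. q a \<noteq> 0"
  proof (rule ccontr)
    assume "\<not> (\<exists>a. q a \<noteq> 0)"
    then have f0: "f = (\<lambda>a. 0)" by (auto simp: q)
    have "v $ i = 0" for i
    proof -
      have "pform (\<lambda>a. P n a i) f = (\<Sum>j\<in>UNIV. v $ j * (if i = j then 1 else 0))"
        unfolding f_def by (simp add: pform_sum_right pform_smult_right pform_P)
      then show ?thesis by (simp add: f0 pform_zero_right if_distrib[of "\<lambda>x. _ * x"] cong: if_cong)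
    qed
    then show False using v by (simp add: vec_eq_iff)
  qed
  define t where "t = (\<Sum>k<n. \<Sum>j\<in>UNIV. (cmod (pform (\<lambda>a. P k a j) q))\<^sup>2)"
  have qq: "pform q q = of_real t" unfolding t_def by (rule parseval[OF dlq])
  have "t \<noteq> 0"
  proof
    assume "t = 0"
    then have "\<forall>k<n. \<forall>j. pform (\<lambda>a. P k a j) q = 0"
      by (simp add: t_def sum_nonneg_eq_0_iff sum_nonneg)
    then have "q = (\<lambda>a. 0)" by (subst expansion[OF dlq]) auto
    then show False using \<open>\<exists>a. q a \<noteq> 0\<close> by simp
  qed
  then have t: "0 < t" by (simp add: t_def order_le_neq_trans sum_nonneg)
  have "pform f q = 0"
    unfolding f_def by (simp add: pform_sum_left pform_smult_left orthogonal_deg_less[OF dlq])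
  moreover have "f = (\<lambda>a. [:0, 1:] * q a + smult (- z0) (q a))" by (auto simp: q)
  ultimately have "pform (\<lambda>a. [:0, 1:] * q a) q + cnj (- z0) * pform q q = 0"
    by (simp only: pform_add_left pform_smult_left)
  then have zt: "pform (\<lambda>a. [:0, 1:] * q a) q = z * of_real t" by (simp add: z0_def qq)
  then have zt': "pform q (\<lambda>a. [:0, 1:] * q a) = z * of_real t" by (simp only: pform_X)
  have "z * of_real t = cnj (z * of_real t)"
    using zt zt' pform_commute[of q "\<lambda>a. [:0, 1:] * q a"] by metis
  then have "z = cnj z" using t by simp
  then have zr: "z = of_real (Re z)" by (metis Reals_cnj_iff of_real_Re)
  have "a * t \<le> Re z * t" "Re z * t \<le> b * t"
    using pform_X_bounds[OF ab, of q] unfolding qq zt' by simp_all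
  then show ?thesis using t zr by (intro exI[of _ "Re z"]) auto
qed

definition zeros :: "nat \<Rightarrow> real set" where
  "zeros n = {x. poly (det_left (p n)) (of_real x) = 0}"

definition weight :: "nat \<Rightarrow> real \<Rightarrow> nat" where
  "weight n x = order (of_real x) (det_left (p n))"

lemma zeros_bounds: "(\<And>x. x \<in> E \<Longrightarrow> a \<le> x \<and> x \<le> b) \<Longrightarrow> x \<in> zeros n \<Longrightarrow> a \<le> x \<and> x \<le> b"
  using det_left_zeros_real[of a b n "of_real x"] by (auto simp: zeros_def)

lemma complex_zeros: "{z. poly (det_left (p n)) z = 0} = of_real ` zeros n"
proof -
  obtain B where "\<And>x. x \<in> E \<Longrightarrow> \<bar>x\<bar> \<le> B"
    using compact_imp_bounded[OF compact_support] by (auto simp: bounded_iff)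
  then have "\<And>x. x \<in> E \<Longrightarrow> - B \<le> x \<and> x \<le> B" by (auto simp: abs_le_iff minus_le_iff)
  then show ?thesis using det_left_zeros_real[of "- B" B n] by (auto simp: zeros_def)
qed

lemma finite_zeros: "finite (zeros n)"
proof -
  have "finite (complex_of_real ` zeros n)"
    unfolding complex_zeros[symmetric] by (rule poly_roots_finite[OF det_left_nonzero])
  then show ?thesis by (rule finite_imageD) (simp add: inj_on_def)
qed

lemma weight_pos: "x \<in> zeros n \<Longrightarrow> 0 < weight n x"
  using det_left_nonzero[of n] by (simp add: zeros_def weight_def order_root)

lemma det_left_factorization:
  "det_left (p n) = smult (cnj (det (\<kappa> n))) (\<Prod>x\<in>zeros n. [:- of_real x, 1:] ^ weight n x)"
proof -
  have "det_left (p n) = smult (cnj (det (\<kappa> n))) (\<Prod>z\<in>of_real ` zeros n. [:- z, 1:] ^ order z (det_left (p n)))"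
    using complex_poly_decompose[of "det_left (p n)", symmetric]
    unfolding complex_zeros conjunct2[OF det_left_lead] .
  then show ?thesis by (subst (asm) prod.reindex) (auto simp: inj_on_def weight_def)
qed

lemma sum_weight: "(\<Sum>x\<in>zeros n. weight n x) = n * CARD('l)"
proof -
  have "degree (det_left (p n)) = degree (\<Prod>x\<in>zeros n. [:- complex_of_real x, 1:] ^ weight n x)"
    by (subst det_left_factorization) (simp add: det_\<kappa>)
  also have "\<dots> = (\<Sum>x\<in>zeros n. weight n x)"
    by (subst degree_prod_eq_sum_degree) (auto simp: degree_linear_power)
  finally show ?thesis using det_left_lead[of n] by simp
qed

lemma cmod_det_p: "cmod (det (rpeval (p n) x)) = cmod (det (\<kappa> n)) * (\<Prod>y\<in>zeros n. \<bar>x - y\<bar> ^ weight n y)"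
proof -
  have "cmod (det (rpeval (p n) x)) = cmod (poly (det_left (p n)) (of_real x))"
    by (simp add: poly_det_left mpeval_left_def det_hadj)
  also have "\<dots> = cmod (det (\<kappa> n)) * (\<Prod>y\<in>zeros n. cmod (of_real x - of_real y) ^ weight n y)"
    by (subst det_left_factorization) (simp add: norm_mult poly_prod norm_power flip: prod_norm)
  also have "(\<Prod>y\<in>zeros n. cmod (of_real x - of_real y) ^ weight n y) = (\<Prod>y\<in>zeros n. \<bar>x - y\<bar> ^ weight n y)"
    by (simp flip: of_real_diff)
  finally show ?thesis .
qed

lemma nn_integral_zero_measure:
  assumes [measurable]: "f \<in> borel_measurable borel"
  shows "(\<integral>\<^sup>+x. f x \<partial>zero_measure p n) = (\<Sum>x\<in>zeros n. ennreal (real (weight n x) / real (n * CARD('l))) * f x)"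
proof -
  have "(\<integral>\<^sup>+x. f x \<partial>zero_measure p n)
    = (\<integral>\<^sup>+x. ennreal (real (weight n x) / real (n * CARD('l))) * f x \<partial>count_space UNIV)"
    unfolding zero_measure_def weight_def
    by (subst nn_integral_distr) (auto simp: nn_integral_density)
  also have "\<dots> = (\<Sum>x\<in>zeros n. ennreal (real (weight n x) / real (n * CARD('l))) * f x)"
    by (rule nn_integral_count_space'[OF finite_zeros]) (auto simp: zeros_def weight_def order_0I)
  finally show ?thesis .
qed

lemma real_distribution_zero_measure:
  assumes "0 < n"
  shows "real_distribution (zero_measure p n)"
proof -
  have s: "sets (zero_measure p n) = sets borel" by (simp add: zero_measure_def)
  have "emeasure (zero_measure p n) (space (zero_measure p n)) = (\<integral>\<^sup>+x. 1 \<partial>zero_measure p n)" by simp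
  also have "\<dots> = (\<Sum>x\<in>zeros n. ennreal (real (weight n x) / real (n * CARD('l))))"
    by (subst nn_integral_zero_measure) simp_all
  also have "\<dots> = ennreal (\<Sum>x\<in>zeros n. real (weight n x) / real (n * CARD('l)))" by (rule sum_ennreal) simp
  also have "(\<Sum>x\<in>zeros n. real (weight n x) / real (n * CARD('l))) = 1"
    using assms sum_weight[of n] by (simp add: sum_divide_distrib[symmetric] flip: of_nat_sum)
  finally have "prob_space (zero_measure p n)" by (intro prob_spaceI) simp
  then show ?thesis by (simp add: real_distribution_def real_distribution_axioms_def s)
qed

text \<open>
  Away from the zeros this is the logarithm of the factorization of \<open>det p\<^sub>n\<close>, with the leading coefficient
  expressed by the Jacobi parameters; at a zero the potential is infinite.
\<close>

lemma pot_zero_measure_ge: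
  assumes n: "0 < n" and D: "0 < D" and diam: "\<And>y. y \<in> zeros n \<Longrightarrow> \<bar>x - y\<bar> \<le> D"
    and H: "cmod (det (rpeval (p n) x)) \<le> H"
  shows "ennreal (ln D - (ln H + ln (cmod (det (jacobi_A_prod \<mu> p n)))) / real (n * CARD('l)))
    \<le> pot D (zero_measure p n) x"
proof -
  let ?N = "real (n * CARD('l))"
  have N: "0 < ?N" using n by simp
  have pot: "pot D (zero_measure p n) x = (\<Sum>y\<in>zeros n. ennreal (real (weight n y) / ?N) * lker D x y)"
    unfolding pot_def by (rule nn_integral_zero_measure) measurable
  show ?thesis
  proof (cases "x \<in> zeros n")
    case True
    have "ennreal (real (weight n x) / ?N) * lker D x x = top"
      using weight_pos[OF True] n by (simp add: lker_def ennreal_mult_top)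
    moreover have "ennreal (real (weight n x) / ?N) * lker D x x \<le> pot D (zero_measure p n) x"
      unfolding pot by (rule member_le_sum[OF True]) (auto simp: finite_zeros)
    ultimately show ?thesis by (simp add: top_unique)
  next
    case False
    have ne: "0 < \<bar>x - y\<bar>" if "y \<in> zeros n" for y using False that by auto
    have lnpos: "0 \<le> ln D - ln \<bar>x - y\<bar>" if "y \<in> zeros n" for y
      using ne[OF that] diam[OF that] by simp
    have "pot D (zero_measure p n) x = (\<Sum>y\<in>zeros n. ennreal (real (weight n y) / ?N * (ln D - ln \<bar>x - y\<bar>)))"
      unfolding pot
    proof (rule sum.cong[OF refl])
      fix y assume y: "y \<in> zeros n"
      show "ennreal (real (weight n y) / ?N) * lker D x y = ennreal (real (weight n y) / ?N * (ln D - ln \<bar>x - y\<bar>))"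
        using ne[OF y] lnpos[OF y] D by (subst ennreal_mult) (auto simp: lker_def ln_div)
    qed
    also have "\<dots> = ennreal (\<Sum>y\<in>zeros n. real (weight n y) / ?N * (ln D - ln \<bar>x - y\<bar>))"
      using lnpos by (intro sum_ennreal mult_nonneg_nonneg) auto
    also have "(\<Sum>y\<in>zeros n. real (weight n y) / ?N * (ln D - ln \<bar>x - y\<bar>))
      = ln D - (\<Sum>y\<in>zeros n. real (weight n y) * ln \<bar>x - y\<bar>) / ?N"
    proof -
      have "(\<Sum>y\<in>zeros n. real (weight n y) / ?N * (ln D - ln \<bar>x - y\<bar>))
        = (\<Sum>y\<in>zeros n. real (weight n y)) * (ln D / ?N) - (\<Sum>y\<in>zeros n. real (weight n y) * ln \<bar>x - y\<bar>) / ?N"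
        by (simp add: right_diff_distrib sum_subtractf sum_distrib_right sum_divide_distrib)
      also have "(\<Sum>y\<in>zeros n. real (weight n y)) = ?N" using sum_weight[of n] by (simp flip: of_nat_sum)
      finally show ?thesis using n by simp
    qed
    finally have pot2: "pot D (zero_measure p n) x
      = ennreal (ln D - (\<Sum>y\<in>zeros n. real (weight n y) * ln \<bar>x - y\<bar>) / ?N)" .
    have prodpos: "0 < (\<Prod>y\<in>zeros n. \<bar>x - y\<bar> ^ weight n y)" using ne by (intro prod_pos) auto
    have "ln (\<Prod>y\<in>zeros n. \<bar>x - y\<bar> ^ weight n y) = (\<Sum>y\<in>zeros n. ln (\<bar>x - y\<bar> ^ weight n y))"
      by (rule ln_prod[OF finite_zeros]) (use ne in force)
    also have "\<dots> = (\<Sum>y\<in>zeros n. real (weight n y) * ln \<bar>x - y\<bar>)"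
      using ne by (intro sum.cong refl ln_realpow)
    finally have lnprod: "ln (\<Prod>y\<in>zeros n. \<bar>x - y\<bar> ^ weight n y) = (\<Sum>y\<in>zeros n. real (weight n y) * ln \<bar>x - y\<bar>)" .
    have pos: "0 < cmod (det (\<kappa> n))" using det_\<kappa> by simp
    have "ln (cmod (det (rpeval (p n) x))) = ln (cmod (det (\<kappa> n))) + (\<Sum>y\<in>zeros n. real (weight n y) * ln \<bar>x - y\<bar>)"
      unfolding cmod_det_p lnprod[symmetric] using pos prodpos by (intro ln_mult_pos)
    moreover have "ln (cmod (det (rpeval (p n) x))) \<le> ln H"
    proof (rule ln_mono[OF H])
      show "0 < cmod (det (rpeval (p n) x))" unfolding cmod_det_p using pos prodpos by simp
    qed
    ultimately have "(\<Sum>y\<in>zeros n. real (weight n y) * ln \<bar>x - y\<bar>) \<le> ln H + ln (cmod (det (jacobi_A_prod \<mu> p n)))"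
      by (simp add: ln_det_\<kappa>)
    then have "(\<Sum>y\<in>zeros n. real (weight n y) * ln \<bar>x - y\<bar>) / ?N \<le> (ln H + ln (cmod (det (jacobi_A_prod \<mu> p n)))) / ?N"
      using N by (intro divide_right_mono) auto
    then show ?thesis unfolding pot2 by (intro ennreal_leI) simp
  qed
qed

text \<open>
  The functions \<open>tr (p\<^sub>n\<^sup>\<dagger> M p\<^sub>n) / (n + 1)\<^sup>2\<close> have summable integrals, so at almost every point they are
  bounded in \<open>n\<close>. By the Cauchy-Schwarz inequality the entries of \<open>M p\<^sub>n\<close> are then of order \<open>n + 1\<close>, which
  bounds \<open>det M det p\<^sub>n\<close>.
\<close>

lemma AE_det_p_le:
  "AE x in mt. det (M x) \<noteq> 0 \<longrightarrow>
     (\<exists>C>0. \<forall>n. cmod (det (rpeval (p n) x)) \<le> C * real (Suc n) ^ CARD('l))"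
proof -
  define q where "q n j x = Re (qform (M x) (\<chi> a. poly (P n a j) (of_real x)))" for n j x
  have iq: "integrable mt (\<lambda>x. qform (M x) (\<chi> a. poly (P n a j) (of_real x)))" for n j
    using integrable_pform[of "\<lambda>a. P n a j" "\<lambda>a. P n a j"] by (simp add: pform_quadratic)
  have iq': "integrable mt (q n j)" for n j unfolding q_def by (rule integrable_Re[OF iq])
  have q1: "(LINT x|mt. q n j x) = 1" for n j
    unfolding q_def integral_Re[OF iq] using pform_P[of n j n j] by (simp add: pform_def pform_quadratic)
  have q0: "AE x in mt. \<forall>n j. 0 \<le> q n j x"
    using AE_psd by eventually_elim (simp add: q_def psd_def)
  define h where "h n x = (\<Sum>j\<in>UNIV. q n j x) / (real (Suc n))\<^sup>2" for n x
  have [measurable]: "h n \<in> borel_measurable mt" for n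
    unfolding h_def using borel_measurable_integrable[OF iq'] by measurable
  have ih: "integrable mt (h n)" for n
    unfolding h_def by (intro Bochner_Integration.integrable_divide Bochner_Integration.integrable_sum iq')
  have "(\<integral>\<^sup>+x. (\<Sum>n. ennreal (h n x)) \<partial>mt) = (\<Sum>n. \<integral>\<^sup>+x. ennreal (h n x) \<partial>mt)"
    by (rule nn_integral_suminf) measurable
  also have "\<dots> = (\<Sum>n. ennreal (CARD('l) / (real (Suc n))\<^sup>2))"
  proof (rule suminf_cong)
    fix n
    have "(\<integral>\<^sup>+x. ennreal (h n x) \<partial>mt) = ennreal (LINT x|mt. h n x)"
      by (rule nn_integral_eq_integral[OF ih])
        (use q0 in eventually_elim, auto simp: h_def intro!: divide_nonneg_nonneg sum_nonneg)
    also have "(LINT x|mt. h n x) = CARD('l) / (real (Suc n))\<^sup>2"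
      unfolding h_def integral_divide_zero by (simp add: Bochner_Integration.integral_sum iq' q1)
    finally show "(\<integral>\<^sup>+x. ennreal (h n x) \<partial>mt) = ennreal (CARD('l) / (real (Suc n))\<^sup>2)" .
  qed
  also have "\<dots> \<noteq> \<infinity>"
  proof -
    have "summable (\<lambda>n. inverse ((real (Suc n))\<^sup>2))"
      using inverse_power_summable[of 2, where 'a = real] by (subst summable_Suc_iff) simp
    then have "summable (\<lambda>n. CARD('l) / (real (Suc n))\<^sup>2)"
      unfolding divide_inverse by (rule summable_mult)
    then show ?thesis unfolding infinity_ennreal_def by (intro ennreal_suminf_neq_top) auto
  qed
  finally have "(\<integral>\<^sup>+x. (\<Sum>n. ennreal (h n x)) \<partial>mt) \<noteq> \<infinity>" .
  then have fin: "AE x in mt. (\<Sum>n. ennreal (h n x)) \<noteq> \<infinity>"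
    by (intro nn_integral_PInf_AE) auto
  show ?thesis
    using fin q0 AE_psd
  proof eventually_elim
    case (elim x)
    show ?case
    proof
      assume M0: "det (M x) \<noteq> 0"
      obtain s where s: "(\<Sum>n. ennreal (h n x)) = ennreal s" "0 \<le> s"
        using elim(1) by (cases "\<Sum>n. ennreal (h n x)") auto
      have hs: "h n x \<le> s" for n
      proof -
        have "ennreal (h n x) \<le> (\<Sum>n. ennreal (h n x))"
          using sum_le_suminf[of "\<lambda>n. ennreal (h n x)" "{n}"] by simp
        then show ?thesis using s by simp
      qed
      have qs: "q n j x \<le> s * (real (Suc n))\<^sup>2" for n j
      proof -
        have "q n j x \<le> (\<Sum>j\<in>UNIV. q n j x)" using elim(2) by (intro member_le_sum) auto
        also have "\<dots> = h n x * (real (Suc n))\<^sup>2" by (simp add: h_def)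
        also have "\<dots> \<le> s * (real (Suc n))\<^sup>2" by (intro mult_right_mono hs) auto
        finally show ?thesis .
      qed
      define m where "m = (\<Sum>i\<in>UNIV. Re (M x $ i $ i))"
      have m: "Re (M x $ i $ i) \<le> m" for i
        unfolding m_def using psd_diag[OF elim(3)] by (intro member_le_sum) auto
      have m0: "0 \<le> m" unfolding m_def using psd_diag[OF elim(3)] by (intro sum_nonneg) auto
      define C where "C = sqrt (m * s)"
      have C0: "0 \<le> C" using m0 s by (simp add: C_def)
      have entry: "cmod ((M x ** rpeval (p n) x) $ i $ j) \<le> C * real (Suc n)" for n i j
      proof -
        let ?v = "\<chi> a. poly (P n a j) (complex_of_real x)"
        have e: "(M x ** rpeval (p n) x) $ i $ j = (M x *v ?v) $ i"
          by (simp add: matrix_matrix_mult_def matrix_vector_mult_def mpeval_P)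
        have "(cmod ((M x *v ?v) $ i))\<^sup>2 \<le> Re (M x $ i $ i) * q n j x"
          unfolding q_def by (rule psd_Cauchy_Schwarz[OF elim(3)])
        also have "\<dots> \<le> m * (s * (real (Suc n))\<^sup>2)"
          using m qs m0 elim(2) by (intro mult_mono) auto
        also have "\<dots> = (C * real (Suc n))\<^sup>2"
          using m0 s by (simp add: C_def power_mult_distrib)
        finally show ?thesis unfolding e
          by (rule power2_le_imp_le) (use C0 in auto)
      qed
      have "cmod (det (rpeval (p n) x)) \<le> fact CARD('l) * C ^ CARD('l) / cmod (det (M x)) * real (Suc n) ^ CARD('l)" for n
      proof -
        have "cmod (det (M x)) * cmod (det (rpeval (p n) x)) = cmod (det (M x ** rpeval (p n) x))"
          by (simp add: det_mul norm_mult)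
        also have "\<dots> \<le> fact CARD('l) * (C * real (Suc n)) ^ CARD('l)"
          by (rule cmod_det_le[OF entry])
        also have "\<dots> = fact CARD('l) * C ^ CARD('l) * real (Suc n) ^ CARD('l)"
          by (simp only: power_mult_distrib mult.assoc)
        finally show ?thesis using M0 by (simp add: pos_le_divide_eq mult.commute del: of_nat_Suc)
      qed
      then have "cmod (det (rpeval (p n) x)) \<le> (fact CARD('l) * C ^ CARD('l) / cmod (det (M x)) + 1) * real (Suc n) ^ CARD('l)" for n
        by (rule order.trans) (simp add: distrib_right del: of_nat_Suc)
      moreover have "0 < fact CARD('l) * C ^ CARD('l) / cmod (det (M x)) + 1"
        using C0 by (intro add_nonneg_pos divide_nonneg_nonneg mult_nonneg_nonneg) auto
      ultimately show "\<exists>C>0. \<forall>n. cmod (det (rpeval (p n) x)) \<le> C * real (Suc n) ^ CARD('l)" by blast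
    qed
  qed
qed

end

section \<open>The dichotomy\<close>

lemma root_eq_exp_ln: "0 < n \<Longrightarrow> 0 < x \<Longrightarrow> root n x = exp (ln x / real n)"
  by (simp add: root_powr_inverse powr_def)

lemma robin_eq_energy:
  assumes \<rho>: "equilibrium_measure K \<rho>" and K: "K \<in> sets borel" and D: "1 \<le> D"
    and diam: "\<And>x y. x \<in> K \<Longrightarrow> y \<in> K \<Longrightarrow> \<bar>x - y\<bar> \<le> D" and cap: "0 < log_capacity K"
  obtains R where "0 \<le> R" "energy D \<rho> = ennreal R" "log_capacity K = exp (ln D - R)"
    "\<And>\<tau>. \<tau> \<in> prob_measures_on K \<Longrightarrow> ennreal R \<le> energy D \<tau>"
proof -
  have \<rho>K: "\<rho> \<in> prob_measures_on K" and rob: "log_energy \<rho> = robin K"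
    using \<rho> by (auto simp: equilibrium_measure_def)
  have le: "log_energy \<tau> = enn2ereal (energy D \<tau>) - ereal (ln D)" if "\<tau> \<in> prob_measures_on K" for \<tau>
    using that K D diam by (rule log_energy_eq_energy)
  have "robin K \<noteq> \<infinity>" using cap by (auto simp: log_capacity_def)
  then have "energy D \<rho> \<noteq> top" using rob le[OF \<rho>K] by (auto simp: top_ereal_def)
  then obtain R where R: "0 \<le> R" "energy D \<rho> = ennreal R" by (cases "energy D \<rho>") auto
  have robin: "robin K = ereal (R - ln D)" using rob le[OF \<rho>K] R by simp
  show ?thesis
  proof (rule that[OF R])
    show "log_capacity K = exp (ln D - R)" by (simp add: log_capacity_def robin)
    fix \<tau> assume \<tau>: "\<tau> \<in> prob_measures_on K"
    have "robin K \<le> log_energy \<tau>" unfolding robin_def by (rule INF_lower[OF \<tau>])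
    then have "ereal (R - ln D) \<le> enn2ereal (energy D \<tau>) - ereal (ln D)" by (simp only: robin le[OF \<tau>])
    then show "ennreal R \<le> energy D \<tau>"
      by (cases "energy D \<tau>") (auto intro: ennreal_leI)
  qed
qed

text \<open>
  Choosing \<open>D\<close> as at least twice the diameter keeps the minimal energy away from \<open>0\<close>. This matters because the
  truncation of negative numbers to \<open>0\<close> would hide a further decrease.
\<close>

lemma energy_ge_ln_2:
  assumes \<tau>: "\<tau> \<in> prob_measures_on K" and K: "K \<in> sets borel" and D: "0 < D"
    and diam: "\<And>x y. x \<in> K \<Longrightarrow> y \<in> K \<Longrightarrow> 2 * \<bar>x - y\<bar> \<le> D"
  shows "ennreal (ln 2) \<le> energy D \<tau>"
proof -
  interpret real_distribution \<tau> using \<tau> by (simp add: prob_measures_on_def)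
  have AEK: "AE x in \<tau>. x \<in> K"
    using \<tau> K by (subst prob_eq_1[symmetric]) (auto simp: prob_measures_on_def)
  have k: "ennreal (ln 2) \<le> lker D x y" if "x \<in> K" "y \<in> K" for x y
    using diam[OF that] D by (auto simp: lker_def pos_le_divide_eq intro!: ennreal_leI ln_mono)
  have "ennreal (ln 2) = (\<integral>\<^sup>+x. \<integral>\<^sup>+y. ennreal (ln 2) \<partial>\<tau> \<partial>\<tau>)"
    by (simp add: emeasure_space_1[simplified])
  also have "\<dots> \<le> energy D \<tau>"
    unfolding energy_def pot_def
  proof (rule nn_integral_mono_AE)
    show "AE x in \<tau>. (\<integral>\<^sup>+y. ennreal (ln 2) \<partial>\<tau>) \<le> (\<integral>\<^sup>+y. lker D x y \<partial>\<tau>)"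
      using AEK
    proof eventually_elim
      case (elim x)
      show ?case by (intro nn_integral_mono_AE) (use AEK in eventually_elim, use elim k in auto)
    qed
  qed
  finally show ?thesis .
qed

text \<open>
  An atom would make the potential infinite.
\<close>

lemma infinite_of_finite_pot:
  assumes \<rho>: "\<rho> \<in> prob_measures_on K" and pot: "\<And>x. pot D \<rho> x \<le> ennreal R"
  shows "infinite K"
proof
  assume fin: "finite K"
  interpret real_distribution \<rho> using \<rho> by (simp add: prob_measures_on_def)
  have "emeasure \<rho> {x} = 0" for x
  proof (rule ccontr)
    assume "emeasure \<rho> {x} \<noteq> 0"
    then have "\<infinity> = (\<integral>\<^sup>+y. \<infinity> * indicator {x} y \<partial>\<rho>)"
      by (subst nn_integral_cmult_indicator) (auto simp: ennreal_top_mult)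
    also have "\<dots> \<le> pot D \<rho> x"
      unfolding pot_def by (intro nn_integral_mono) (auto simp: lker_def indicator_def)
    finally show False using pot[of x] by (simp add: top_unique)
  qed
  then have "emeasure \<rho> K = 0"
    using fin by (subst emeasure_eq_sum_singleton) auto
  then show False using \<rho> by (simp add: prob_measures_on_def measure_def)
qed

lemma density_in_prob_measures_on:
  assumes \<rho>: "\<rho> \<in> prob_measures_on K" and K: "K \<in> sets borel" and h [measurable]: "h \<in> borel_measurable borel"
    and int: "(\<integral>\<^sup>+x. h x \<partial>\<rho>) = 1"
  shows "density \<rho> h \<in> prob_measures_on K"
proof -
  interpret real_distribution \<rho> using \<rho> by (simp add: prob_measures_on_def)
  have AEK: "AE x in \<rho>. x \<in> K"
    using \<rho> K by (subst prob_eq_1[symmetric]) (auto simp: prob_measures_on_def)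
  have "prob_space (density \<rho> h)" by (rule prob_spaceI) (simp add: emeasure_density int)
  then interpret d: prob_space "density \<rho> h" .
  have "AE x in density \<rho> h. x \<in> K" using AEK by (subst AE_density) auto
  then have "measure (density \<rho> h) K = 1" using K by (subst d.prob_eq_1) auto
  then show ?thesis
    by (simp add: prob_measures_on_def real_distribution_def real_distribution_axioms_def d.prob_space_axioms)
qed

lemma equilibrium_pot_le:
  assumes \<rho>: "\<rho> \<in> prob_measures_on K" and K: "K \<in> sets borel" and D: "0 < D"
    and R: "0 \<le> R" "energy D \<rho> = ennreal R"
    and min: "\<And>\<tau>. \<tau> \<in> prob_measures_on K \<Longrightarrow> ennreal R \<le> energy D \<tau>"
  shows "pot D \<rho> x \<le> ennreal R"
proof -
  have rd: "real_distribution \<rho>" using \<rho> by (simp add: prob_measures_on_def)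
  show ?thesis
    by (rule pot_le_of_AE[OF rd D R(1) energy_minimizer_pot_le_AE[OF rd R(2,1)]])
      (auto intro: min density_in_prob_measures_on[OF \<rho> K])
qed

context matrix_orthonormal_polynomials
begin

lemma eventually_ln_det_jacobi_A_prod_le:
  assumes inf: "infinite E" and D: "0 < D" and diam: "\<And>x y. x \<in> E \<Longrightarrow> y \<in> E \<Longrightarrow> \<bar>x - y\<bar> \<le> D"
    and R: "0 < R" and min: "\<And>\<tau>. \<tau> \<in> prob_measures_on E \<Longrightarrow> ennreal R \<le> energy D \<tau>"
    and e: "0 < e"
  shows "eventually (\<lambda>n. ln (cmod (det (jacobi_A_prod \<mu> p n)))
    \<le> ln (fact CARD('l)) + real CARD('l) * (real n * (ln D - R + e))) sequentially"
proof -
  have "eventually (\<lambda>n. \<exists>A (x :: nat \<Rightarrow> real). finite A \<and> card A = n \<and>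
    (\<forall>z\<in>E. (\<Prod>i\<in>A. \<bar>z - x i\<bar>) \<le> exp (real n * (ln D - R + e)))) sequentially"
    by (rule eventually_monic_poly_le_exp[OF compact_support inf D diam R min e])
  then show ?thesis
  proof eventually_elim
    case (elim n)
    then obtain A and x :: "nat \<Rightarrow> real" where A: "finite A" "card A = n"
      and le: "\<And>z. z \<in> E \<Longrightarrow> (\<Prod>i\<in>A. \<bar>z - x i\<bar>) \<le> exp (real n * (ln D - R + e))" by blast
    define T where "T = (\<Prod>i\<in>A. [:- complex_of_real (x i), 1:])"
    have degT: "degree T = n"
      unfolding T_def using A by (subst degree_prod_eq_sum_degree) auto
    have "lead_coeff T = 1" unfolding T_def by (subst lead_coeff_prod) simp
    then have "cmod (det (jacobi_A_prod \<mu> p n)) \<le> fact CARD('l) * exp (real n * (ln D - R + e)) ^ CARD('l)"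
    proof (intro det_jacobi_A_prod_le degT)
      fix z assume z: "z \<in> E"
      have "cmod (poly T (of_real z)) = (\<Prod>i\<in>A. cmod (of_real z - of_real (x i)))"
        unfolding T_def by (simp add: poly_prod flip: prod_norm)
      also have "\<dots> = (\<Prod>i\<in>A. \<bar>z - x i\<bar>)" by (simp flip: of_real_diff)
      finally show "cmod (poly T (of_real z)) \<le> exp (real n * (ln D - R + e))" using le[OF z] by simp
    qed (simp_all add: degT)
    then have "ln (cmod (det (jacobi_A_prod \<mu> p n))) \<le> ln (fact CARD('l) * exp (real n * (ln D - R + e)) ^ CARD('l))"
      by (intro ln_mono det_jacobi_A_prod_pos)
    also have "\<dots> = ln (fact CARD('l)) + real CARD('l) * (real n * (ln D - R + e))"
      by (subst ln_mult_pos) (auto simp: ln_realpow)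
    finally show ?case .
  qed
qed

text \<open>
  The upper bound holds for every measure, so regularity is a matter of the lower bound alone.
\<close>

lemma regular_if_lower_bound:
  assumes inf: "infinite E" and D: "0 < D" and diam: "\<And>x y. x \<in> E \<Longrightarrow> y \<in> E \<Longrightarrow> \<bar>x - y\<bar> \<le> D"
    and R: "0 < R" and min: "\<And>\<tau>. \<tau> \<in> prob_measures_on E \<Longrightarrow> ennreal R \<le> energy D \<tau>"
    and cap: "log_capacity E = exp (ln D - R)"
    and low: "\<And>\<delta>. 0 < \<delta> \<Longrightarrow> eventually (\<lambda>n. real CARD('l) * (ln D - R) - \<delta>
       \<le> ln (cmod (det (jacobi_A_prod \<mu> p (Suc n)))) / real (Suc n)) sequentially"
  shows "regular_measure \<mu> p"
proof -
  let ?l = "real CARD('l)"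
  define L where "L = ?l * (ln D - R)"
  define a where "a n = ln (cmod (det (jacobi_A_prod \<mu> p n))) / real n" for n
  have l: "0 < ?l" by simp
  have "a \<longlonglongrightarrow> L"
  proof (rule LIMSEQ_I)
    fix e :: real assume e: "0 < e"
    have "eventually (\<lambda>n. L - e / 2 \<le> a (Suc n)) sequentially"
      using low[of "e / 2"] e by (simp add: L_def a_def)
    then have 1: "eventually (\<lambda>n. L - e / 2 \<le> a n) sequentially"
      by (subst (asm) eventually_sequentially_Suc)
    define e' where "e' = e / (2 * ?l)"
    have e': "0 < e'" "?l * e' = e / 2" using e l by (auto simp: e'_def)
    have 2: "eventually (\<lambda>n. ln (cmod (det (jacobi_A_prod \<mu> p n)))
      \<le> ln (fact CARD('l)) + ?l * (real n * (ln D - R + e'))) sequentially"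
      by (rule eventually_ln_det_jacobi_A_prod_le[OF inf D diam R min e'(1)])
    have "(\<lambda>n. ln (fact CARD('l)) / real n) \<longlonglongrightarrow> 0"
      by (rule lim_const_over_n)
    then have 3: "eventually (\<lambda>n. ln (fact CARD('l)) / real n < e / 2) sequentially"
      by (rule order_tendstoD) (use e in simp)
    have "eventually (\<lambda>n. norm (a n - L) < e) sequentially"
      using 1 2 3 eventually_gt_at_top[of 0]
    proof eventually_elim
      case (elim n)
      have "a n \<le> (ln (fact CARD('l)) + ?l * (real n * (ln D - R + e'))) / real n"
        unfolding a_def using elim(2) by (rule divide_right_mono) simp
      also have "\<dots> = ln (fact CARD('l)) / real n + L + e / 2"
        using elim(4) e'(2) by (simp add: L_def add_divide_distrib) (simp add: algebra_simps)
      finally show ?case using elim(1,3) e unfolding real_norm_def by linarith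
    qed
    then show "\<exists>no. \<forall>n\<ge>no. norm (a n - L) < e" by (simp add: eventually_sequentially)
  qed
  then have "(\<lambda>n. exp (a n)) \<longlonglongrightarrow> exp L" by (rule tendsto_exp)
  moreover have "eventually (\<lambda>n. exp (a n) = root n (cmod (det (jacobi_A_prod \<mu> p n)))) sequentially"
    using eventually_gt_at_top[of 0]
    by eventually_elim (simp only: a_def root_eq_exp_ln[OF _ det_jacobi_A_prod_pos])
  ultimately have "(\<lambda>n. root n (cmod (det (jacobi_A_prod \<mu> p n)))) \<longlonglongrightarrow> exp L"
    by (rule Lim_transform_eventually)
  then show ?thesis
    unfolding regular_measure_def cap L_def exp_of_nat_mult[symmetric] .
qed

text \<open>
  Half of the excess \<open>2 e\<close> absorbs the polynomial growth of \<open>det p\<^sub>n(x)\<close>, which is invisible at the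
  exponential scale.
\<close>

lemma liminf_pot_ge:
  assumes r: "strict_mono r" and D: "0 < D" and diam: "\<And>n y. y \<in> zeros n \<Longrightarrow> \<bar>x - y\<bar> \<le> D"
    and small: "\<And>j. ln (cmod (det (jacobi_A_prod \<mu> p (Suc (r j))))) / real (Suc (r j))
        < real CARD('l) * (ln D - R) - real CARD('l) * (2 * e)" and e: "0 < e"
    and C: "0 < C" "\<And>n. cmod (det (rpeval (p n) x)) \<le> C * real (Suc n) ^ CARD('l)"
  shows "ennreal (R + e) \<le> liminf (\<lambda>j. pot D (zero_measure p (Suc (r j))) x)"
proof (rule Liminf_bounded)
  let ?l = "real CARD('l)"
  have l: "0 < ?l" by simp
  have "(\<lambda>n. (ln C + ?l * ln (real n + 2)) / ((real n + 1) * ?l)) \<longlonglongrightarrow> 0"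
    using l by real_asymp
  then have "(\<lambda>j. (ln C + ?l * ln (real (r j) + 2)) / ((real (r j) + 1) * ?l)) \<longlonglongrightarrow> 0"
    using LIMSEQ_subseq_LIMSEQ[OF _ r] by (auto simp: o_def)
  then have "eventually (\<lambda>j. (ln C + ?l * ln (real (r j) + 2)) / ((real (r j) + 1) * ?l) < e) sequentially"
    by (rule order_tendstoD) (rule e)
  then show "eventually (\<lambda>j. ennreal (R + e) \<le> pot D (zero_measure p (Suc (r j))) x) sequentially"
  proof eventually_elim
    case (elim j)
    let ?n = "Suc (r j)"
    let ?a = "ln (cmod (det (jacobi_A_prod \<mu> p ?n)))"
    have H: "ln (C * real (Suc ?n) ^ CARD('l)) = ln C + ?l * ln (real (r j) + 2)"
      using C(1) by (subst ln_mult_pos) (auto simp: ln_realpow add.commute)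
    have "?a / real ?n / ?l < (?l * (ln D - R) - ?l * (2 * e)) / ?l"
      using small[of j] l by (rule divide_strict_right_mono)
    also have "\<dots> = ln D - R - 2 * e" using l by (simp add: diff_divide_distrib)
    finally have a: "?a / real (?n * CARD('l)) < ln D - R - 2 * e"
      by (simp only: divide_divide_eq_left of_nat_mult)
    have N: "real (?n * CARD('l)) = (real (r j) + 1) * ?l" by (simp add: algebra_simps)
    have "R + e \<le> ln D - (ln (C * real (Suc ?n) ^ CARD('l)) + ?a) / real (?n * CARD('l))"
      using elim a unfolding H N add_divide_distrib[of _ ?a] by linarith
    then have "ennreal (R + e) \<le> ennreal (ln D - (ln (C * real (Suc ?n) ^ CARD('l)) + ?a) / real (?n * CARD('l)))"
      by (rule ennreal_leI)
    also have "\<dots> \<le> pot D (zero_measure p ?n) x"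
      by (rule pot_zero_measure_ge[OF _ D diam C(2)]) simp
    finally show ?case .
  qed
qed

end

lemma capacity_zeroI:
  assumes S: "S \<in> sets borel" and D: "1 \<le> D" and diam: "\<And>x y. x \<in> S \<Longrightarrow> y \<in> S \<Longrightarrow> \<bar>x - y\<bar> \<le> D"
    and inf: "\<And>\<sigma>. \<sigma> \<in> prob_measures_on S \<Longrightarrow> energy D \<sigma> = \<infinity>"
  shows "capacity_zero S"
  unfolding capacity_zero_def
proof (intro conjI allI impI S)
  fix K :: "real set" assume K: "compact K" "K \<subseteq> S"
  have Kb: "K \<in> sets borel" using compact_imp_closed[OF K(1)] by auto
  have "log_energy \<sigma> = \<infinity>" if \<sigma>: "\<sigma> \<in> prob_measures_on K" for \<sigma>
  proof -
    interpret real_distribution \<sigma> using \<sigma> by (simp add: prob_measures_on_def)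
    have "prob K \<le> prob S" using K S by (intro finite_measure_mono) auto
    then have "prob S = 1"
      using \<sigma> by (intro antisym prob_le_1) (simp add: prob_measures_on_def)
    then have "\<sigma> \<in> prob_measures_on S" using \<sigma> by (simp add: prob_measures_on_def)
    then have "energy D \<sigma> = \<infinity>" by (rule inf)
    moreover have "log_energy \<sigma> = enn2ereal (energy D \<sigma>) - ereal (ln D)"
      using \<sigma> Kb D by (rule log_energy_eq_energy) (use K diam in blast)
    ultimately show ?thesis by (simp add: top_ereal_def)
  qed
  then have "robin K = \<infinity>"
    unfolding robin_def by (simp add: top_ereal_def[symmetric])
  then show "log_capacity K = 0" by (simp add: log_capacity_def)
qed

lemma weak_conv_m_subseq: "weak_conv_m \<nu> \<rho> \<Longrightarrow> strict_mono r \<Longrightarrow> weak_conv_m (\<lambda>n. \<nu> (r n)) \<rho>"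
  unfolding weak_conv_m_def weak_conv_def using LIMSEQ_subseq_LIMSEQ by (fastforce simp: o_def)

theorem theorem5p3:
  fixes \<mu> :: "real set \<Rightarrow> complex^'l^'l"
    and M :: "real \<Rightarrow> complex^'l^'l"
    and p :: "nat \<Rightarrow> (complex^'l^'l) poly"
    and \<rho> :: "real measure"
  assumes "matrix_measure \<mu>" and "nontrivial \<mu>"
    and "compact (msupport \<mu>)" and "0 < log_capacity (msupport \<mu>)"
    and "trace_density \<mu> M"
    and "right_orthonormal \<mu> p"
    and "equilibrium_measure (msupport \<mu>) \<rho>"
    and "weak_conv_m (\<lambda>n. zero_measure p (Suc n)) \<rho>"
  shows "regular_measure \<mu> p \<or>
    (\<exists>S. capacity_zero S \<and> (AE x in trace_measure \<mu>. x \<notin> S \<longrightarrow> det (M x) = 0))"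
proof (rule disjCI)
  assume nonex: "\<nexists>S. capacity_zero S \<and> (AE x in trace_measure \<mu>. x \<notin> S \<longrightarrow> det (M x) = 0)"
  interpret matrix_orthonormal_polynomials \<mu> M p
    using assms by unfold_locales
  have Eb [measurable]: "E \<in> sets borel" using compact_imp_closed[OF compact_support] by auto
  obtain B where B: "0 < B" "\<And>x. x \<in> E \<Longrightarrow> - B \<le> x \<and> x \<le> B"
  proof -
    obtain B where "0 < B" "\<forall>x\<in>E. norm x \<le> B"
      using compact_imp_bounded[OF compact_support] bounded_pos by blast
    then show ?thesis by (intro that[of B]) (auto simp: abs_le_iff minus_le_iff)
  qed
  define D where "D = 4 * B + 1"
  have D: "1 \<le> D" "0 < D" using B(1) by (auto simp: D_def)
  have diam2: "2 * \<bar>x - y\<bar> \<le> D" if "- B \<le> x \<and> x \<le> B" "- B \<le> y \<and> y \<le> B" for x y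
  proof -
    have "\<bar>x - y\<bar> \<le> 2 * B" using that by (auto simp: abs_le_iff)
    then show ?thesis using B(1) by (simp add: D_def)
  qed
  have diam: "\<bar>x - y\<bar> \<le> D" if "- B \<le> x \<and> x \<le> B" "- B \<le> y \<and> y \<le> B" for x y
    using order.trans[OF _ diam2[OF that], of "\<bar>x - y\<bar>"] by simp
  have \<rho>E: "\<rho> \<in> prob_measures_on E" using assms(7) by (simp add: equilibrium_measure_def)
  have rd\<rho>: "real_distribution \<rho>" using \<rho>E by (simp add: prob_measures_on_def)
  obtain R where R: "0 \<le> R" "energy D \<rho> = ennreal R" "log_capacity E = exp (ln D - R)"
    and min: "\<And>\<tau>. \<tau> \<in> prob_measures_on E \<Longrightarrow> ennreal R \<le> energy D \<tau>"
    by (rule robin_eq_energy[OF assms(7) Eb D(1) _ assms(4)]) (use diam B(2) in blast)+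
  have "ennreal (ln 2) \<le> ennreal R"
    using energy_ge_ln_2[OF \<rho>E Eb D(2)] diam2 B(2) R(2) by simp
  then have "ln 2 \<le> R" using R(1) by (simp add: ennreal_le_iff)
  then have Rpos: "0 < R" by (rule less_le_trans[rotated]) simp
  have pot\<rho>: "pot D \<rho> x \<le> ennreal R" for x
    by (rule equilibrium_pot_le[OF \<rho>E Eb D(2) R(1,2) min])
  have inf: "infinite E" by (rule infinite_of_finite_pot[OF \<rho>E pot\<rho>])
  have zb: "- B \<le> y \<and> y \<le> B" if "y \<in> zeros n" for n y
    using zeros_bounds[OF B(2) that] .
  show "regular_measure \<mu> p"
  proof (rule regular_if_lower_bound[OF inf D(2) _ Rpos min R(3)])
    show "\<bar>x - y\<bar> \<le> D" if "x \<in> E" "y \<in> E" for x y using diam B(2) that by blast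
    fix \<delta> :: real assume \<delta>: "0 < \<delta>"
    show "eventually (\<lambda>n. real CARD('l) * (ln D - R) - \<delta>
       \<le> ln (cmod (det (jacobi_A_prod \<mu> p (Suc n)))) / real (Suc n)) sequentially"
    proof (rule ccontr)
      assume "\<not> ?thesis"
      then obtain r :: "nat \<Rightarrow> nat" where r: "strict_mono r"
        and small: "\<And>j. \<not> real CARD('l) * (ln D - R) - \<delta>
          \<le> ln (cmod (det (jacobi_A_prod \<mu> p (Suc (r j))))) / real (Suc (r j))"
        using not_eventually_sequentiallyD by blast
      define e where "e = \<delta> / (2 * real CARD('l))"
      have e: "0 < e" "real CARD('l) * (2 * e) = \<delta>" using \<delta> by (auto simp: e_def)
      define \<nu> where "\<nu> j = zero_measure p (Suc (r j))" for j
      have \<nu>: "real_distribution (\<nu> j)" for j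
        unfolding \<nu>_def by (rule real_distribution_zero_measure) simp
      have conv: "weak_conv_m \<nu> \<rho>"
        using weak_conv_m_subseq[OF assms(8) r] by (simp add: \<nu>_def[abs_def])
      have [measurable]: "pot D (\<nu> j) \<in> borel_measurable borel" for j
      proof -
        interpret real_distribution "\<nu> j" by (rule \<nu>)
        show ?thesis by (rule pot_measurable) (auto simp: finite_measure_axioms)
      qed
      define S where "S = {x \<in> E. ennreal (R + e) \<le> liminf (\<lambda>j. pot D (\<nu> j) x)}"
      have Sb: "S \<in> sets borel" unfolding S_def by measurable
      have "capacity_zero S"
      proof (rule capacity_zeroI[OF Sb D(1)])
        show "\<bar>x - y\<bar> \<le> D" if "x \<in> S" "y \<in> S" for x y using diam B(2) that by (auto simp: S_def)
        fix \<sigma> assume \<sigma>: "\<sigma> \<in> prob_measures_on S"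
        then have rd: "real_distribution \<sigma>" by (simp add: prob_measures_on_def)
        interpret sg: real_distribution \<sigma> by (rule rd)
        have "AE x in \<sigma>. x \<in> S"
          using \<sigma> Sb by (subst sg.prob_eq_1[symmetric]) (auto simp: prob_measures_on_def)
        then have lim: "AE x in \<sigma>. ennreal (R + e) \<le> liminf (\<lambda>j. pot D (\<nu> j) x)"
          by eventually_elim (simp add: S_def)
        have "R < R + e" using e by simp
        then show "energy D \<sigma> = \<infinity>"
          by (rule energy_infinite_of_liminf_pot[OF \<nu> rd\<rho> conv D(2) R(1) _ pot\<rho> rd lim])
      qed
      moreover have "AE x in mt. x \<notin> S \<longrightarrow> det (M x) = 0"
        using AE_E AE_det_p_le
      proof eventually_elim
        case (elim x)
        show ?case
        proof (intro impI, rule ccontr)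
          assume "x \<notin> S" "det (M x) \<noteq> 0"
          then obtain C where C: "0 < C" "\<And>n. cmod (det (rpeval (p n) x)) \<le> C * real (Suc n) ^ CARD('l)"
            using elim(2) by blast
          have "ennreal (R + e) \<le> liminf (\<lambda>j. pot D (\<nu> j) x)"
            unfolding \<nu>_def
          proof (rule liminf_pot_ge[OF r D(2) _ _ e(1) C])
            show "\<bar>x - y\<bar> \<le> D" if "y \<in> zeros n" for n y
              by (rule diam[OF B(2)[OF elim(1)] zb[OF that]])
            show "ln (cmod (det (jacobi_A_prod \<mu> p (Suc (r j))))) / real (Suc (r j))
              < real CARD('l) * (ln D - R) - real CARD('l) * (2 * e)" for j
              using small[of j] unfolding e(2) by simp
          qed
          then show False using \<open>x \<notin> S\<close> elim(1) by (simp add: S_def)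
        qed
      qed
      ultimately show False using nonex by blast
    qed
  qed
qed

end
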